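(* Let $N,d\in\mathbb{N}$, let $\Omega\subset\mathbb{R}^N$ be a bounded open set, and let $W:\Omega\times\Omega\times\mathbb{R}^{d\times N}\times\mathbb{R}^{d\times N}\to\mathbb{R}$ be a normal integrand, bounded from below, such that $W(x,y,\cdot,\cdot)$ is separately curl Young quasiconvex for $\mathcal{L}^N\otimes\mathcal{L}^N$-a.e. $(x,y)\in\Omega\times\Omega$. Let $F:W^{1,\infty}(\Omega;\mathbb{R}^d)\to\mathbb{R}\cup\{+\infty\}$ be the functional defined by $$F(u)=\operatorname*{ess\,sup}_{(x,y)\in\Omega\times\Omega}W(x,y,\nabla u(x),\nabla u(y)).$$ Then $F$ is sequentially weakly* lower semicontinuous in $W^{1,\infty}(\Omega;\mathbb{R}^d)$; that is, whenever $(u_j)_j\subset W^{1,\infty}(\Omega;\mathbb{R}^d)$ converges weakly* in $W^{1,\infty}(\Omega;\mathbb{R}^d)$ to $u\in W^{1,\infty}(\Omega;\mathbb{R}^d)$, one has $F(u)\le\liminf_{j\to\infty}F(u_j)$.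
   Context: $\mathcal{L}^N$ is Lebesgue measure on $\mathbb{R}^N$; the essential supremum defining $F$ is with respect to $\mathcal{L}^N\otimes\mathcal{L}^N$. Weak* convergence $u_j\to u$ in $W^{1,\infty}(\Omega;\mathbb{R}^d)$ means that $u_j\to u$ weakly* in $L^\infty(\Omega;\mathbb{R}^d)$ and $\nabla u_j\to\nabla u$ weakly* in $L^\infty(\Omega;\mathbb{R}^{d\times N})$. Normal integrand: $W$ is measurable with respect to the product of the Lebesgue $\sigma$-algebra on $\Omega\times\Omega$ and the Borel $\sigma$-algebra on $\mathbb{R}^{d\times N}\times\mathbb{R}^{d\times N}$, and $W(x,y,\cdot,\cdot)$ is lower semicontinuous for a.e. $(x,y)\in\Omega\times\Omega$. For a probability measure $\lambda$ on $\mathbb{R}^l$ and a Borel function $g:\mathbb{R}^l\to\mathbb{R}$, $\lambda\text{-}\operatorname{ess\,sup}_{\xi\in\mathbb{R}^l}g(\xi)=\inf\{t\in\mathbb{R}:\lambda(\{g>t\})=0\}$ (with $\inf\emptyset=+\infty$). If $\lambda$ has a barycenter, write $[\lambda]=\int_{\mathbb{R}^l}\xi\,d\lambda(\xi)$. Young measures: let $U\subset\mathbb{R}^n$ be Lebesgue measurable with finite measure. A Young measure $\nu=\{\nu_x\}_{x\in U}$ is an essentially bounded, weakly* measurable map from $U$ into the bounded Radon measures on $\mathbb{R}^m$ such that $\nu_x$ is a probability measure for a.e. $x\in U$. It is homogeneous if there is a single probability measure $\nu_0$ with $\nu_x=\nu_0$ for a.e. $x\in U$; it is then identified with $\nu_0$.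 A sequence of measurable functions $z_j:U\to\mathbb{R}^m$ generates $\nu$ if for every $h\in L^1(U)$ and $\varphi\in C_0(\mathbb{R}^m)$, $$\lim_{j\to\infty}\int_U h(x)\varphi(z_j(x))\,dx=\int_U h(x)\int_{\mathbb{R}^m}\varphi(\xi)\,d\nu_x(\xi)\,dx.$$ A $W^{1,\infty}$-gradient Young measure on a bounded open set $U\subset\mathbb{R}^N$ is a Young measure (with $\mathbb{R}^m=\mathbb{R}^{d\times N}$) generated by a sequence of gradients $(\nabla u_j)_j$, where $(u_j)_j$ is a bounded sequence in $W^{1,\infty}(U;\mathbb{R}^d)$. A probability measure $\nu$ on $\mathbb{R}^{d\times N}$ is called a (homogeneous) $W^{1,\infty}$-gradient Young measure if the constant family $\nu_x=\nu$ is a $W^{1,\infty}$-gradient Young measure on the unit cube $Q=\,]0,1[^N$. Separate curl Young quasiconvexity: a lower semicontinuous function $V:\mathbb{R}^{d\times N}\times\mathbb{R}^{d\times N}\to\mathbb{R}$ is separately curl Young quasiconvex if for all probability measures $\nu,\mu$ on $\mathbb{R}^{d\times N}$ that are (homogeneous) $W^{1,\infty}$-gradient Young measures, $$V([\nu],[\mu])\le(\nu\otimes\mu)\text{-}\operatorname*{ess\,sup}_{(\xi,\zeta)\in\mathbb{R}^{d\times N}\times\mathbb{R}^{d\times N}}V(\xi,\zeta),$$ where the right-hand side equals $\nu\text{-}\operatorname{ess\,sup}_{\xi}\bigl(\mu\text{-}\operatorname{ess\,sup}_{\zeta}V(\xi,\zeta)\bigr)=\mu\text{-}\operatorname{ess\,sup}_{\zeta}\bigl(\nu\text{-}\operatorname{ess\,sup}_{\xi}V(\xi,\zeta)\bigr)$.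 *)

theory Defs
  imports "HOL-Probability.Probability"
begin

section \<open>Sobolev functions\<close>

text \<open>
  Functions on \<open>\<Omega> \<subseteq> \<real>\<^sup>N\<close> with values in \<open>\<real>\<^sup>d\<close> are total functions of type
  \<open>real ^ 'n \<Rightarrow> real ^ 'd\<close>, and their gradients are functions into the \<open>d \<times> N\<close> matrices
  \<open>real ^ 'n ^ 'd\<close>. Elements of Lebesgue and Sobolev spaces are represented by functions;
  all notions below are invariant under changes on null sets and outside the domain.
\<close>

definition partial_deriv :: "'n \<Rightarrow> (real ^ 'n \<Rightarrow> real) \<Rightarrow> real ^ 'n \<Rightarrow> real" where
  "partial_deriv j \<phi> x = frechet_derivative \<phi> (at x) (axis j 1)"

primrec C_k :: "nat \<Rightarrow> (real ^ 'n \<Rightarrow> real) \<Rightarrow> bool" where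
  "C_k 0 \<phi> \<longleftrightarrow> continuous_on UNIV \<phi>"
| "C_k (Suc k) \<phi> \<longleftrightarrow> (\<forall>x. \<phi> differentiable (at x)) \<and> (\<forall>j. C_k k (partial_deriv j \<phi>))"

definition test_functions :: "(real ^ 'n) set \<Rightarrow> (real ^ 'n \<Rightarrow> real) set" where
  "test_functions \<Omega> =
    {\<phi>. (\<forall>k. C_k k \<phi>) \<and> compact (closure {x. \<phi> x \<noteq> 0}) \<and> closure {x. \<phi> x \<noteq> 0} \<subseteq> \<Omega>}"

definition Linf :: "'a::euclidean_space set \<Rightarrow> ('a \<Rightarrow> 'b::euclidean_space) set" where
  "Linf U = {f. f \<in> borel_measurable (lebesgue_on U) \<and>
                (\<exists>C. AE x in lebesgue_on U. norm (f x) \<le> C)}"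

definition has_weak_gradient ::
  "(real ^ 'n) set \<Rightarrow> (real ^ 'n \<Rightarrow> real ^ 'd) \<Rightarrow> (real ^ 'n \<Rightarrow> real ^ 'n ^ 'd) \<Rightarrow> bool" where
  "has_weak_gradient \<Omega> u G \<longleftrightarrow> G \<in> Linf \<Omega> \<and>
    (\<forall>\<phi> \<in> test_functions \<Omega>. \<forall>i j.
      (LINT x|lebesgue_on \<Omega>. u x $ i * partial_deriv j \<phi> x)
        = - (LINT x|lebesgue_on \<Omega>. G x $ i $ j * \<phi> x))"

definition W1inf :: "(real ^ 'n) set \<Rightarrow> (real ^ 'n \<Rightarrow> real ^ 'd) set" where
  "W1inf \<Omega> = {u \<in> Linf \<Omega>. \<exists>G. has_weak_gradient \<Omega> u G}"

text \<open>A representative of the weak gradient, which on an open set is unique almost everywhere.\<close>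

definition weak_gradient ::
  "(real ^ 'n) set \<Rightarrow> (real ^ 'n \<Rightarrow> real ^ 'd) \<Rightarrow> real ^ 'n \<Rightarrow> real ^ 'n ^ 'd" where
  "weak_gradient \<Omega> u = (SOME G. has_weak_gradient \<Omega> u G)"

definition W1inf_bounded_sequence ::
  "(real ^ 'n) set \<Rightarrow> (nat \<Rightarrow> real ^ 'n \<Rightarrow> real ^ 'd) \<Rightarrow> bool" where
  "W1inf_bounded_sequence \<Omega> u \<longleftrightarrow> (\<forall>j. u j \<in> W1inf \<Omega>) \<and>
    (\<exists>C. \<forall>j. AE x in lebesgue_on \<Omega>.
        norm (u j x) \<le> C \<and> norm (weak_gradient \<Omega> (u j) x) \<le> C)"

text \<open>For matrices the inner product of the library is the Frobenius product.\<close>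

definition Linf_weakstar_tendsto ::
  "'a::euclidean_space set \<Rightarrow> (nat \<Rightarrow> 'a \<Rightarrow> 'b::euclidean_space) \<Rightarrow> ('a \<Rightarrow> 'b) \<Rightarrow> bool" where
  "Linf_weakstar_tendsto U f g \<longleftrightarrow>
    (\<forall>h. integrable (lebesgue_on U) h \<longrightarrow>
      (\<lambda>j. LINT x|lebesgue_on U. f j x \<bullet> h x) \<longlonglongrightarrow> (LINT x|lebesgue_on U. g x \<bullet> h x))"

definition W1inf_weakstar_tendsto ::
  "(real ^ 'n) set \<Rightarrow> (nat \<Rightarrow> real ^ 'n \<Rightarrow> real ^ 'd) \<Rightarrow> (real ^ 'n \<Rightarrow> real ^ 'd) \<Rightarrow> bool" where
  "W1inf_weakstar_tendsto \<Omega> u v \<longleftrightarrow>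
    Linf_weakstar_tendsto \<Omega> u v \<and>
    Linf_weakstar_tendsto \<Omega> (\<lambda>j. weak_gradient \<Omega> (u j)) (weak_gradient \<Omega> v)"


section \<open>Young measures\<close>

definition C_0 :: "('b::euclidean_space \<Rightarrow> real) set" where
  "C_0 = {\<phi>. continuous_on UNIV \<phi> \<and> (\<phi> \<longlongrightarrow> 0) at_infinity}"

text \<open>
  The values on a null set are irrelevant, so \<open>\<nu> x\<close> is only required to be a Borel
  (probability) measure for almost every \<open>x\<close>. Essential boundedness in total variation is then
  automatic.
\<close>

definition young_measure ::
  "'a::euclidean_space set \<Rightarrow> ('a \<Rightarrow> 'b::euclidean_space measure) \<Rightarrow> bool" where
  "young_measure U \<nu> \<longleftrightarrow>
    (AE x in lebesgue_on U. sets (\<nu> x) = sets borel \<and> prob_space (\<nu> x)) \<and>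
    (\<forall>\<phi> \<in> C_0. (\<lambda>x. LINT \<xi>|\<nu> x. \<phi> \<xi>) \<in> borel_measurable (lebesgue_on U))"

definition generates ::
  "'a::euclidean_space set \<Rightarrow> (nat \<Rightarrow> 'a \<Rightarrow> 'b::euclidean_space) \<Rightarrow> ('a \<Rightarrow> 'b measure) \<Rightarrow> bool" where
  "generates U z \<nu> \<longleftrightarrow>
    (\<forall>j. z j \<in> borel_measurable (lebesgue_on U)) \<and>
    (\<forall>h. \<forall>\<phi> \<in> C_0. integrable (lebesgue_on U) h \<longrightarrow>
      (\<lambda>j. LINT x|lebesgue_on U. h x * \<phi> (z j x))
        \<longlonglongrightarrow> (LINT x|lebesgue_on U. h x * (LINT \<xi>|\<nu> x. \<phi> \<xi>)))"

definition W1inf_gradient_young_measure ::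
  "(real ^ 'n) set \<Rightarrow> (real ^ 'n \<Rightarrow> (real ^ 'n ^ 'd) measure) \<Rightarrow> bool" where
  "W1inf_gradient_young_measure U \<nu> \<longleftrightarrow> young_measure U \<nu> \<and>
    (\<exists>u. W1inf_bounded_sequence U u \<and> generates U (\<lambda>j. weak_gradient U (u j)) \<nu>)"

definition unit_cube :: "(real ^ 'n) set" where
  "unit_cube = box 0 (\<chi> i. 1)"

definition homogeneous_W1inf_gradient_young_measure :: "(real ^ 'n ^ 'd) measure \<Rightarrow> bool" where
  "homogeneous_W1inf_gradient_young_measure \<nu> \<longleftrightarrow>
    sets \<nu> = sets borel \<and> prob_space \<nu> \<and>
    W1inf_gradient_young_measure (unit_cube :: (real ^ 'n) set) (\<lambda>x. \<nu>)"

definition barycenter :: "'b::euclidean_space measure \<Rightarrow> 'b" where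
  "barycenter \<nu> = (LINT \<xi>|\<nu>. \<xi>)"


section \<open>Supremal integrands\<close>

definition lower_semicontinuous :: "('b::topological_space \<Rightarrow> real) \<Rightarrow> bool" where
  "lower_semicontinuous f \<longleftrightarrow> (\<forall>x. \<forall>t < f x. \<forall>\<^sub>F y in nhds x. t < f y)"

text \<open>
  \<open>esssup\<close> is the essential supremum of the library, taken in the extended reals. It is \<open>\<infinity>\<close> by
  convention for non-measurable functions; the functions it is applied to below are
  measurable in all relevant cases.
\<close>

definition separately_curl_Young_quasiconvex ::
  "(real ^ 'n ^ 'd \<Rightarrow> real ^ 'n ^ 'd \<Rightarrow> real) \<Rightarrow> bool" where
  "separately_curl_Young_quasiconvex V \<longleftrightarrow>
    lower_semicontinuous (\<lambda>(\<xi>, \<zeta>). V \<xi> \<zeta>) \<and>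
    (\<forall>\<nu> \<mu>. homogeneous_W1inf_gradient_young_measure \<nu> \<longrightarrow>
           homogeneous_W1inf_gradient_young_measure \<mu> \<longrightarrow>
       ereal (V (barycenter \<nu>) (barycenter \<mu>))
         \<le> esssup (\<nu> \<Otimes>\<^sub>M \<mu>) (\<lambda>(\<xi>, \<zeta>). ereal (V \<xi> \<zeta>)))"

text \<open>
  On \<open>\<Omega> \<times> \<Omega>\<close> we use the Lebesgue measure of the product space, i.e. the completion of the
  product of the Lebesgue measures on the factors.
\<close>

definition normal_integrand ::
  "(real ^ 'n) set \<Rightarrow>
   (real ^ 'n \<Rightarrow> real ^ 'n \<Rightarrow> real ^ 'n ^ 'd \<Rightarrow> real ^ 'n ^ 'd \<Rightarrow> real) \<Rightarrow> bool" where
  "normal_integrand \<Omega> W \<longleftrightarrow>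
    (\<lambda>((x, y), (\<xi>, \<zeta>)). W x y \<xi> \<zeta>)
      \<in> borel_measurable (lebesgue_on (\<Omega> \<times> \<Omega>) \<Otimes>\<^sub>M borel) \<and>
    (AE (x, y) in lebesgue_on (\<Omega> \<times> \<Omega>). lower_semicontinuous (\<lambda>(\<xi>, \<zeta>). W x y \<xi> \<zeta>))"

definition supremal_functional ::
  "(real ^ 'n) set \<Rightarrow>
   (real ^ 'n \<Rightarrow> real ^ 'n \<Rightarrow> real ^ 'n ^ 'd \<Rightarrow> real ^ 'n ^ 'd \<Rightarrow> real) \<Rightarrow>
   (real ^ 'n \<Rightarrow> real ^ 'd) \<Rightarrow> ereal" where
  "supremal_functional \<Omega> W u =
    esssup (lebesgue_on (\<Omega> \<times> \<Omega>))
      (\<lambda>(x, y). ereal (W x y (weak_gradient \<Omega> u x) (weak_gradient \<Omega> u y)))"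

end

theory Submission
  imports Defs
begin

text \<open>
  Suppose that \<open>F(u\<^sub>j) \<le> c\<close> along a subsequence; the claim is \<open>F(v) \<le> c\<close> for the limit \<open>v\<close>. The gradients \<open>z\<^sub>j\<close> of the \<open>u\<^sub>j\<close> converge weakly*,
  hence they are essentially bounded by a common constant \<open>M\<close> (\<open>gliding_hump_bounded\<close>), and a further
  subsequence generates a Young measure \<open>\<nu>\<close>. Blowing up at almost every point \<open>x\<close> shows that the
  single measure \<open>\<nu> x\<close> is a homogeneous gradient Young measure, and its barycenter is \<open>\<nabla>v(x)\<close>
  (\<open>gradient_young_measure_exists\<close>). So quasiconvexity bounds \<open>W x y (\<nabla>v x) (\<nabla>v y)\<close> by the
  essential supremum of \<open>W x y\<close> for \<open>\<nu> x \<otimes> \<nu> y\<close>, and it remains to see that this is at most \<open>c\<close>.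

  Tensor products of weakly* convergent sequences converge weakly* (\<open>weakstar_tendsto_tensor\<close>).
  Let \<open>B\<close> and \<open>B'\<close> be open sets, and let \<open>A\<close> be the set of all \<open>(x, y)\<close> for which the pair
  \<open>(z\<^sub>j x, z\<^sub>j y)\<close> is in \<open>B \<times> B'\<close> for no \<open>j\<close>. Passing to the limit in the products of two functions
  that are positive exactly on \<open>B\<close> and \<open>B'\<close> gives \<open>\<nu> x B = 0\<close> or \<open>\<nu> y B' = 0\<close> for almost all
  \<open>(x, y)\<close> in \<open>A\<close> (\<open>weakstar_tensor_AE_zero\<close>). With \<open>B\<close> and \<open>B'\<close> ranging over a countable
  base, \<open>\<nu> x \<otimes> \<nu> y\<close> is concentrated, for almost all \<open>(x, y)\<close>, on the closure of the set of pairs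
  \<open>(z\<^sub>j x, z\<^sub>j y)\<close>. On that closure \<open>W x y \<le> c\<close>, because this holds at the pairs themselves and
  \<open>W x y\<close> is lower semicontinuous (\<open>product_esssup_le\<close>). The argument works with
  the whole sequence of pairs at a fixed \<open>(x, y)\<close>, so that it never has to approximate \<open>W\<close> by functions
  that are continuous in the matrices.

  Young measures are constructed as follows. A continuous curve \<open>dec\<close> defined on \<open>[0, 1]\<close>
  covers the ball of radius \<open>M\<close> in the space of matrices (\<open>continuous_curve_through_ball\<close>), and it has a
  Borel section \<open>code\<close>. The scalar sequence \<open>code z\<^sub>j\<close> has values in \<open>[0, 1]\<close>; along a
  subsequence all its powers converge weakly* to functions \<open>m\<^sub>i\<close> (\<open>weakstar_compactness\<close>). For almost every
  \<open>x\<close> the numbers \<open>m\<^sub>i x\<close> are the moments of a probability measure \<open>\<Lambda> x\<close> on \<open>[0, 1]\<close>, and \<open>\<nu> x\<close> is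
  its image under \<open>dec\<close>: since \<open>z\<^sub>j = dec (code z\<^sub>j)\<close>, the Weierstrass theorem carries convergence
  from powers to all continuous functions of \<open>z\<^sub>j\<close> (\<open>weakstar_limit_of_moments\<close>).

  The existence of \<open>\<Lambda> x\<close> and the homogeneity come from the same blow-up
  (\<open>blow_up_homogeneous_gradient_young_measure\<close>). At a common Lebesgue point \<open>x\<close> of all \<open>m\<^sub>i\<close>, suitable
  rescalings \<open>y \<mapsto> code (z\<^sub>j (x + r y))\<close> on the unit cube, with \<open>r\<close> tending to \<open>0\<close>, have powers that
  converge weakly* to the constants \<open>m\<^sub>i x\<close>, and Helly's selection theorem produces \<open>\<Lambda> x\<close>. The rescaled
  matrix fields are gradients of \<open>(u\<^sub>j (x + r y) - a) / r\<close> with constants \<open>a\<close>, and for a suitable \<open>a\<close>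
  this is bounded in terms of \<open>M\<close>, because a function with a bounded
  weak gradient on a cube oscillates by at most a multiple of the side length
  (\<open>weak_gradient_oscillation_bound\<close>).
\<close>

section \<open>Cubes and Lebesgue points\<close>

definition cube :: "'a::euclidean_space \<Rightarrow> real \<Rightarrow> 'a set" where
  "cube x r = box x (x + r *\<^sub>R One)"

lemma unit_cube_eq_cube: "(unit_cube :: (real ^ 'n) set) = cube 0 1"
proof -
  have "(\<chi> i. 1) = (One :: real ^ 'n)"
  proof (rule euclidean_eqI)
    fix b :: "real ^ 'n" assume b: "b \<in> Basis"
    then obtain i where "b = axis i 1" by (auto simp: Basis_vec_def)
    then have "(\<chi> i. 1) \<bullet> b = 1" by (simp add: inner_axis)
    then show "(\<chi> i. 1) \<bullet> b = One \<bullet> b" using b by simp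
  qed
  then show ?thesis by (simp add: unit_cube_def cube_def)
qed

lemma borel_cube [measurable, simp]: "cube x r \<in> sets borel"
  by (simp add: cube_def)

lemma cube_lebesgue [simp]: "cube x r \<in> sets lebesgue"
  by (simp add: cube_def)

lemma emeasure_cube: "0 \<le> r \<Longrightarrow> emeasure lborel (cube (x::'a::euclidean_space) r) = ennreal (r ^ DIM('a))"
  unfolding cube_def by (subst emeasure_lborel_box) (auto simp: inner_simps)

lemma borel_lebesgue_on [measurable (raw)]:
  "f \<in> borel_measurable borel \<Longrightarrow> f \<in> borel_measurable (lebesgue_on S)"
  by (intro measurable_restrict_space1 measurable_completion) simp

lemma integral_lebesgue_on_borel:
  fixes f :: "'a::euclidean_space \<Rightarrow> 'b::{banach, second_countable_topology}"
  assumes [measurable]: "S \<in> sets borel" "f \<in> borel_measurable borel"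
  shows "(LINT x|lebesgue_on S. f x) = (LINT x|lborel. indicator S x *\<^sub>R f x)"
    and "integrable (lebesgue_on S) f \<longleftrightarrow> integrable lborel (\<lambda>x. indicator S x *\<^sub>R f x)"
  by (simp_all add: integral_restrict_space integral_completion integrable_restrict_space integrable_completion)

lemma lborel_integral_affine:
  fixes f :: "'a::euclidean_space \<Rightarrow> 'b::{banach, second_countable_topology}"
  assumes [measurable]: "f \<in> borel_measurable borel" and r: "r \<noteq> 0"
  shows "(LINT x|lborel. f x) = \<bar>r\<bar> ^ DIM('a) *\<^sub>R (LINT y|lborel. f (t + r *\<^sub>R y))"
    and "integrable lborel f \<longleftrightarrow> integrable lborel (\<lambda>y. f (t + r *\<^sub>R y))"
proof -
  show "(LINT x|lborel. f x) = \<bar>r\<bar> ^ DIM('a) *\<^sub>R (LINT y|lborel. f (t + r *\<^sub>R y))"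
    by (subst lborel_affine[OF r, of t]) (simp add: integral_density integral_distr)
  have "integrable lborel f \<longleftrightarrow> integrable lborel (\<lambda>y. \<bar>r\<bar> ^ DIM('a) *\<^sub>R f (t + r *\<^sub>R y))"
    by (subst lborel_affine[OF r, of t]) (simp add: integrable_density integrable_distr_eq)
  also have "\<dots> \<longleftrightarrow> integrable lborel (\<lambda>y. f (t + r *\<^sub>R y))"
    using r integrable_scaleR_right[of "1 / \<bar>r\<bar> ^ DIM('a)" lborel "\<lambda>y. \<bar>r\<bar> ^ DIM('a) *\<^sub>R f (t + r *\<^sub>R y)"]
    by (auto intro: integrable_scaleR_right)
  finally show "integrable lborel f \<longleftrightarrow> integrable lborel (\<lambda>y. f (t + r *\<^sub>R y))" .
qed

lemma prob_space_cube: "prob_space (lebesgue_on (cube (0::'a::euclidean_space) 1))"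
  by (rule prob_spaceI) (simp add: emeasure_restrict_space emeasure_cube)

lemma mem_cube_affine:
  assumes "0 < r" shows "x + r *\<^sub>R y \<in> cube x r \<longleftrightarrow> y \<in> cube 0 1"
  using assms by (auto simp: cube_def box_def inner_simps zero_less_mult_iff)

lemma integral_cube_rescale:
  fixes f :: "'a::euclidean_space \<Rightarrow> 'b::{banach, second_countable_topology}"
  assumes [measurable]: "f \<in> borel_measurable borel" and r: "0 < r"
  shows "(LINT z|lebesgue_on (cube x r). f z)
    = r ^ DIM('a) *\<^sub>R (LINT y|lebesgue_on (cube 0 1). f (x + r *\<^sub>R y))"
proof -
  have "(LINT z|lebesgue_on (cube x r). f z) = (LINT z|lborel. indicator (cube x r) z *\<^sub>R f z)"
    by (simp add: integral_lebesgue_on_borel)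
  also have "\<dots> = r ^ DIM('a) *\<^sub>R (LINT y|lborel. indicator (cube x r) (x + r *\<^sub>R y) *\<^sub>R f (x + r *\<^sub>R y))"
    using r by (subst lborel_integral_affine[where r=r and t=x]) auto
  also have "(\<lambda>y. indicator (cube x r) (x + r *\<^sub>R y) *\<^sub>R f (x + r *\<^sub>R y))
      = (\<lambda>y. indicator (cube 0 1) y *\<^sub>R f (x + r *\<^sub>R y))"
    using mem_cube_affine[OF r, of x] by (auto simp: indicator_def fun_eq_iff)
  finally show ?thesis by (simp add: integral_lebesgue_on_borel)
qed

lemma finite_measure_lebesgue_on_bounded:
  assumes "bounded S" "S \<in> sets lebesgue"
  shows "finite_measure (lebesgue_on S)"
proof (rule finite_measureI)
  have "S \<in> lmeasurable" using assms by (rule bounded_set_imp_lmeasurable)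
  then have "emeasure lebesgue S < \<infinity>" by (simp add: fmeasurable_def del: emeasure_completion)
  then show "emeasure (lebesgue_on S) (space (lebesgue_on S)) \<noteq> \<infinity>"
    using assms by (simp add: emeasure_restrict_space del: emeasure_completion)
qed

lemma integrable_cube_bounded:
  fixes f :: "'a::euclidean_space \<Rightarrow> real"
  assumes "f \<in> borel_measurable (lebesgue_on (cube x r))" "\<And>x. \<bar>f x\<bar> \<le> C"
  shows "integrable (lebesgue_on (cube x r)) f"
proof -
  interpret finite_measure "lebesgue_on (cube x r)"
    by (rule finite_measure_lebesgue_on_bounded) (simp_all add: cube_def)
  show ?thesis using assms by (intro integrable_const_bound[where B=C]) auto
qed

text \<open>
  The averages are written on the fixed cube \<open>cube 0 1\<close>, which is the form in which blow-ups use them.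
\<close>

lemma lebesgue_differentiation_cube:
  fixes f :: "'a::euclidean_space \<Rightarrow> real"
  assumes f [measurable]: "f \<in> borel_measurable borel" and C: "\<And>x. \<bar>f x\<bar> \<le> C"
  shows "AE x in lborel. ((\<lambda>r. LINT y|lebesgue_on (cube 0 1). f (x + r *\<^sub>R y)) \<longlongrightarrow> f x) (at_right 0)"
proof -
  have fin: "integrable (lebesgue_on (cbox a b)) f" for a b
  proof -
    interpret finite_measure "lebesgue_on (cbox a b)"
      by (rule finite_measure_lebesgue_on_bounded) simp_all
    show ?thesis using C by (intro integrable_const_bound[where B=C]) auto
  qed
  have io: "f integrable_on cbox a b" for a b
    using fin by (intro integrable_on_lebesgue_on) auto
  obtain N where N: "negligible N"
       "\<And>x e. \<lbrakk>x \<notin> N; 0 < e\<rbrakk> \<Longrightarrow> \<exists>d>0. \<forall>h. 0 < h \<and> h < d \<longrightarrow>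
          norm(integral (cbox x (x + h *\<^sub>R One)) f /\<^sub>R h ^ DIM('a) - f x) < e"
    using integrable_ccontinuous_explicit[OF io] by blast
  have avg: "integral (cbox x (x + h *\<^sub>R One)) f /\<^sub>R h ^ DIM('a) = (LINT y|lebesgue_on (cube 0 1). f (x + h *\<^sub>R y))"
    if h: "0 < h" for x h
  proof -
    have "integral (cbox x (x + h *\<^sub>R One)) f = integral (box x (x + h *\<^sub>R One)) f"
      by (simp add: integral_open_interval)
    also have "\<dots> = (LINT y|lebesgue_on (cube x h). f y)"
    proof (subst lebesgue_integral_eq_integral)
      show "integrable (lebesgue_on (cube x h)) f"
        using C by (intro integrable_cube_bounded[where C=C] borel_lebesgue_on f)
    qed (simp_all add: cube_def)
    also have "\<dots> = h ^ DIM('a) *\<^sub>R (LINT y|lebesgue_on (cube 0 1). f (x + h *\<^sub>R y))"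
      by (rule integral_cube_rescale[OF f h])
    finally show ?thesis using h by simp
  qed
  have "AE x in lebesgue. x \<notin> N"
    using N(1) by (simp add: negligible_iff_null_sets AE_not_in)
  then have "AE x in lborel. x \<notin> N" by (simp add: AE_completion_iff)
  then show ?thesis
  proof eventually_elim
    case (elim x)
    show ?case
    proof (rule tendstoI)
      fix e :: real assume "0 < e"
      then obtain d where d: "d > 0" "\<And>h. 0 < h \<Longrightarrow> h < d \<Longrightarrow>
          norm(integral (cbox x (x + h *\<^sub>R One)) f /\<^sub>R h ^ DIM('a) - f x) < e"
        using N(2)[OF elim] by blast
      show "\<forall>\<^sub>F r in at_right 0. dist (LINT y|lebesgue_on (cube 0 1). f (x + r *\<^sub>R y)) (f x) < e"
        unfolding eventually_at_right_field
        by (rule exI[of _ d]) (use d avg in \<open>auto simp: dist_norm\<close>)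
    qed
  qed
qed

text \<open>
  Differentiation, applied to the countably many functions \<open>\<bar>f - q\<bar>\<close> with rational \<open>q\<close>, gives
  the claim, because \<open>f x\<close> can be replaced by a nearby rational number.
\<close>

lemma lebesgue_point_cube:
  fixes f :: "'a::euclidean_space \<Rightarrow> real"
  assumes f [measurable]: "f \<in> borel_measurable borel" and C: "\<And>x. \<bar>f x\<bar> \<le> C"
  shows "AE x in lborel.
    ((\<lambda>r. LINT y|lebesgue_on (cube 0 1). \<bar>f (x + r *\<^sub>R y) - f x\<bar>) \<longlongrightarrow> 0) (at_right 0)"
proof -
  interpret Q: prob_space "lebesgue_on (cube (0::'a) 1)" by (rule prob_space_cube)
  have "AE x in lborel. \<forall>q\<in>\<rat>.
      ((\<lambda>r. LINT y|lebesgue_on (cube 0 1). \<bar>f (x + r *\<^sub>R y) - q\<bar>) \<longlongrightarrow> \<bar>f x - q\<bar>) (at_right 0)"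
  proof (subst AE_ball_countable)
    show "\<forall>q\<in>\<rat>. AE x in lborel.
      ((\<lambda>r. LINT y|lebesgue_on (cube 0 1). \<bar>f (x + r *\<^sub>R y) - q\<bar>) \<longlongrightarrow> \<bar>f x - q\<bar>) (at_right 0)"
    proof
      fix q :: real
      show "AE x in lborel.
        ((\<lambda>r. LINT y|lebesgue_on (cube 0 1). \<bar>f (x + r *\<^sub>R y) - q\<bar>) \<longlongrightarrow> \<bar>f x - q\<bar>) (at_right 0)"
        by (rule lebesgue_differentiation_cube[of "\<lambda>x. \<bar>f x - q\<bar>" "C + \<bar>q\<bar>"])
          (use C in \<open>auto intro!: order_trans[OF abs_triangle_ineq4] add_right_mono\<close>)
    qed
  qed (rule countable_rat)
  then show ?thesis
  proof eventually_elim
    case (elim x)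
    show ?case
    proof (rule tendstoI)
      fix e :: real assume e: "0 < e"
      obtain q where q: "q \<in> \<rat>" "\<bar>f x - q\<bar> < e / 2"
      proof -
        obtain q where "q \<in> \<rat>" "f x - e/2 < q" "q < f x + e/2"
          using Rats_dense_in_real[of "f x - e/2" "f x + e/2"] e by auto
        moreover from this have "\<bar>f x - q\<bar> < e / 2" by linarith
        ultimately show ?thesis by (intro that[of q])
      qed
      have "\<forall>\<^sub>F r in at_right 0. (LINT y|lebesgue_on (cube 0 1). \<bar>f (x + r *\<^sub>R y) - q\<bar>) < e / 2"
        using elim q by (intro order_tendstoD(2)) auto
      then show "\<forall>\<^sub>F r in at_right 0. dist (LINT y|lebesgue_on (cube 0 1). \<bar>f (x + r *\<^sub>R y) - f x\<bar>) 0 < e"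
      proof eventually_elim
        case (elim r)
        note less = this
        have i: "integrable (lebesgue_on (cube (0::'a) 1)) (\<lambda>y. \<bar>f (x + r *\<^sub>R y) - c\<bar>)" for c
          by (rule integrable_cube_bounded[where C="C + \<bar>c\<bar>"])
            (use C in \<open>auto intro!: order_trans[OF abs_triangle_ineq4] add_right_mono\<close>)
        have "(LINT y|lebesgue_on (cube 0 1). \<bar>f (x + r *\<^sub>R y) - f x\<bar>)
            \<le> (LINT y|lebesgue_on (cube 0 1). \<bar>f (x + r *\<^sub>R y) - q\<bar> + \<bar>f x - q\<bar>)"
        proof (rule integral_mono)
          show "integrable (lebesgue_on (cube 0 1)) (\<lambda>y. \<bar>f (x + r *\<^sub>R y) - q\<bar> + \<bar>f x - q\<bar>)"
            by (intro Bochner_Integration.integrable_add i Q.integrable_const)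
        qed (use i[of "f x"] in auto)
        also have "\<dots> = (LINT y|lebesgue_on (cube 0 1). \<bar>f (x + r *\<^sub>R y) - q\<bar>) + \<bar>f x - q\<bar>"
        proof (subst Bochner_Integration.integral_add)
          show "integrable (lebesgue_on (cube 0 1)) (\<lambda>y::'a. \<bar>f x - q\<bar>)"
            by (rule Q.integrable_const)
        qed (use i[of q] Q.prob_space in simp_all)
        finally have "(LINT y|lebesgue_on (cube 0 1). \<bar>f (x + r *\<^sub>R y) - f x\<bar>) < e"
          using less q(2) by linarith
        moreover have "0 \<le> (LINT y|lebesgue_on (cube 0 1). \<bar>f (x + r *\<^sub>R y) - f x\<bar>)"
          by (rule Bochner_Integration.integral_nonneg) simp
        ultimately show ?case by simp
      qed
    qed
  qed
qed

lemma AE_lebesgue_on_iff: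
  assumes "U \<in> sets borel"
  shows "(AE x in lebesgue_on U. P x) \<longleftrightarrow> (AE x in lborel. x \<in> U \<longrightarrow> P x)"
  using assms by (simp add: AE_restrict_space_iff AE_completion_iff)

section \<open>A continuous curve through a ball\<close>

text \<open>
  A continuous function of period 2 that vanishes on \<open>[0, 1/3]\<close> and equals 1 on \<open>[2/3, 1]\<close>. Composed
  with multiplication by \<open>3 ^ l\<close>, it reads off a ternary digit that is 0 or 2 as a binary digit.
\<close>

definition digit_wave :: "real \<Rightarrow> real" where
  "digit_wave t = max 0 (min 1 (1 / 2 - cos (pi * t)))"

lemma digit_wave_bounds: "0 \<le> digit_wave t" "digit_wave t \<le> 1"
  by (auto simp: digit_wave_def)

lemma continuous_digit_wave: "continuous_on A digit_wave"
  unfolding digit_wave_def[abs_def] by (intro continuous_intros)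

text \<open>
  The argument consists of an even integer, the digit that is being read, and the contribution \<open>s\<close> of the
  later digits.
\<close>

lemma digit_wave_eq:
  assumes b: "b = 0 \<or> b = (1::nat)" and s: "0 \<le> s" "s \<le> 1 / 3"
  shows "digit_wave (2 * real K + 2 * real b / 3 + s) = real b"
proof -
  have "cos (pi * (2 * real K + 2 * real b / 3 + s)) = cos (pi * (2 * real b / 3 + s) + 2 * real K * pi)"
    by (simp add: algebra_simps)
  also have "\<dots> = cos (pi * (2 * real b / 3 + s))"
    using cos_add[of "pi * (2 * real b / 3 + s)" "2 * real K * pi"] by (simp add: cos_2npi sin_2npi)
  finally have *: "cos (pi * (2 * real K + 2 * real b / 3 + s)) = cos (pi * (2 * real b / 3 + s))" .
  show ?thesis
  proof (cases "b = 0")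
    case True
    have "cos (pi / 3) \<le> cos (pi * s)"
      using s by (intro cos_monotone_0_pi_le) auto
    then show ?thesis using True * by (simp add: digit_wave_def cos_60)
  next
    case False
    with b have b1: "b = 1" by simp
    have "cos (pi * (2 / 3 + s)) = - cos (pi * (1 / 3 - s))"
      using cos_pi_minus[of "pi * (1 / 3 - s)"] by (simp add: algebra_simps)
    moreover have "cos (pi / 3) \<le> cos (pi * (1 / 3 - s))"
      using s by (intro cos_monotone_0_pi_le) auto
    ultimately show ?thesis using b1 * by (simp add: digit_wave_def cos_60)
  qed
qed

text \<open>
  The digit 1 is chosen whenever the remainder is at least one half; this keeps the remainders in
  \<open>[0, 1]\<close>, also for \<open>a = 1\<close>.
\<close>

lemma binary_expansion:
  fixes a :: real
  assumes a: "0 \<le> a" "a \<le> 1"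
  obtains d :: "nat \<Rightarrow> nat" where "\<And>k. d k = 0 \<or> d k = 1" "(\<lambda>k. real (d k) * (1 / 2) ^ Suc k) sums a"
proof -
  define r where "r = rec_nat a (\<lambda>k x. if 1 / 2 \<le> x then 2 * x - 1 else 2 * x :: real)"
  define d where "d k = (if 1 / 2 \<le> r k then 1 else 0 :: nat)" for k
  have r_Suc: "r (Suc k) = 2 * r k - real (d k)" and r_0: "r 0 = a" for k
    by (simp_all add: r_def d_def)
  have r01: "0 \<le> r k \<and> r k \<le> 1" for k
  proof (induction k)
    case (Suc k) then show ?case by (auto simp: r_Suc d_def)
  qed (use a in \<open>simp add: r_0\<close>)
  have part: "a = (\<Sum>k<n. real (d k) * (1 / 2) ^ Suc k) + (1 / 2) ^ n * r n" for n
  proof (induction n)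
    case (Suc n)
    have "(1 / 2) ^ Suc n * r (Suc n) = (1 / 2) ^ n * r n - real (d n) * (1 / 2) ^ Suc n"
      by (simp add: r_Suc field_simps)
    with Suc show ?case unfolding sum.lessThan_Suc by linarith
  qed (simp add: r_0)
  have "(\<lambda>n. (1 / 2) ^ n * r n) \<longlonglongrightarrow> 0"
  proof (rule tendsto_sandwich[of "\<lambda>n. 0" _ _ "\<lambda>n. (1 / 2) ^ n"])
    show "\<forall>\<^sub>F n in sequentially. (1 / 2) ^ n * r n \<le> (1 / 2) ^ n"
      using r01 by (intro always_eventually allI) (simp add: mult_left_le)
  qed (use r01 in \<open>auto intro: LIMSEQ_realpow_zero\<close>)
  then have "(\<lambda>n. a - (1 / 2) ^ n * r n) \<longlonglongrightarrow> a - 0" by (intro tendsto_intros)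
  moreover have "(\<lambda>n. a - (1 / 2) ^ n * r n) = (\<lambda>n. \<Sum>k<n. real (d k) * (1 / 2) ^ Suc k)"
    using part by (auto simp: fun_eq_iff algebra_simps)
  ultimately have "(\<lambda>k. real (d k) * (1 / 2) ^ Suc k) sums a" by (simp add: sums_def)
  with that[of d] show ?thesis by (auto simp: d_def)
qed

text \<open>
  The witness \<open>t\<close> is the point of the Cantor set with ternary digits \<open>2 * b l\<close>. In \<open>3 ^ l * t\<close> the earlier
  digits contribute an even integer, and the later ones a number in \<open>[0, 1/3]\<close>.
\<close>

lemma ternary_digits:
  assumes b: "\<And>l. b l = 0 \<or> b l = (1::nat)"
  obtains t where "0 \<le> t" "t \<le> 1" "\<And>l. digit_wave (3 ^ l * t) = real (b l)"
proof -
  define f where "f l = 2 * real (b l) / 3 ^ Suc l" for l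
  have f0: "0 \<le> f l" for l by (simp add: f_def)
  have fle: "f (l + n) \<le> (2 / 3 ^ Suc n) * (1 / 3) ^ l" for l n
    using b[of "l + n"] by (auto simp: f_def power_add field_simps)
  have geo: "(\<lambda>l. (2 / 3 ^ Suc n) * (1 / 3) ^ l) sums (1 / 3 ^ n :: real)" for n :: nat
    using sums_mult[OF geometric_sums[of "1 / 3 :: real"], of "2 / 3 ^ Suc n"] by (simp add: field_simps)
  have summ: "summable f"
    using fle[of _ 0] f0 by (intro summable_comparison_test'[OF sums_summable[OF geo[of 0]], of 0]) auto
  define t where "t = suminf f"
  have tail0: "0 \<le> (\<Sum>l. f (l + n))" for n
    by (intro suminf_nonneg f0 summable_ignore_initial_segment summ)
  have tail: "(\<Sum>l. f (l + n)) \<le> 1 / 3 ^ n" for n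
    using suminf_le[OF fle[of _ n] summable_ignore_initial_segment[OF summ] sums_summable[OF geo]]
    sums_unique[OF geo[of n]] by simp
  have "digit_wave (3 ^ l * t) = real (b l)" for l
  proof -
    have "t = (\<Sum>i. f (i + Suc l)) + (\<Sum>i<Suc l. f i)"
      unfolding t_def by (rule suminf_split_initial_segment[OF summ])
    then have "3 ^ l * t = 3 ^ l * (\<Sum>i<l. f i) + 3 ^ l * f l + 3 ^ l * (\<Sum>i. f (i + Suc l))"
      by (simp add: algebra_simps)
    also have "3 ^ l * (\<Sum>i<l. f i) = 2 * real (\<Sum>i<l. b i * 3 ^ (l - Suc i))"
    proof -
      have "3 ^ l * f i = 2 * real (b i * 3 ^ (l - Suc i))" if "i < l" for i
      proof -
        have "(3::real) ^ l = 3 ^ (l - Suc i) * 3 ^ Suc i"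
          using that by (subst power_add[symmetric]) simp
        then show ?thesis by (simp add: f_def)
      qed
      then show ?thesis by (simp add: sum_distrib_left)
    qed
    also have "3 ^ l * f l = 2 * real (b l) / 3" by (simp add: f_def)
    finally have eq: "3 ^ l * t = 2 * real (\<Sum>i<l. b i * 3 ^ (l - Suc i)) + 2 * real (b l) / 3
        + 3 ^ l * (\<Sum>i. f (i + Suc l))" .
    show ?thesis
      unfolding eq
    proof (rule digit_wave_eq[OF b])
      show "0 \<le> 3 ^ l * (\<Sum>i. f (i + Suc l))" using tail0[of "Suc l"] by simp
      show "3 ^ l * (\<Sum>i. f (i + Suc l)) \<le> 1 / 3" using tail[of "Suc l"] by (simp add: field_simps)
    qed
  qed
  then show ?thesis using that[of t] tail0[of 0] tail[of 0] by (simp add: t_def)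
qed

text \<open>
  The section picks the least preimage. It is Borel measurable because its sublevel sets are images of
  compact intervals, hence compact.
\<close>

lemma borel_section_of_continuous_image:
  fixes dec :: "real \<Rightarrow> 'b::euclidean_space"
  assumes cont: "continuous_on UNIV dec"
  obtains code :: "'b \<Rightarrow> real" where "code \<in> borel_measurable borel"
    "\<And>x. 0 \<le> code x \<and> code x \<le> 1" "\<And>x. x \<in> dec ` {0..1} \<Longrightarrow> dec (code x) = x"
proof -
  define S where "S x = {0..1} \<inter> dec -` {x}" for x
  have S_compact: "compact (S x)" for x
    unfolding S_def by (intro compact_Int_closed closed_vimage) (auto simp: cont)
  \<comment> \<open>outside the image the largest value 1 keeps all sublevel sets below it inside the image\<close>
  define code where "code x = (if S x = {} then 1 else Inf (S x))" for x
  have code_mem: "code x \<in> S x" if "x \<in> dec ` {0..1}" for x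
  proof -
    have "S x \<noteq> {}" using that by (auto simp: S_def)
    moreover have "bdd_below (S x)" unfolding S_def by (intro bdd_belowI[of _ 0]) auto
    ultimately show ?thesis
      using closed_contains_Inf[of "S x"] S_compact[of x] by (simp add: code_def compact_imp_closed)
  qed
  have bounds: "0 \<le> code x \<and> code x \<le> 1" for x
    using code_mem[of x] by (cases "x \<in> dec ` {0..1}") (auto simp: S_def code_def)
  have "code \<in> borel_measurable borel"
  proof (rule borel_measurableI_le)
    fix a :: real
    have "{x \<in> space borel. code x \<le> a} = (if 1 \<le> a then UNIV else dec ` ({0..1} \<inter> {..a}))"
    proof (cases "1 \<le> a")
      case True then show ?thesis using bounds order_trans by auto
    next
      case False
      have "code x \<le> a" if "x = dec t" "0 \<le> t" "t \<le> 1" "t \<le> a" for x t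
      proof -
        have "t \<in> S x" using that by (simp add: S_def)
        moreover have "bdd_below (S x)" unfolding S_def by (intro bdd_belowI[of _ 0]) auto
        ultimately have "code x \<le> t" by (auto simp: code_def intro: cInf_lower)
        with that show ?thesis by simp
      qed
      moreover have "x \<in> dec ` ({0..1} \<inter> {..a})" if "code x \<le> a" for x
      proof -
        have "x \<in> dec ` {0..1}" using that False by (auto simp: code_def S_def split: if_splits)
        then have "code x \<in> {0..1} \<inter> {..a}" "x = dec (code x)"
          using code_mem[of x] that by (auto simp: S_def)
        then show ?thesis by (rule rev_image_eqI)
      qed
      ultimately show ?thesis using False by auto
    qed
    also have "\<dots> \<in> sets borel"
    proof -
      have "compact (dec ` ({0..1} \<inter> {..a}))"
        by (intro compact_continuous_image continuous_on_subset[OF cont] compact_Int_closed) auto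
      then show ?thesis by (auto intro: borel_compact)
    qed
    finally show "{x \<in> space borel. code x \<le> a} \<in> sets borel" .
  qed
  then show ?thesis
    using that[of code] bounds code_mem by (auto simp: S_def)
qed

text \<open>
  Schoenberg's space-filling curve: the binary digits of all coordinates are interleaved into the
  ternary digits of a single parameter.
\<close>

theorem continuous_curve_through_ball:
  fixes M :: real
  obtains dec :: "real \<Rightarrow> 'b::euclidean_space"
  where "continuous_on UNIV dec" "cball 0 M \<subseteq> dec ` {0..1}"
proof -
  define D where "D = DIM('b)"
  have D: "0 < D" by (simp add: D_def)
  obtain e where e: "bij_betw e (Basis :: 'b set) {..<D}"
    using ex_bij_betw_finite_nat[of "Basis :: 'b set"] by (auto simp: D_def atLeast0LessThan)
  define X where "X n t = (\<Sum>k. (1 / 2) ^ Suc k * digit_wave (3 ^ (D * k + n) * t))" for n t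
  have contX: "continuous_on UNIV (X n)" for n
  proof -
    have "uniform_limit UNIV (\<lambda>m t. \<Sum>k<m. (1 / 2) ^ Suc k * digit_wave (3 ^ (D * k + n) * t))
        (\<lambda>t. X n t) sequentially"
      unfolding X_def
    proof (rule Weierstrass_m_test)
      show "norm ((1 / 2) ^ Suc k * digit_wave (3 ^ (D * k + n) * t)) \<le> (1 / 2) ^ Suc k" for k t
        using digit_wave_bounds[of "3 ^ (D * k + n) * t"] by (simp add: abs_mult mult_left_le)
      show "summable (\<lambda>k. (1 / 2 :: real) ^ Suc k)"
        using power_half_series sums_summable by blast
    qed
    then show ?thesis
      by (rule uniform_limit_theorem[rotated])
        (auto intro!: always_eventually continuous_intros continuous_on_compose2[OF continuous_digit_wave[of UNIV]])
  qed
  define dec where "dec t = (\<Sum>b\<in>Basis. (M * (2 * X (e b) t - 1)) *\<^sub>R b)" for t :: real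
  have "continuous_on UNIV dec"
    unfolding dec_def[abs_def] by (intro continuous_intros contX)
  moreover have "\<xi> \<in> dec ` {0..1}" if \<xi>: "\<xi> \<in> cball 0 M" for \<xi> :: 'b
  proof (cases "M = 0")
    case True
    then have "\<xi> = 0" using \<xi> by simp
    moreover have "dec 0 = 0" using True by (simp add: dec_def)
    ultimately show ?thesis by (metis atLeastAtMost_iff image_eqI order_refl zero_le_one)
  next
    case False
    have "0 \<le> norm \<xi>" "norm \<xi> \<le> M" using \<xi> by auto
    with False have M: "0 < M" by linarith
    define a where "a b = (\<xi> \<bullet> b / M + 1) / 2" for b
    have "0 \<le> a b \<and> a b \<le> 1" if "b \<in> Basis" for b
    proof -
      have "\<bar>\<xi> \<bullet> b\<bar> \<le> M" using Basis_le_norm[OF that, of \<xi>] \<xi> by auto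
      then have "- 1 \<le> \<xi> \<bullet> b / M" "\<xi> \<bullet> b / M \<le> 1" using M by (auto simp: field_simps)
      then show ?thesis unfolding a_def by simp
    qed
    then have "\<forall>b\<in>Basis. \<exists>d :: nat \<Rightarrow> nat. (\<forall>k. d k = 0 \<or> d k = 1) \<and> (\<lambda>k. real (d k) * (1 / 2) ^ Suc k) sums a b"
      using binary_expansion by metis
    then obtain d :: "'b \<Rightarrow> nat \<Rightarrow> nat" where d: "\<And>b k. b \<in> Basis \<Longrightarrow> d b k = 0 \<or> d b k = 1"
        "\<And>b. b \<in> Basis \<Longrightarrow> (\<lambda>k. real (d b k) * (1 / 2) ^ Suc k) sums a b"
      by metis
    \<comment> \<open>the coordinate \<open>b\<close> owns the positions that are congruent to \<open>e b\<close> modulo \<open>D\<close>\<close>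
    define c where "c l = d (inv_into Basis e (l mod D)) (l div D)" for l
    have inv: "inv_into Basis e (l mod D) \<in> Basis" for l
      using e D by (intro inv_into_into) (auto simp: bij_betw_def)
    obtain t where t: "0 \<le> t" "t \<le> 1" "\<And>l. digit_wave (3 ^ l * t) = real (c l)"
      by (rule ternary_digits[of c]) (use d(1)[OF inv] in \<open>auto simp: c_def\<close>)
    have "X (e b) t = a b" if b: "b \<in> Basis" for b
    proof -
      have "e b < D" using e b by (auto simp: bij_betw_def)
      then have "c (D * k + e b) = d b k" for k
        using e b by (simp add: c_def bij_betw_def)
      then have "X (e b) t = (\<Sum>k. real (d b k) * (1 / 2) ^ Suc k)"
        unfolding X_def t(3) by (simp add: mult.commute)
      then show ?thesis
        using sums_unique[OF d(2)[OF b]] by simp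
    qed
    then have "dec t = (\<Sum>b\<in>Basis. (M * (2 * a b - 1)) *\<^sub>R b)"
      by (simp add: dec_def)
    also have "\<dots> = (\<Sum>b\<in>Basis. (\<xi> \<bullet> b) *\<^sub>R b)"
      using M by (intro sum.cong refl) (simp add: a_def field_simps)
    finally have "dec t = \<xi>" by (simp add: euclidean_representation)
    then show ?thesis using t by auto
  qed
  ultimately show ?thesis using that by blast
qed

section \<open>Weak* convergence of bounded functions\<close>

lemma AE_summable_of_summable_integrals:
  fixes u :: "nat \<Rightarrow> 'a \<Rightarrow> real"
  assumes int: "\<And>i. integrable M (u i)" and sum: "summable (\<lambda>i. LINT x|M. \<bar>u i x\<bar>)"
  shows "AE x in M. summable (\<lambda>i. \<bar>u i x\<bar>)"
proof -
  have [measurable]: "u i \<in> borel_measurable M" for i using int by auto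
  have "(\<integral>\<^sup>+x. (\<Sum>i. ennreal \<bar>u i x\<bar>) \<partial>M) = (\<Sum>i. \<integral>\<^sup>+x. ennreal \<bar>u i x\<bar> \<partial>M)"
    by (rule nn_integral_suminf) simp
  also have "\<dots> = (\<Sum>i. ennreal (LINT x|M. \<bar>u i x\<bar>))"
    using int by (intro suminf_cong nn_integral_eq_integral) auto
  also have "\<dots> = ennreal (\<Sum>i. LINT x|M. \<bar>u i x\<bar>)"
    by (rule suminf_ennreal2) (use sum in auto)
  finally have "AE x in M. (\<Sum>i. ennreal \<bar>u i x\<bar>) \<noteq> \<infinity>"
    by (intro nn_integral_PInf_AE) auto
  then show ?thesis
    by eventually_elim (rule summable_suminf_not_top, auto)
qed

text \<open>
  The uniform boundedness principle for \<open>L\<^sup>\<infinity>\<close> as the dual of \<open>L\<^sup>1\<close>, by Sokal's elementary argument. If there were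
  no common bound, there would be indices \<open>j n\<close> with essential bounds \<open>E n\<close>, growing faster
  than \<open>3 ^ n\<close>, that are sharp up to the factor 3/4. The function \<open>H\<close> is a sum of humps of norm at most
  \<open>3 ^ (- n)\<close>. Tested with \<open>f (j n)\<close>, its first \<open>n + 1\<close> humps contribute at least
  \<open>3/4 * E n * 3 ^ (- n)\<close> in absolute value, and the remaining ones at most
  \<open>1/2 * E n * 3 ^ (- n)\<close>. The difference is larger than \<open>n + 1\<close>.
\<close>

lemma (in finite_measure) gliding_hump_bounded:
  fixes f :: "nat \<Rightarrow> 'a \<Rightarrow> real"
  assumes meas [measurable]: "\<And>j. f j \<in> borel_measurable M"
    and ess: "\<And>j. \<exists>C. AE x in M. \<bar>f j x\<bar> \<le> C"
    and bdd: "\<And>h. integrable M h \<Longrightarrow> \<exists>B. \<forall>j. \<bar>LINT x|M. f j x * h x\<bar> \<le> B"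
  shows "\<exists>C. \<forall>j. AE x in M. \<bar>f j x\<bar> \<le> C"
proof (rule ccontr)
  assume neg: "\<not> ?thesis"
  have "\<exists>j E. K < E \<and> (AE x in M. \<bar>f j x\<bar> \<le> E) \<and> \<not> (AE x in M. \<bar>f j x\<bar> \<le> 3 / 4 * E)" if K: "0 < K" for K
  proof -
    from neg obtain j where j: "\<not> (AE x in M. \<bar>f j x\<bar> \<le> K)" by blast
    obtain C where C: "AE x in M. \<bar>f j x\<bar> \<le> C" using ess by blast
    have mono: "AE x in M. \<bar>f j x\<bar> \<le> b" if "AE x in M. \<bar>f j x\<bar> \<le> a" "a \<le> b" for a b
      using that(1) by eventually_elim (use that(2) in auto)
    have "K < C" using j mono[OF C] by (meson not_le)
    \<comment> \<open>lowering the bound \<open>C\<close> by factors 3/4 for as long as possible locates the essential supremum\<close>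
    define P where "P n \<longleftrightarrow> \<not> (AE x in M. \<bar>f j x\<bar> \<le> C * (3 / 4) ^ n)" for n :: nat
    have "(\<lambda>n. C * (3 / 4) ^ n) \<longlonglongrightarrow> C * 0" by (intro tendsto_intros LIMSEQ_power_zero) simp
    then have "\<forall>\<^sub>F n in sequentially. C * (3 / 4) ^ n < K" using K by (intro order_tendstoD(2)) auto
    then obtain n where "C * (3 / 4) ^ n \<le> K" by (meson eventually_happens' less_imp_le trivial_limit_sequentially)
    then have Pn: "P n" unfolding P_def using j mono by blast
    define m where "m = (LEAST n. P n)"
    have Pm: "P m" unfolding m_def using Pn by (rule LeastI)
    have "m \<noteq> 0" using Pm C by (intro notI) (simp add: P_def)
    then obtain l where l: "m = Suc l" by (cases m) auto
    have nPl: "\<not> P l" using not_less_Least[of l P] l by (simp add: m_def)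
    then have AEl: "AE x in M. \<bar>f j x\<bar> \<le> C * (3 / 4) ^ l" by (simp add: P_def)
    moreover have "K < C * (3 / 4) ^ l" using j mono[OF AEl] by (meson not_le)
    moreover have "\<not> (AE x in M. \<bar>f j x\<bar> \<le> 3 / 4 * (C * (3 / 4) ^ l))"
      using Pm by (simp add: P_def l mult_ac)
    ultimately show ?thesis by blast
  qed
  then have "\<forall>n. \<exists>j E. 4 * (real n + 1) * 3 ^ n < E \<and> (AE x in M. \<bar>f j x\<bar> \<le> E) \<and> \<not> (AE x in M. \<bar>f j x\<bar> \<le> 3 / 4 * E)"
    by simp
  then obtain j E where E: "\<And>n. 4 * (real n + 1) * 3 ^ n < E n"
    and up: "\<And>n. AE x in M. \<bar>f (j n) x\<bar> \<le> E n"
    and low: "\<And>n. \<not> (AE x in M. \<bar>f (j n) x\<bar> \<le> 3 / 4 * E n)"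
    by metis
  have Epos: "0 < E n" for n using E[of n] by (smt (verit) mult_nonneg_nonneg of_nat_0_le_iff zero_le_power)
  define A where "A n = {x \<in> space M. 3 / 4 * E n < \<bar>f (j n) x\<bar>}" for n
  have A [measurable]: "A n \<in> sets M" for n unfolding A_def by measurable
  have Apos: "0 < measure M (A n)" for n
  proof -
    have "measure M (A n) \<noteq> 0"
    proof
      assume "measure M (A n) = 0"
      then have "AE x in M. x \<notin> A n" by (intro AE_not_in) (auto simp: null_sets_def emeasure_eq_measure)
      then have "AE x in M. \<bar>f (j n) x\<bar> \<le> 3 / 4 * E n"
        using AE_space by eventually_elim (auto simp: A_def)
      with low show False by blast
    qed
    then show ?thesis by (simp add: zero_less_measure_iff)
  qed
  \<comment> \<open>a hump of norm 1 on the set where \<open>f (j n)\<close> is almost maximal, with the sign of \<open>f (j n)\<close>\<close>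
  define g where "g n x = sgn (f (j n) x) * indicator (A n) x / measure M (A n)" for n x
  have [measurable]: "g n \<in> borel_measurable M" for n unfolding g_def[abs_def] by measurable
  have g_abs: "\<bar>g n x\<bar> \<le> indicator (A n) x / measure M (A n)" for n x
    by (auto simp: g_def indicator_def sgn_if divide_right_mono)
  have g_int: "integrable M (g n)" for n
    by (rule Bochner_Integration.integrable_bound[of M "\<lambda>x. indicator (A n) x / measure M (A n)"])
      (use g_abs in \<open>auto simp: integrable_real_indicator emeasure_eq_measure\<close>)
  have g_norm: "(LINT x|M. \<bar>g n x\<bar>) \<le> 1" for n
  proof -
    have "(LINT x|M. \<bar>g n x\<bar>) \<le> (LINT x|M. indicator (A n) x / measure M (A n))"
      by (intro integral_mono g_abs) (use g_int in \<open>auto simp: integrable_real_indicator emeasure_eq_measure\<close>)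
    also have "\<dots> = 1" using Apos[of n] by (simp add: less_imp_neq)
    finally show ?thesis .
  qed
  have fint: "integrable M (\<lambda>x. f (j n) x * k x)" if k: "integrable M k" for n k
  proof (rule Bochner_Integration.integrable_bound)
    show "integrable M (\<lambda>x. E n * \<bar>k x\<bar>)" using k by auto
    show "AE x in M. norm (f (j n) x * k x) \<le> norm (E n * \<bar>k x\<bar>)"
      using up[of n] by eventually_elim (auto simp: abs_mult intro: mult_right_mono)
  qed (use k in measurable)
  have fbound: "\<bar>LINT x|M. f (j n) x * k x\<bar> \<le> E n * (LINT x|M. \<bar>k x\<bar>)" if k: "integrable M k" for n k
  proof -
    have "\<bar>LINT x|M. f (j n) x * k x\<bar> \<le> (LINT x|M. \<bar>f (j n) x * k x\<bar>)"
      by (rule integral_abs_bound)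
    also have "\<dots> \<le> (LINT x|M. E n * \<bar>k x\<bar>)"
    proof (rule integral_mono_AE)
      show "AE x in M. \<bar>f (j n) x * k x\<bar> \<le> E n * \<bar>k x\<bar>"
        using up[of n] by eventually_elim (auto simp: abs_mult intro: mult_right_mono)
    qed (use k fint in auto)
    finally show ?thesis by simp
  qed
  have hump: "3 / 4 * E n \<le> (LINT x|M. f (j n) x * g n x)" for n
  proof -
    have "3 / 4 * E n = (LINT x|M. 3 / 4 * E n * (indicator (A n) x / measure M (A n)))"
      using Apos[of n] by (simp add: less_imp_neq)
    also have "\<dots> \<le> (LINT x|M. f (j n) x * g n x)"
    proof (rule integral_mono)
      fix x
      have "3 / 4 * E n / measure M (A n) \<le> \<bar>f (j n) x\<bar> / measure M (A n)" if "x \<in> A n"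
        using that by (intro divide_right_mono) (auto simp: A_def)
      then show "3 / 4 * E n * (indicator (A n) x / measure M (A n)) \<le> f (j n) x * g n x"
        by (auto simp: g_def indicator_def abs_sgn)
    qed (use fint[OF g_int] in \<open>auto simp: integrable_real_indicator emeasure_eq_measure\<close>)
    finally show ?thesis .
  qed
  \<comment> \<open>the sign of each hump is chosen so that it does not cancel against the preceding ones\<close>
  define step where "step n a = (if 3 / 4 * E n * (1 / 3) ^ n \<le> \<bar>a + (1 / 3) ^ n * (LINT x|M. f (j n) x * g n x)\<bar>
    then 1 else - 1 :: real)" for n and a :: real
  define h where "h = rec_nat (\<lambda>x. 0) (\<lambda>n k x. k x + step n (LINT x|M. f (j n) x * k x) * (1 / 3) ^ n * g n x)"
  define s where "s n = step n (LINT x|M. f (j n) x * h n x)" for n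
  define v where "v n x = s n * (1 / 3) ^ n * g n x" for n x
  have s1: "\<bar>s n\<bar> = 1" for n by (simp add: s_def step_def)
  have h_sum: "h n = (\<lambda>x. \<Sum>i<n. v i x)" for n
  proof (induction n)
    case (Suc n)
    have "h (Suc n) = (\<lambda>x. h n x + v n x)" by (simp add: h_def v_def s_def)
    then show ?case using Suc by simp
  qed (simp add: h_def)
  have v_int: "integrable M (v n)" for n unfolding v_def[abs_def] using g_int by auto
  have h_int: "integrable M (h n)" for n unfolding h_sum using v_int by auto
  have v_norm: "(LINT x|M. \<bar>v n x\<bar>) \<le> (1 / 3) ^ n" for n
    using g_norm[of n] s1[of n] by (simp add: v_def abs_mult mult_left_le)
  have part: "3 / 4 * E n * (1 / 3) ^ n \<le> \<bar>LINT x|M. f (j n) x * h (Suc n) x\<bar>" for n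
  proof -
    define a where "a = (LINT x|M. f (j n) x * h n x)"
    define b where "b = (1 / 3) ^ n * (LINT x|M. f (j n) x * g n x)"
    have b: "3 / 4 * E n * (1 / 3) ^ n \<le> b"
      using mult_right_mono[OF hump[of n], of "(1 / 3) ^ n"] by (simp add: b_def mult.commute)
    have "f (j n) x * h (Suc n) x = f (j n) x * h n x + s n * (1 / 3) ^ n * (f (j n) x * g n x)" for x
      by (simp add: h_sum v_def algebra_simps)
    then have eq: "(LINT x|M. f (j n) x * h (Suc n) x) = a + s n * b"
      using fint[OF h_int[of n], of n] fint[OF g_int[of n], of n] by (simp add: a_def b_def)
    have sn: "s n = (if 3 / 4 * E n * (1 / 3) ^ n \<le> \<bar>a + b\<bar> then 1 else - 1)"
      by (simp add: s_def step_def a_def b_def)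
    have key: "c \<le> \<bar>a + (if c \<le> \<bar>a + b\<bar> then 1 else - 1) * b\<bar>" if "c \<le> b" for c
    proof (cases "c \<le> \<bar>a + b\<bar>")
      case False
      then have "c \<le> \<bar>a - b\<bar>" using that by linarith
      with False show ?thesis by simp
    qed simp
    show ?thesis unfolding eq sn by (rule key[OF b])
  qed
  have geo: "summable (\<lambda>n. (1 / 3 :: real) ^ n)" by (intro summable_geometric) simp
  have v_summable: "summable (\<lambda>n. LINT x|M. \<bar>v n x\<bar>)"
    by (rule summable_comparison_test'[OF geo, of 0]) (use v_norm in auto)
  have v_AE: "AE x in M. summable (\<lambda>n. \<bar>v n x\<bar>)"
    by (rule AE_summable_of_summable_integrals[OF v_int v_summable])
  define H where "H x = (\<Sum>n. v n x)" for x
  have H_int: "integrable M H"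
    unfolding H_def by (rule integrable_suminf) (use v_int v_AE v_summable in auto)
  obtain B where B: "\<And>j. \<bar>LINT x|M. f j x * H x\<bar> \<le> B" using bdd[OF H_int] by blast
  have big: "real n + 1 < \<bar>LINT x|M. f (j n) x * H x\<bar>" for n
  proof -
    define c where "c i = (LINT x|M. f (j n) x * v i x)" for i
    have c_bound: "\<bar>c i\<bar> \<le> E n * (1 / 3) ^ i" for i
      unfolding c_def using order_trans[OF fbound[OF v_int] mult_left_mono[OF v_norm]] Epos[of n] by auto
    have fv_int: "integrable M (\<lambda>x. f (j n) x * v i x)" for i by (rule fint[OF v_int])
    have fv_sum: "summable (\<lambda>i. LINT x|M. norm (f (j n) x * v i x))"
    proof (rule summable_comparison_test'[of "\<lambda>i. E n * (1 / 3) ^ i" 0])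
      fix i
      have "(LINT x|M. \<bar>f (j n) x * v i x\<bar>) \<le> (LINT x|M. E n * \<bar>v i x\<bar>)"
      proof (rule integral_mono_AE)
        show "AE x in M. \<bar>f (j n) x * v i x\<bar> \<le> E n * \<bar>v i x\<bar>"
          using up[of n] by eventually_elim (auto simp: abs_mult intro: mult_right_mono)
      qed (use v_int fv_int in auto)
      also have "\<dots> \<le> E n * (1 / 3) ^ i" using v_norm[of i] Epos[of n] by simp
      finally show "norm (LINT x|M. norm (f (j n) x * v i x)) \<le> E n * (1 / 3) ^ i" by simp
    qed (use geo in auto)
    have fv_AE: "AE x in M. summable (\<lambda>i. norm (f (j n) x * v i x))"
      using v_AE by eventually_elim (auto simp: abs_mult intro: summable_mult)
    have sums: "c sums (LINT x|M. (\<Sum>i. f (j n) x * v i x))"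
      unfolding c_def by (rule sums_integral[OF fv_int fv_AE fv_sum])
    moreover have "(LINT x|M. (\<Sum>i. f (j n) x * v i x)) = (LINT x|M. f (j n) x * H x)"
    proof (rule integral_cong_AE)
      show "AE x in M. (\<Sum>i. f (j n) x * v i x) = f (j n) x * H x"
        using v_AE by eventually_elim (auto simp: H_def intro!: suminf_mult intro: summable_rabs_cancel)
    qed (use H_int v_int in measurable)
    ultimately have c_sums: "c sums (LINT x|M. f (j n) x * H x)" by simp
    have head: "(\<Sum>i<Suc n. c i) = (LINT x|M. f (j n) x * h (Suc n) x)"
      using fv_int unfolding c_def h_sum sum_distrib_left
      by (subst Bochner_Integration.integral_sum) auto
    have tail: "\<bar>\<Sum>i. c (i + Suc n)\<bar> \<le> E n * (1 / 3) ^ n / 2"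
    proof -
      have g: "(\<lambda>i. E n * (1 / 3) ^ Suc n * (1 / 3) ^ i) sums (E n * (1 / 3) ^ n / 2)"
        using sums_mult[OF geometric_sums[of "1 / 3 :: real"], of "E n * (1 / 3) ^ Suc n"] by (simp add: field_simps)
      have le: "\<bar>c (i + Suc n)\<bar> \<le> E n * (1 / 3) ^ Suc n * (1 / 3) ^ i" for i
        using c_bound[of "i + Suc n"] by (simp add: power_add mult_ac)
      have ab: "summable (\<lambda>i. \<bar>c (i + Suc n)\<bar>)"
        by (rule summable_comparison_test'[OF sums_summable[OF g], of 0]) (use le in auto)
      have "\<bar>\<Sum>i. c (i + Suc n)\<bar> \<le> (\<Sum>i. \<bar>c (i + Suc n)\<bar>)" by (rule summable_rabs[OF ab])
      also have "\<dots> \<le> E n * (1 / 3) ^ n / 2"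
        using suminf_le[OF le ab sums_summable[OF g]] sums_unique[OF g] by simp
      finally show ?thesis .
    qed
    have "(LINT x|M. f (j n) x * H x) = (\<Sum>i. c (i + Suc n)) + (\<Sum>i<Suc n. c i)"
      using suminf_split_initial_segment[OF sums_summable[OF c_sums], of "Suc n"] sums_unique[OF c_sums] by simp
    then have "E n * (1 / 3) ^ n / 4 \<le> \<bar>LINT x|M. f (j n) x * H x\<bar>"
      using tail part[of n] unfolding head by (simp add: abs_if split: if_splits)
    moreover have "real n + 1 < E n * (1 / 3) ^ n / 4"
      using E[of n] by (simp add: field_simps)
    ultimately show ?thesis by linarith
  qed
  obtain n where "B < real n" using reals_Archimedean2 by blast
  then show False using big[of n] B[of "j n"] by linarith
qed

text \<open>
  Open sets approximate measurable sets from outside, and an open set is exhausted by finite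
  unions of sets from a countable base.
\<close>

lemma lebesgue_countable_dense_sets:
  fixes U :: "'a::euclidean_space set"
  assumes U: "U \<in> sets lebesgue"
  obtains E :: "nat \<Rightarrow> 'a set" where "\<And>n. open (E n)"
    "\<And>A e. A \<in> sets (lebesgue_on U) \<Longrightarrow> finite_measure (lebesgue_on U) \<Longrightarrow> 0 < e \<Longrightarrow>
      \<exists>n. measure (lebesgue_on U) ((A - E n) \<union> (U \<inter> E n - A)) < e"
proof -
  obtain B :: "nat \<Rightarrow> 'a set" where B: "\<And>n. open (B n)" "\<And>S. open S \<Longrightarrow> \<exists>I. S = (\<Union>i\<in>I. B i)"
  proof -
    obtain \<B> :: "'a set set" where \<B>: "countable \<B>" "topological_basis \<B>" using ex_countable_basis by blast
    have ne: "\<B> \<noteq> {}"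
    proof
      assume "\<B> = {}"
      then have "\<exists>B'\<subseteq>{}. \<Union>B' = (UNIV :: 'a set)" using \<B>(2) topological_basis_def open_UNIV by metis
      then show False by simp
    qed
    show ?thesis
    proof (rule that[of "from_nat_into \<B>"])
      show "open (from_nat_into \<B> n)" for n
        using from_nat_into[OF ne] \<B>(2) topological_basis_open by blast
      fix S :: "'a set" assume "open S"
      then obtain \<C> where C: "\<C> \<subseteq> \<B>" "\<Union>\<C> = S" using \<B>(2) topological_basis_def by metis
      have "S = (\<Union>i\<in>{i. from_nat_into \<B> i \<in> \<C>}. from_nat_into \<B> i)"
      proof
        show "S \<subseteq> (\<Union>i\<in>{i. from_nat_into \<B> i \<in> \<C>}. from_nat_into \<B> i)"
        proof
          fix x assume "x \<in> S"
          then obtain c where c: "c \<in> \<C>" "x \<in> c" using C by blast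
          then obtain i where "from_nat_into \<B> i = c" using C(1) from_nat_into_surj[OF \<B>(1)] by blast
          with c show "x \<in> (\<Union>i\<in>{i. from_nat_into \<B> i \<in> \<C>}. from_nat_into \<B> i)" by blast
        qed
      qed (use C in blast)
      then show "\<exists>I. S = (\<Union>i\<in>I. from_nat_into \<B> i)" by blast
    qed
  qed
  obtain F :: "nat \<Rightarrow> nat set" where F: "range F = Collect finite"
    using countable_Collect_finite by (metis finite.emptyI mem_Collect_eq empty_iff range_from_nat_into)
  define E where "E n = (\<Union>i\<in>F n. B i)" for n
  show ?thesis
  proof (rule that[of E])
    show "open (E n)" for n unfolding E_def using B(1) by blast
    fix A and e :: real assume A: "A \<in> sets (lebesgue_on U)" and fin: "finite_measure (lebesgue_on U)" and e: "0 < e"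
    interpret finite_measure "lebesgue_on U" by fact
    have A': "A \<in> sets lebesgue" "A \<subseteq> U" using A U by (auto simp: sets_restrict_space)
    from sets_lebesgue_outer_open[OF A'(1), of "e / 2"] e
    obtain T where T: "open T" "A \<subseteq> T" "T - A \<in> lmeasurable" "emeasure lebesgue (T - A) < ennreal (e / 2)" by auto
    obtain I where I: "T = (\<Union>i\<in>I. B i)" using B(2)[OF T(1)] by blast
    define T' where "T' n = (\<Union>i\<in>I \<inter> {..<n}. B i)" for n
    have T'U: "(\<Union>n. U \<inter> T' n) = U \<inter> T" by (auto simp: T'_def I)
    have T'm: "U \<inter> T' n \<in> sets (lebesgue_on U)" for n
    proof -
      have "open (T' n)" unfolding T'_def using B(1) by blast
      then show ?thesis using U by (auto simp: sets_restrict_space)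
    qed
    have Tm: "U \<inter> T \<in> sets (lebesgue_on U)" using T(1) U by (auto simp: sets_restrict_space)
    have "(\<lambda>n. measure (lebesgue_on U) (U \<inter> T' n)) \<longlonglongrightarrow> measure (lebesgue_on U) (U \<inter> T)"
      unfolding T'U[symmetric]
      by (rule finite_Lim_measure_incseq) (use T'm in \<open>auto simp: incseq_def T'_def\<close>)
    then have "\<forall>\<^sub>F n in sequentially. measure (lebesgue_on U) (U \<inter> T) - e / 2 < measure (lebesgue_on U) (U \<inter> T' n)"
      using e by (intro order_tendstoD(1)) auto
    then obtain n where n: "measure (lebesgue_on U) (U \<inter> T) - e / 2 < measure (lebesgue_on U) (U \<inter> T' n)"
      by (meson eventually_happens' trivial_limit_sequentially)
    have "I \<inter> {..<n} \<in> range F" unfolding F by simp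
    then obtain k where k: "F k = I \<inter> {..<n}" by (metis imageE)
    then have Ek: "E k = T' n" by (simp add: E_def T'_def)
    have sub: "U \<inter> T' n \<subseteq> U \<inter> T" by (auto simp: T'_def I)
    have m1: "measure (lebesgue_on U) (U \<inter> T - U \<inter> T' n) < e / 2"
      using finite_measure_Diff[OF Tm T'm sub] n by simp
    have m2: "measure (lebesgue_on U) (U \<inter> T - A) < e / 2"
    proof -
      have "emeasure (lebesgue_on U) (U \<inter> T - A) = emeasure lebesgue (U \<inter> T - A)"
        by (rule emeasure_restrict_space) (use U in \<open>auto simp del: emeasure_completion\<close>)
      also have "\<dots> \<le> emeasure lebesgue (T - A)" by (rule emeasure_mono) (use T(3) in auto)
      also have "\<dots> < ennreal (e / 2)" by (rule T(4))
      finally show ?thesis using e by (simp add: emeasure_eq_measure ennreal_less_iff)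
    qed
    have "(A - E k) \<union> (U \<inter> E k - A) \<subseteq> (U \<inter> T - U \<inter> T' n) \<union> (U \<inter> T - A)"
      unfolding Ek using T(2) A'(2) sub by blast
    then have "measure (lebesgue_on U) ((A - E k) \<union> (U \<inter> E k - A))
        \<le> measure (lebesgue_on U) ((U \<inter> T - U \<inter> T' n) \<union> (U \<inter> T - A))"
      by (rule finite_measure_mono) (use Tm T'm A in auto)
    also have "\<dots> \<le> measure (lebesgue_on U) (U \<inter> T - U \<inter> T' n) + measure (lebesgue_on U) (U \<inter> T - A)"
      by (rule measure_Un_le) (use Tm T'm A in auto)
    also have "\<dots> < e" using m1 m2 by simp
    finally show "\<exists>n. measure (lebesgue_on U) ((A - E n) \<union> (U \<inter> E n - A)) < e" by blast
  qed
qed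

lemma (in finite_measure) integrable_bounded_mult:
  fixes g h :: "'a \<Rightarrow> real"
  assumes g: "g \<in> borel_measurable M" "\<And>x. \<bar>g x\<bar> \<le> K" and h: "integrable M h"
  shows "integrable M (\<lambda>x. g x * h x)"
proof (rule Bochner_Integration.integrable_bound)
  show "integrable M (\<lambda>x. K * \<bar>h x\<bar>)" using h by simp
  show "(\<lambda>x. g x * h x) \<in> borel_measurable M" using g(1) h by simp
  show "AE x in M. norm (g x * h x) \<le> norm (K * \<bar>h x\<bar>)"
    using g(2) by (intro AE_I2) (simp add: abs_mult mult_right_mono order_trans[OF g(2) abs_ge_self])
qed

lemma (in finite_measure) integral_bounded_mult:
  fixes g h :: "'a \<Rightarrow> real"
  assumes g: "g \<in> borel_measurable M" "\<And>x. \<bar>g x\<bar> \<le> K" and h: "integrable M h"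
  shows "\<bar>LINT x|M. g x * h x\<bar> \<le> K * (LINT x|M. \<bar>h x\<bar>)"
proof -
  have "\<bar>LINT x|M. g x * h x\<bar> \<le> (LINT x|M. \<bar>g x * h x\<bar>)" by (rule integral_abs_bound)
  also have "\<dots> \<le> (LINT x|M. K * \<bar>h x\<bar>)"
  proof (rule integral_mono)
    show "integrable M (\<lambda>x. \<bar>g x * h x\<bar>)" by (rule integrable_abs[OF integrable_bounded_mult[OF g h]])
    show "\<bar>g x * h x\<bar> \<le> K * \<bar>h x\<bar>" for x unfolding abs_mult by (rule mult_right_mono[OF g(2) abs_ge_zero])
  qed (use h in simp)
  finally show ?thesis by simp
qed

text \<open>
  The test functions for which a bounded sequence tends to \<open>0\<close> form a closed subspace of \<open>L\<^sup>1\<close>, and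
  simple functions are dense.
\<close>

lemma (in finite_measure) weakstar_null_of_sets:
  fixes g :: "nat \<Rightarrow> 'a \<Rightarrow> real"
  assumes g: "\<And>k. g k \<in> borel_measurable M" "\<And>k x. \<bar>g k x\<bar> \<le> K"
    and sets: "\<And>A. A \<in> sets M \<Longrightarrow> (\<lambda>k. LINT x|M. g k x * indicator A x) \<longlonglongrightarrow> 0"
    and h: "integrable M h"
  shows "(\<lambda>k. LINT x|M. g k x * h x) \<longlonglongrightarrow> 0"
  using h
proof (induction rule: integrable_induct)
  case (base A c)
  have "(LINT x|M. g k x * (indicator A x *\<^sub>R c)) = c * (LINT x|M. g k x * indicator A x)" for k
    by (simp add: mult_ac flip: integral_mult_right_zero)
  then show ?case using tendsto_mult_right_zero[OF sets[OF base(1)], of c] by simp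
next
  case (add f h)
  have "(LINT x|M. g k x * (f x + h x)) = (LINT x|M. g k x * f x) + (LINT x|M. g k x * h x)" for k
    using integrable_bounded_mult[OF g add.hyps(1)] integrable_bounded_mult[OF g add.hyps(2)] by (simp add: distrib_left)
  then show ?case using tendsto_add[OF add.IH] by simp
next
  case (lim f s)
  have K0: "0 \<le> K" using g(2)[of 0 undefined] by linarith
  have conv: "(\<lambda>i. LINT x|M. \<bar>f x - s i x\<bar>) \<longlonglongrightarrow> (LINT x|M. 0)"
  proof (rule integral_dominated_convergence)
    show "integrable M (\<lambda>x. 3 * \<bar>f x\<bar>)" using lim.hyps(4) by simp
    show "AE x in M. (\<lambda>i. \<bar>f x - s i x\<bar>) \<longlonglongrightarrow> 0"
    proof (rule AE_I2)
      fix x assume "x \<in> space M"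
      from tendsto_rabs[OF tendsto_diff[OF tendsto_const[of "f x"] lim.hyps(2)[OF this]]]
      show "(\<lambda>i. \<bar>f x - s i x\<bar>) \<longlonglongrightarrow> 0" by simp
    qed
    show "AE x in M. norm \<bar>f x - s i x\<bar> \<le> 3 * \<bar>f x\<bar>" for i
    proof (rule AE_I2)
      fix x assume "x \<in> space M"
      then have "\<bar>s i x\<bar> \<le> 2 * \<bar>f x\<bar>" using lim.hyps(3)[of x i] by simp
      then show "norm \<bar>f x - s i x\<bar> \<le> 3 * \<bar>f x\<bar>" unfolding real_norm_def by linarith
    qed
  qed (use lim.hyps in auto)
  show ?case
  proof (rule LIMSEQ_I)
    fix e :: real assume e: "0 < e"
    have "\<forall>\<^sub>F i in sequentially. (LINT x|M. \<bar>f x - s i x\<bar>) < e / (2 * (K + 1))"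
      using conv e K0 by (intro order_tendstoD(2)) auto
    then obtain i where i: "(LINT x|M. \<bar>f x - s i x\<bar>) < e / (2 * (K + 1))"
      by (meson eventually_happens' trivial_limit_sequentially)
    obtain N where N: "\<And>k. N \<le> k \<Longrightarrow> norm ((LINT x|M. g k x * s i x) - 0) < e / 2"
      using LIMSEQ_D[OF lim.IH[of i], of "e / 2"] e by auto
    show "\<exists>N. \<forall>k\<ge>N. norm ((LINT x|M. g k x * f x) - 0) < e"
    proof (intro exI allI impI)
      fix k assume k: "N \<le> k"
      have fs: "integrable M (\<lambda>x. f x - s i x)" using lim.hyps by auto
      have "(LINT x|M. g k x * f x) = (LINT x|M. g k x * (f x - s i x) + g k x * s i x)"
        by (simp add: algebra_simps)
      also have "\<dots> = (LINT x|M. g k x * (f x - s i x)) + (LINT x|M. g k x * s i x)"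
        by (rule Bochner_Integration.integral_add[OF integrable_bounded_mult[OF g fs] integrable_bounded_mult[OF g lim.hyps(1)]])
      finally have eq: "(LINT x|M. g k x * f x) = (LINT x|M. g k x * (f x - s i x)) + (LINT x|M. g k x * s i x)" .
      have "\<bar>LINT x|M. g k x * (f x - s i x)\<bar> \<le> K * (LINT x|M. \<bar>f x - s i x\<bar>)"
        by (rule integral_bounded_mult[OF g fs])
      also have "\<dots> \<le> (K + 1) * (LINT x|M. \<bar>f x - s i x\<bar>)"
        by (intro mult_right_mono Bochner_Integration.integral_nonneg) auto
      also have "\<dots> < e / 2" using i K0 by (simp add: field_simps)
      finally show "norm ((LINT x|M. g k x * f x) - 0) < e" using N[OF k] unfolding eq by simp
    qed
  qed
qed

text \<open>
  Replacing the indicator function of \<open>A\<close> by that of some \<open>E n\<close> changes the integrals by at most \<open>K\<close>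
  times the measure of the symmetric difference, uniformly in \<open>k\<close>.
\<close>

lemma (in finite_measure) weakstar_null_of_dense_sets:
  fixes g :: "nat \<Rightarrow> 'a \<Rightarrow> real"
  assumes g: "\<And>k. g k \<in> borel_measurable M" "\<And>k x. \<bar>g k x\<bar> \<le> K"
    and E: "\<And>n. E n \<inter> space M \<in> sets M"
    and dense: "\<And>A e. A \<in> sets M \<Longrightarrow> 0 < e \<Longrightarrow> \<exists>n. measure M ((A - E n) \<union> (space M \<inter> E n - A)) < e"
    and lim: "\<And>n. (\<lambda>k. LINT x|M. g k x * indicator (E n) x) \<longlonglongrightarrow> 0"
    and h: "integrable M h"
  shows "(\<lambda>k. LINT x|M. g k x * h x) \<longlonglongrightarrow> 0"
proof (rule weakstar_null_of_sets[OF g _ h])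
  fix A assume A: "A \<in> sets M"
  have K0: "0 \<le> K" using g(2)[of 0 undefined] by linarith
  show "(\<lambda>k. LINT x|M. g k x * indicator A x) \<longlonglongrightarrow> 0"
  proof (rule LIMSEQ_I)
    fix e :: real assume e: "0 < e"
    then obtain n where n: "measure M ((A - E n) \<union> (space M \<inter> E n - A)) < e / (2 * (K + 1))"
      using dense[OF A, of "e / (2 * (K + 1))"] K0 by auto
    let ?D = "(A - E n) \<union> (space M \<inter> E n - A)"
    let ?E = "E n \<inter> space M"
    have Asp: "A \<subseteq> space M" by (rule sets.sets_into_space[OF A])
    have D: "?D \<in> sets M"
    proof -
      have "?D = (A - ?E) \<union> (?E - A)" using Asp by auto
      then show ?thesis using A E[of n] by auto
    qed
    have EE: "(LINT x|M. g k x * indicator (E n) x) = (LINT x|M. g k x * indicator ?E x)" for k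
      by (rule Bochner_Integration.integral_cong) (auto simp: indicator_def)
    obtain N where N: "\<And>k. N \<le> k \<Longrightarrow> norm ((LINT x|M. g k x * indicator (E n) x) - 0) < e / 2"
      using LIMSEQ_D[OF lim[of n], of "e / 2"] e by auto
    have iI: "integrable M (indicator S :: 'a \<Rightarrow> real)" if "S \<in> sets M" for S
      using that by (intro integrable_real_indicator) (auto simp: emeasure_eq_measure)
    show "\<exists>N. \<forall>k\<ge>N. norm ((LINT x|M. g k x * indicator A x) - 0) < e"
    proof (intro exI allI impI)
      fix k assume k: "N \<le> k"
      have fs: "integrable M (\<lambda>x. indicator A x - indicator ?E x :: real)" using iI[OF A] iI[OF E[of n]] by auto
      have "(LINT x|M. g k x * indicator A x) = (LINT x|M. g k x * (indicator A x - indicator ?E x) + g k x * indicator ?E x)"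
        by (simp add: algebra_simps)
      also have "\<dots> = (LINT x|M. g k x * (indicator A x - indicator ?E x)) + (LINT x|M. g k x * indicator ?E x)"
        by (rule Bochner_Integration.integral_add[OF integrable_bounded_mult[OF g fs] integrable_bounded_mult[OF g iI[OF E]]])
      finally have eq: "(LINT x|M. g k x * indicator A x) = (LINT x|M. g k x * (indicator A x - indicator ?E x)) + (LINT x|M. g k x * indicator (E n) x)"
        unfolding EE .
      have "\<bar>LINT x|M. g k x * (indicator A x - indicator ?E x)\<bar> \<le> K * (LINT x|M. \<bar>indicator A x - indicator ?E x\<bar>)"
        by (rule integral_bounded_mult[OF g fs])
      also have "(LINT x|M. \<bar>indicator A x - indicator ?E x\<bar>) = (LINT x|M. indicator ?D x :: real)"
        by (rule Bochner_Integration.integral_cong) (use Asp in \<open>auto simp: indicator_def\<close>)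
      also have "\<dots> = measure M ?D" using D by simp
      also have "K * measure M ?D \<le> (K + 1) * measure M ?D" by (intro mult_right_mono) auto
      also have "\<dots> < e / 2" using n K0 by (simp add: field_simps)
      finally show "norm ((LINT x|M. g k x * indicator A x) - 0) < e" using N[OF k] unfolding eq by simp
    qed
  qed
qed

text \<open>
  The Cauchy property in a form that only involves null sequences, so that criteria for weak*
  convergence to \<open>0\<close> also yield convergence to an unknown limit.
\<close>

lemma convergent_of_differences:
  fixes X :: "nat \<Rightarrow> real"
  assumes "\<And>p q. (\<And>k. k \<le> p k) \<Longrightarrow> (\<And>k. k \<le> q k) \<Longrightarrow> (\<lambda>k. X (p k) - X (q k)) \<longlonglongrightarrow> 0"
  shows "convergent X"
proof (rule ccontr)
  assume "\<not> convergent X"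
  then have "\<not> Cauchy X" by (simp add: Cauchy_convergent_iff)
  then obtain e where e: "0 < e" "\<forall>M. \<exists>m\<ge>M. \<exists>n\<ge>M. e \<le> \<bar>X m - X n\<bar>"
    by (auto simp: Cauchy_iff not_less)
  then obtain p q where pq: "\<And>k. k \<le> p k" "\<And>k. k \<le> q k" "\<And>k. e \<le> \<bar>X (p k) - X (q k)\<bar>" by metis
  obtain k where "norm (X (p k) - X (q k) - 0) < e"
    using LIMSEQ_D[OF assms[OF pq(1,2)] e(1)] by blast
  then show False using pq(3)[of k] by simp
qed

lemma diagonal_subsequence:
  fixes X :: "nat \<Rightarrow> nat \<Rightarrow> real"
  assumes bdd: "\<And>n k. \<bar>X n k\<bar> \<le> C n"
  obtains q :: "nat \<Rightarrow> nat" where "strict_mono q" "\<And>n. convergent (\<lambda>k. X n (q k))"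
proof -
  interpret subseqs "\<lambda>n s. convergent (\<lambda>k. X n (s k))"
  proof
    fix n :: nat and s :: "nat \<Rightarrow> nat"
    have "X n (s k) \<in> {- C n..C n}" for k using bdd[of n "s k"] by auto
    then have "\<exists>l r. strict_mono r \<and> ((\<lambda>k. X n (s k)) \<circ> r) \<longlonglongrightarrow> l"
      using compact_imp_seq_compact[OF compact_Icc] seq_compactE by metis
    then show "\<exists>r. strict_mono (r :: nat \<Rightarrow> nat) \<and> convergent (\<lambda>k. X n ((s \<circ> r) k))"
      by (auto simp: convergent_def comp_def)
  qed
  have "convergent (\<lambda>k. X n (diagseq k))" for n
  proof -
    have "convergent (\<lambda>k. X n ((diagseq \<circ> ((+) (Suc n))) k))"
    proof (rule diagseq_holds)
      fix r s :: "nat \<Rightarrow> nat" and n assume "strict_mono r" "convergent (\<lambda>k. X n (s k))"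
      then show "convergent (\<lambda>k. X n ((s \<circ> r) k))"
        using convergent_subseq_convergent[of "\<lambda>k. X n (s k)" r] by (simp add: comp_def)
    qed
    then show ?thesis using convergent_ignore_initial_segment[of "\<lambda>k. X n (diagseq k)" "Suc n"] by (simp add: add.commute)
  qed
  with subseq_diagseq that show ?thesis by blast
qed

lemma finite_measure_lebesgue_on_open_bounded:
  "open \<Omega> \<Longrightarrow> bounded \<Omega> \<Longrightarrow> finite_measure (lebesgue_on \<Omega>)"
  by (rule finite_measure_lebesgue_on_bounded) auto

text \<open>
  Uniform boundedness is applied to each coordinate function.
\<close>

lemma Linf_weakstar_convergent_bounded:
  fixes f :: "nat \<Rightarrow> 'a::euclidean_space \<Rightarrow> 'b::euclidean_space"
  assumes fin: "finite_measure (lebesgue_on U)" and f: "\<And>j. f j \<in> Linf U" and lim: "Linf_weakstar_tendsto U f g"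
  shows "\<exists>C. \<forall>j. AE x in lebesgue_on U. norm (f j x) \<le> C"
proof -
  interpret finite_measure "lebesgue_on U" by fact
  have fm [measurable]: "f j \<in> borel_measurable (lebesgue_on U)" for j using f by (simp add: Linf_def)
  have "\<exists>C. \<forall>j. AE x in lebesgue_on U. \<bar>f j x \<bullet> b\<bar> \<le> C" if b: "b \<in> Basis" for b
  proof (rule gliding_hump_bounded)
    show "(\<lambda>x. f j x \<bullet> b) \<in> borel_measurable (lebesgue_on U)" for j by measurable
    show "\<exists>C. AE x in lebesgue_on U. \<bar>f j x \<bullet> b\<bar> \<le> C" for j
    proof -
      obtain C where "AE x in lebesgue_on U. norm (f j x) \<le> C" using f[of j] by (auto simp: Linf_def)
      then have "AE x in lebesgue_on U. \<bar>f j x \<bullet> b\<bar> \<le> C"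
        by eventually_elim (rule order_trans[OF Basis_le_norm[OF b]])
      then show ?thesis by blast
    qed
    fix h :: "'a \<Rightarrow> real" assume h: "integrable (lebesgue_on U) h"
    have "integrable (lebesgue_on U) (\<lambda>x. h x *\<^sub>R b)" using h by simp
    then have "(\<lambda>j. LINT x|lebesgue_on U. f j x \<bullet> (h x *\<^sub>R b)) \<longlonglongrightarrow> (LINT x|lebesgue_on U. g x \<bullet> (h x *\<^sub>R b))"
      using lim unfolding Linf_weakstar_tendsto_def by blast
    then have "Bseq (\<lambda>j. LINT x|lebesgue_on U. f j x \<bullet> (h x *\<^sub>R b))"
      by (intro convergent_imp_Bseq convergentI)
    then obtain B where "\<And>j. norm (LINT x|lebesgue_on U. f j x \<bullet> (h x *\<^sub>R b)) \<le> B" by (auto simp: Bseq_def)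
    then have "\<bar>LINT x|lebesgue_on U. f j x \<bullet> b * h x\<bar> \<le> B" for j by (simp add: mult.commute)
    then show "\<exists>B. \<forall>j. \<bar>LINT x|lebesgue_on U. f j x \<bullet> b * h x\<bar> \<le> B" by blast
  qed
  then have "\<forall>b\<in>Basis. \<exists>C. \<forall>j. AE x in lebesgue_on U. \<bar>f j x \<bullet> b\<bar> \<le> C" by blast
  from bchoice[OF this] obtain C where C: "\<And>b j. b \<in> Basis \<Longrightarrow> AE x in lebesgue_on U. \<bar>f j x \<bullet> b\<bar> \<le> C b" by auto
  have "AE x in lebesgue_on U. norm (f j x) \<le> (\<Sum>b\<in>Basis. C b)" for j
  proof -
    have "AE x in lebesgue_on U. \<forall>b\<in>Basis. \<bar>f j x \<bullet> b\<bar> \<le> C b"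
      by (subst AE_finite_all) (use C in auto)
    then show ?thesis
    proof eventually_elim
      case (elim x)
      have "norm (f j x) \<le> (\<Sum>b\<in>Basis. \<bar>f j x \<bullet> b\<bar>)" by (rule norm_le_l1)
      also have "\<dots> \<le> (\<Sum>b\<in>Basis. C b)" by (intro sum_mono) (use elim in blast)
      finally show ?case .
    qed
  qed
  then show ?thesis by blast
qed

text \<open>
  The sign of \<open>a - b\<close> is itself an admissible test function.
\<close>

lemma (in finite_measure) weakstar_limit_unique:
  fixes a b :: "'a \<Rightarrow> real"
  assumes a: "integrable M a" and b: "integrable M b"
    and eq: "\<And>h. h \<in> borel_measurable M \<Longrightarrow> (\<And>x. \<bar>h x\<bar> \<le> 1) \<Longrightarrow> (LINT x|M. a x * h x) = (LINT x|M. b x * h x)"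
  shows "AE x in M. a x = b x"
proof -
  have [measurable]: "a \<in> borel_measurable M" "b \<in> borel_measurable M" using a b by auto
  define h where "h x = sgn (a x - b x)" for x
  have h: "h \<in> borel_measurable M" "\<bar>h x\<bar> \<le> 1" for x unfolding h_def[abs_def] by (auto simp: sgn_if)
  have ih: "integrable M (\<lambda>x. a x * h x)" "integrable M (\<lambda>x. b x * h x)"
    using integrable_bounded_mult[OF h a] integrable_bounded_mult[OF h b] by (simp_all add: mult.commute)
  have "(LINT x|M. \<bar>a x - b x\<bar>) = (LINT x|M. a x * h x - b x * h x)"
    by (intro Bochner_Integration.integral_cong) (simp_all add: h_def abs_sgn left_diff_distrib)
  also have "\<dots> = 0" using eq[OF h] ih by simp
  finally have "AE x in M. \<bar>a x - b x\<bar> = 0"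
    by (subst (asm) integral_nonneg_eq_0_iff_AE) (use a b in auto)
  then show ?thesis by eventually_elim simp
qed

text \<open>
  The limits of the integrals over \<open>A\<close> define an additive set function with values between \<open>0\<close> and
  the measure of \<open>A\<close>. This bound makes it a measure that is absolutely continuous, and its
  Radon-Nikodym density is the weak* limit.
\<close>

lemma (in finite_measure) weakstar_limit_exists:
  fixes f :: "nat \<Rightarrow> 'a \<Rightarrow> real"
  assumes f: "\<And>j. f j \<in> borel_measurable M" "\<And>j x. 0 \<le> f j x" "\<And>j x. f j x \<le> 1"
    and conv: "\<And>h. integrable M h \<Longrightarrow> convergent (\<lambda>j. LINT x|M. f j x * h x)"
  obtains m where "m \<in> borel_measurable M" "\<And>x. 0 \<le> m x" "\<And>x. m x \<le> 1"
    "\<And>h. integrable M h \<Longrightarrow> (\<lambda>j. LINT x|M. f j x * h x) \<longlonglongrightarrow> (LINT x|M. m x * h x)"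
proof -
  have fabs: "\<bar>f j x\<bar> \<le> 1" for j x using f(2,3)[of j x] by simp
  have iI: "integrable M (indicator S :: 'a \<Rightarrow> real)" if "S \<in> sets M" for S
    using that by (intro integrable_real_indicator) (auto simp: emeasure_eq_measure)
  define I where "I j A = (LINT x|M. f j x * indicator A x)" for j A
  define L where "L A = lim (\<lambda>j. I j A)" for A
  have lim: "(\<lambda>j. I j A) \<longlonglongrightarrow> L A" if "A \<in> sets M" for A
    using conv[OF iI[OF that]] unfolding I_def L_def by (simp add: convergent_LIMSEQ_iff)
  have I0: "0 \<le> I j A" for j A
    unfolding I_def by (intro Bochner_Integration.integral_nonneg mult_nonneg_nonneg f) auto
  have Ile: "I j A \<le> measure M A" if A: "A \<in> sets M" for j A
    using integral_bounded_mult[OF f(1) fabs iI[OF A], of j] A by (simp add: I_def)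
  have L0: "0 \<le> L A" if "A \<in> sets M" for A
    by (rule LIMSEQ_le_const[OF lim[OF that]]) (use I0 in auto)
  have Lle: "L A \<le> measure M A" if "A \<in> sets M" for A
    by (rule LIMSEQ_le_const2[OF lim[OF that]]) (use Ile[OF that] in auto)
  have Ladd: "L (A \<union> B) = L A + L B" if A: "A \<in> sets M" and B: "B \<in> sets M" and AB: "A \<inter> B = {}" for A B
  proof -
    have "I j (A \<union> B) = I j A + I j B" for j
    proof -
      have "(LINT x|M. f j x * indicator (A \<union> B) x) = (LINT x|M. f j x * indicator A x + f j x * indicator B x)"
        using AB by (intro Bochner_Integration.integral_cong) (auto simp: indicator_def)
      then show ?thesis
        unfolding I_def using Bochner_Integration.integral_add[OF integrable_bounded_mult[OF f(1) fabs iI[OF A]] integrable_bounded_mult[OF f(1) fabs iI[OF B]], of j j]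
        by simp
    qed
    then have "(\<lambda>j. I j (A \<union> B)) \<longlonglongrightarrow> L A + L B" using tendsto_add[OF lim[OF A] lim[OF B]] by simp
    then show ?thesis using LIMSEQ_unique lim[of "A \<union> B"] A B by blast
  qed
  let ?\<nu> = "\<lambda>A. ennreal (L A)"
  have "L {} = 0" using L0[of "{}"] Lle[of "{}"] by simp
  then have pos: "positive (sets M) ?\<nu>" by (simp add: positive_def)
  have add: "additive (sets M) ?\<nu>"
    unfolding additive_def using Ladd L0 by (auto simp: ennreal_plus[symmetric] simp del: ennreal_plus)
  have ca: "countably_additive (sets M) ?\<nu>"
  proof (rule sets.empty_continuous_imp_countably_additive[OF pos add])
    fix A :: "nat \<Rightarrow> 'a set" assume A: "range A \<subseteq> sets M" "decseq A" "(\<Inter>i. A i) = {}"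
    have "(\<lambda>i. measure M (A i)) \<longlonglongrightarrow> measure M (\<Inter>i. A i)" by (rule finite_Lim_measure_decseq[OF A(1,2)])
    then have m0: "(\<lambda>i. measure M (A i)) \<longlonglongrightarrow> 0" using A(3) by simp
    have "(\<lambda>i. L (A i)) \<longlonglongrightarrow> 0"
      by (rule tendsto_sandwich[OF _ _ tendsto_const m0]) (use A(1) L0 Lle in \<open>auto intro!: always_eventually\<close>)
    then show "(\<lambda>i. ?\<nu> (A i)) \<longlonglongrightarrow> 0" using tendsto_ennrealI by fastforce
  qed simp
  define N where "N = measure_of (space M) (sets M) ?\<nu>"
  have setsN: "sets N = sets M" unfolding N_def by (rule sets.sets_measure_of_eq)
  have emN: "emeasure N A = ?\<nu> A" if "A \<in> sets M" for A
    unfolding N_def by (rule emeasure_measure_of_sigma[OF sets.sigma_algebra_axioms pos ca that])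
  have ac: "absolutely_continuous M N"
  proof (unfold absolutely_continuous_def, rule subsetI)
    fix A assume A: "A \<in> null_sets M"
    then have "measure M A = 0" "A \<in> sets M" by (auto simp: measure_eq_0_null_sets)
    then show "A \<in> null_sets N" using L0[of A] Lle[of A] setsN emN[of A] by (auto simp: null_sets_def)
  qed
  obtain d where d: "d \<in> borel_measurable M" "density M d = N" using Radon_Nikodym[OF ac setsN] by blast
  note [measurable] = d(1)
  have dA: "(\<integral>\<^sup>+x. d x * indicator A x \<partial>M) = ?\<nu> A" if "A \<in> sets M" for A
    using emeasure_density[OF d(1) that] emN[OF that] unfolding d(2) by simp
  have "AE x in M. d x \<le> 1"
  proof -
    define A where "A = {x \<in> space M. 1 < d x}"
    have A [measurable]: "A \<in> sets M" unfolding A_def by measurable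
    have "(\<integral>\<^sup>+x. d x * indicator A x - indicator A x \<partial>M) = (\<integral>\<^sup>+x. d x * indicator A x \<partial>M) - (\<integral>\<^sup>+x. indicator A x \<partial>M)"
    proof (rule nn_integral_diff)
      show "AE x in M. indicator A x \<le> d x * indicator A x" by (intro AE_I2) (auto simp: indicator_def A_def less_imp_le)
    qed (auto simp: emeasure_eq_measure)
    also have "\<dots> = 0"
      using dA[OF A] Lle[OF A] by (simp add: emeasure_eq_measure diff_eq_0_iff_ennreal ennreal_leI)
    finally have "AE x in M. d x * indicator A x - indicator A x = 0"
      by (subst (asm) nn_integral_0_iff_AE) auto
    then show ?thesis
      using AE_space
    proof eventually_elim
      case (elim x)
      show ?case
      proof (rule ccontr)
        assume "\<not> d x \<le> 1"
        then have "x \<in> A" using elim by (simp add: A_def)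
        then have "d x - 1 = 0" using elim by simp
        then have "d x \<le> 1" by (simp add: diff_eq_0_iff_ennreal)
        with \<open>\<not> d x \<le> 1\<close> show False by simp
      qed
    qed
  qed
  define m where "m x = min 1 (enn2real (d x))" for x
  have mm [measurable]: "m \<in> borel_measurable M" unfolding m_def[abs_def] by measurable
  have m01: "0 \<le> m x" "m x \<le> 1" for x by (auto simp: m_def)
  have dm: "AE x in M. d x = ennreal (m x)"
    using \<open>AE x in M. d x \<le> 1\<close>
  proof eventually_elim
    case (elim x)
    then have "d x < top" using le_less_trans ennreal_one_less_top by blast
    moreover from elim have "enn2real (d x) \<le> 1" using enn2real_leI[of 1 "d x"] by simp
    ultimately show ?case by (simp add: m_def min_absorb2)
  qed
  have mabs: "\<bar>m x\<bar> \<le> 1" for x using m01[of x] by simp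
  have Lm: "L A = (LINT x|M. m x * indicator A x)" if A: "A \<in> sets M" for A
  proof -
    have "?\<nu> A = (\<integral>\<^sup>+x. ennreal (m x * indicator A x) \<partial>M)"
      unfolding dA[OF A, symmetric]
      by (rule nn_integral_cong_AE) (use dm in \<open>eventually_elim, auto simp: indicator_def\<close>)
    also have "\<dots> = ennreal (LINT x|M. m x * indicator A x)"
      by (rule nn_integral_eq_integral[OF integrable_bounded_mult[OF mm mabs iI[OF A]]]) (use m01 in auto)
    finally show ?thesis
      using L0[OF A] m01 by (simp add: Bochner_Integration.integral_nonneg)
  qed
  show ?thesis
  proof (rule that[OF mm m01])
    fix h :: "'a \<Rightarrow> real" assume h: "integrable M h"
    have "(\<lambda>j. LINT x|M. (f j x - m x) * h x) \<longlonglongrightarrow> 0"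
    proof (rule weakstar_null_of_sets[OF _ _ _ h])
      show "(\<lambda>x. f k x - m x) \<in> borel_measurable M" for k using f(1) mm by measurable
      show "\<bar>f k x - m x\<bar> \<le> 1" for k x using f(2,3)[of k x] m01[of x] by linarith
      fix A assume A: "A \<in> sets M"
      have "(LINT x|M. (f k x - m x) * indicator A x) = I k A - L A" for k
        unfolding Lm[OF A] I_def left_diff_distrib
        by (rule Bochner_Integration.integral_diff[OF integrable_bounded_mult[OF f(1) fabs iI[OF A]] integrable_bounded_mult[OF mm mabs iI[OF A]]])
      then show "(\<lambda>k. LINT x|M. (f k x - m x) * indicator A x) \<longlonglongrightarrow> 0"
        using lim[OF A] by (simp add: LIM_zero)
    qed
    moreover have "(LINT x|M. (f j x - m x) * h x) = (LINT x|M. f j x * h x) - (LINT x|M. m x * h x)" for j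
      unfolding left_diff_distrib
      by (rule Bochner_Integration.integral_diff[OF integrable_bounded_mult[OF f(1) fabs h] integrable_bounded_mult[OF mm mabs h]])
    ultimately show "(\<lambda>j. LINT x|M. f j x * h x) \<longlonglongrightarrow> (LINT x|M. m x * h x)" by (simp add: LIM_zero_iff)
  qed
qed

text \<open>
  A diagonal argument makes the integrals of all sequences over all sets of a countable dense
  family convergent. The difference of two index sequences tending to infinity then
  tends to \<open>0\<close> on the dense sets, hence weakly*, so that the integrals against every integrable
  function converge.
\<close>

lemma weakstar_compactness:
  fixes f :: "nat \<Rightarrow> nat \<Rightarrow> 'a::euclidean_space \<Rightarrow> real"
  assumes U: "U \<in> sets lebesgue" "finite_measure (lebesgue_on U)"
    and f: "\<And>i j. f i j \<in> borel_measurable (lebesgue_on U)" "\<And>i j x. 0 \<le> f i j x" "\<And>i j x. f i j x \<le> 1"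
  obtains q :: "nat \<Rightarrow> nat" and m where "strict_mono q"
    "\<And>i. m i \<in> borel_measurable (lebesgue_on U)" "\<And>i x. 0 \<le> m i x" "\<And>i x. m i x \<le> 1"
    "\<And>i h. integrable (lebesgue_on U) h \<Longrightarrow>
      (\<lambda>j. LINT x|lebesgue_on U. f i (q j) x * h x) \<longlonglongrightarrow> (LINT x|lebesgue_on U. m i x * h x)"
proof -
  interpret finite_measure "lebesgue_on U" by fact
  obtain E :: "nat \<Rightarrow> 'a set" where E: "\<And>n. open (E n)"
    "\<And>A e. A \<in> sets (lebesgue_on U) \<Longrightarrow> 0 < e \<Longrightarrow> \<exists>n. measure (lebesgue_on U) ((A - E n) \<union> (U \<inter> E n - A)) < e"
    using lebesgue_countable_dense_sets[OF U(1)] U(2) by metis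
  have spU: "space (lebesgue_on U) = U" by simp
  have Es: "E n \<inter> U \<in> sets (lebesgue_on U)" for n
    using E(1)[of n] by (auto simp: sets_restrict_space)
  have fabs: "\<bar>f i j x\<bar> \<le> 1" for i j x using f(2,3)[of i j x] by simp
  have iI: "integrable (lebesgue_on U) (\<lambda>x. indicator (E n) x :: real)" for n
  proof -
    have "integrable (lebesgue_on U) (indicator (E n \<inter> U) :: 'a \<Rightarrow> real)"
      using Es by (intro integrable_real_indicator) (auto simp: emeasure_eq_measure)
    then show ?thesis
      by (rule Bochner_Integration.integrable_cong[THEN iffD1, rotated -1]) (auto simp: indicator_def)
  qed
  \<comment> \<open>the index \<open>n\<close> encodes a pair of a sequence and a test set\<close>
  define X where "X n j = (LINT x|lebesgue_on U. f (fst (prod_decode n)) j x * indicator (E (snd (prod_decode n))) x)" for n j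
  have "\<bar>X n j\<bar> \<le> 1 * (LINT x|lebesgue_on U. \<bar>indicator (E (snd (prod_decode n))) x\<bar>)" for n j
    unfolding X_def by (rule integral_bounded_mult[OF f(1) fabs iI])
  from diagonal_subsequence[of X, OF this]
  obtain q :: "nat \<Rightarrow> nat" where q: "strict_mono q" "\<And>n. convergent (\<lambda>k. X n (q k))" by blast
  have cE: "convergent (\<lambda>k. LINT x|lebesgue_on U. f i (q k) x * indicator (E n) x)" for i n
    using q(2)[of "prod_encode (i, n)"] by (simp add: X_def)
  define is_limit where "is_limit i m \<longleftrightarrow> m \<in> borel_measurable (lebesgue_on U) \<and> (\<forall>x. 0 \<le> m x) \<and> (\<forall>x. m x \<le> 1) \<and>
      (\<forall>h. integrable (lebesgue_on U) h \<longrightarrow>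
      (\<lambda>j. LINT x|lebesgue_on U. f i (q j) x * h x) \<longlonglongrightarrow> (LINT x|lebesgue_on U. m x * h x))" for i m
  have "\<exists>m. is_limit i m" for i
  proof -
    have conv: "convergent (\<lambda>j. LINT x|lebesgue_on U. f i (q j) x * h x)" if h: "integrable (lebesgue_on U) h" for h
    proof (rule convergent_of_differences)
      fix p r :: "nat \<Rightarrow> nat" assume pr: "\<And>k. k \<le> p k" "\<And>k. k \<le> r k"
      have inf: "filterlim p at_top sequentially" "filterlim r at_top sequentially"
        using pr by (auto intro!: filterlim_at_top_mono[OF filterlim_ident] always_eventually)
      have eq: "(LINT x|lebesgue_on U. (f i (q (p k)) x - f i (q (r k)) x) * h' x)
        = (LINT x|lebesgue_on U. f i (q (p k)) x * h' x) - (LINT x|lebesgue_on U. f i (q (r k)) x * h' x)"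
        if h': "integrable (lebesgue_on U) h'" for k h'
        unfolding left_diff_distrib
        by (rule Bochner_Integration.integral_diff[OF integrable_bounded_mult[OF f(1) fabs h'] integrable_bounded_mult[OF f(1) fabs h']])
      have "(\<lambda>k. LINT x|lebesgue_on U. (f i (q (p k)) x - f i (q (r k)) x) * h x) \<longlonglongrightarrow> 0"
      proof (rule weakstar_null_of_dense_sets[where K=1 and E=E])
        show "(\<lambda>x. f i (q (p k)) x - f i (q (r k)) x) \<in> borel_measurable (lebesgue_on U)" for k
          by (intro borel_measurable_diff f(1))
        show "\<bar>f i (q (p k)) x - f i (q (r k)) x\<bar> \<le> 1" for k x
          using f(2,3)[of i "q (p k)" x] f(2,3)[of i "q (r k)" x] by linarith
        show "E n \<inter> space (lebesgue_on U) \<in> sets (lebesgue_on U)" for n using Es[of n] by simp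
        show "\<exists>n. measure (lebesgue_on U) (A - E n \<union> (space (lebesgue_on U) \<inter> E n - A)) < e"
          if "A \<in> sets (lebesgue_on U)" "0 < e" for A e using E(2)[OF that] by simp
        fix n
        obtain l where l: "(\<lambda>k. LINT x|lebesgue_on U. f i (q k) x * indicator (E n) x) \<longlonglongrightarrow> l"
          using cE[of i n] by (auto simp: convergent_def)
        have "(\<lambda>k. (LINT x|lebesgue_on U. f i (q (p k)) x * indicator (E n) x)
           - (LINT x|lebesgue_on U. f i (q (r k)) x * indicator (E n) x)) \<longlonglongrightarrow> l - l"
          by (intro tendsto_diff filterlim_compose[OF l inf(1)] filterlim_compose[OF l inf(2)])
        then show "(\<lambda>k. LINT x|lebesgue_on U. (f i (q (p k)) x - f i (q (r k)) x) * indicator (E n) x) \<longlonglongrightarrow> 0"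
          unfolding eq[OF iI] by simp
      qed (rule h)
      then show "(\<lambda>k. (LINT x|lebesgue_on U. f i (q (p k)) x * h x) - (LINT x|lebesgue_on U. f i (q (r k)) x * h x)) \<longlonglongrightarrow> 0"
        unfolding eq[OF h] .
    qed
    show ?thesis
    proof (rule weakstar_limit_exists[of "\<lambda>j. f i (q j)"])
      show "f i (q j) \<in> borel_measurable (lebesgue_on U)" "0 \<le> f i (q j) x" "f i (q j) x \<le> 1" for j x by (rule f)+
      show "convergent (\<lambda>j. LINT x|lebesgue_on U. f i (q j) x * h x)" if "integrable (lebesgue_on U) h" for h
        by (rule conv[OF that])
      fix m assume "m \<in> borel_measurable (lebesgue_on U)" "\<And>x. 0 \<le> m x" "\<And>x. m x \<le> 1"
        "\<And>h. integrable (lebesgue_on U) h \<Longrightarrow>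
          (\<lambda>j. LINT x|lebesgue_on U. f i (q j) x * h x) \<longlonglongrightarrow> (LINT x|lebesgue_on U. m x * h x)"
      then show ?thesis unfolding is_limit_def by blast
    qed
  qed
  then obtain m where m: "\<And>i. is_limit i (m i)" by metis
  show ?thesis
    by (rule that[OF q(1), of m]) (use m in \<open>simp_all add: is_limit_def\<close>)
qed

text \<open>
  Polynomials approximate \<open>\<psi>\<close> uniformly on the unit interval, and for polynomials the claim is
  linear in the moments. The family \<open>\<Lambda>\<close> comes from a pointwise choice, so that the
  measurable function \<open>\<Psi>\<close> is part of the conclusion.
\<close>

lemma (in finite_measure) weakstar_limit_of_moments:
  fixes g :: "nat \<Rightarrow> 'a \<Rightarrow> real" and m :: "nat \<Rightarrow> 'a \<Rightarrow> real" and \<Lambda> :: "'a \<Rightarrow> real measure" and \<psi> :: "real \<Rightarrow> real"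
  assumes g: "\<And>k. g k \<in> borel_measurable M" "\<And>k x. 0 \<le> g k x \<and> g k x \<le> 1"
    and m: "\<And>i. m i \<in> borel_measurable M" "\<And>i x. \<bar>m i x\<bar> \<le> 1"
    and lim: "\<And>i h. integrable M h \<Longrightarrow> (\<lambda>k. LINT x|M. g k x ^ i * h x) \<longlonglongrightarrow> (LINT x|M. m i x * h x)"
    and \<Lambda>: "AE x in M. prob_space (\<Lambda> x) \<and> sets (\<Lambda> x) = sets borel \<and> (AE t in \<Lambda> x. 0 \<le> t \<and> t \<le> 1)
      \<and> (\<forall>i. (LINT t|\<Lambda> x. t ^ i) = m i x)"
    and \<psi>: "continuous_on UNIV \<psi>"
  obtains \<Psi> C where "\<Psi> \<in> borel_measurable M" "\<And>x. \<bar>\<Psi> x\<bar> \<le> C" "AE x in M. \<Psi> x = (LINT t|\<Lambda> x. \<psi> t)"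
    "\<And>h. integrable M h \<Longrightarrow> (\<lambda>k. LINT x|M. \<psi> (g k x) * h x) \<longlonglongrightarrow> (LINT x|M. \<Psi> x * h x)"
proof -
  have "\<exists>a N. \<forall>t\<in>{0..1}. \<bar>\<psi> t - (\<Sum>i\<le>N. a i * t ^ i)\<bar> < 1 / real (Suc n)" for n
  proof -
    obtain p where p: "real_polynomial_function p" "\<And>t. t \<in> {0..1} \<Longrightarrow> \<bar>\<psi> t - p t\<bar> < 1 / real (Suc n)"
    proof -
      have "compact {0..1::real}" "continuous_on {0..1} \<psi>" "0 < 1 / real (Suc n)"
        using continuous_on_subset[OF \<psi>] by auto
      from Stone_Weierstrass_real_polynomial_function[OF this] that show ?thesis by blast
    qed
    from real_polynomial_function_iff_sum[THEN iffD1, OF p(1)]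
    obtain a N where "p = (\<lambda>t. \<Sum>i\<le>N. a i * t ^ i)" by (elim exE)
    with p(2) show ?thesis by blast
  qed
  then obtain a N where aN: "\<And>n t. t \<in> {0..1} \<Longrightarrow> \<bar>\<psi> t - (\<Sum>i\<le>N n. a n i * t ^ i)\<bar> < 1 / real (Suc n)" by metis
  define p where "p n t = (\<Sum>i\<le>N n. a n i * t ^ i)" for n t
  have p: "\<bar>\<psi> t - p n t\<bar> \<le> 1 / real (Suc n)" if "0 \<le> t" "t \<le> 1" for n t
    using aN[of t n] that by (simp add: p_def less_imp_le)
  define P where "P n x = (\<Sum>i\<le>N n. a n i * m i x)" for n x
  have Pm [measurable]: "P n \<in> borel_measurable M" for n unfolding P_def[abs_def] using m(1) by measurable
  obtain C0 where C0: "\<And>t. 0 \<le> t \<Longrightarrow> t \<le> 1 \<Longrightarrow> \<bar>\<psi> t\<bar> \<le> C0"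
  proof -
    have "compact (\<psi> ` {0..1})" by (intro compact_continuous_image continuous_on_subset[OF \<psi>]) auto
    then obtain b where "\<forall>x\<in>\<psi> ` {0..1}. norm x \<le> b" using compact_imp_bounded bounded_iff by blast
    then show ?thesis by (intro that[of b]) auto
  qed
  define C where "C = max C0 0"
  have C: "\<And>t. 0 \<le> t \<Longrightarrow> t \<le> 1 \<Longrightarrow> \<bar>\<psi> t\<bar> \<le> C" "0 \<le> C" using C0 by (auto simp: C_def intro: max.coboundedI1)
  have \<psi>m: "\<psi> \<in> borel_measurable borel" using \<psi> by (rule borel_measurable_continuous_onI)
  have AEx: "AE x in M. (\<forall>n. \<bar>(LINT t|\<Lambda> x. \<psi> t) - P n x\<bar> \<le> 1 / real (Suc n)) \<and> \<bar>LINT t|\<Lambda> x. \<psi> t\<bar> \<le> C"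
    using \<Lambda>
  proof eventually_elim
    case (elim x)
    interpret l: prob_space "\<Lambda> x" using elim by blast
    have s: "sets (\<Lambda> x) = sets borel" and t01: "AE t in \<Lambda> x. 0 \<le> t \<and> t \<le> 1" using elim by auto
    have bm: "u \<in> borel_measurable (\<Lambda> x)" if "u \<in> borel_measurable borel" for u :: "real \<Rightarrow> real"
      using that measurable_cong_sets[OF s refl] by blast
    have int: "integrable (\<Lambda> x) u" if "u \<in> borel_measurable borel" "\<And>t. 0 \<le> t \<Longrightarrow> t \<le> 1 \<Longrightarrow> \<bar>u t\<bar> \<le> c" for u :: "real \<Rightarrow> real" and c
    proof (rule l.integrable_const_bound[where B=c])
      show "AE t in \<Lambda> x. norm (u t) \<le> c" using t01 by eventually_elim (use that(2) in simp)
      show "u \<in> borel_measurable (\<Lambda> x)" by (rule bm[OF that(1)])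
    qed
    have bound: "\<bar>LINT t|\<Lambda> x. u t\<bar> \<le> c" if u: "u \<in> borel_measurable borel" "\<And>t. 0 \<le> t \<Longrightarrow> t \<le> 1 \<Longrightarrow> \<bar>u t\<bar> \<le> c" for u :: "real \<Rightarrow> real" and c
    proof -
      have "\<bar>LINT t|\<Lambda> x. u t\<bar> \<le> (LINT t|\<Lambda> x. \<bar>u t\<bar>)" by (rule integral_abs_bound)
      also have "\<dots> \<le> (LINT t|\<Lambda> x. c)"
      proof (rule integral_mono_AE)
        show "AE t in \<Lambda> x. \<bar>u t\<bar> \<le> c" using t01 by eventually_elim (use u(2) in simp)
        show "integrable (\<Lambda> x) (\<lambda>t. \<bar>u t\<bar>)" using int[OF u] by (rule integrable_abs)
      qed (rule l.integrable_const)
      finally show ?thesis using l.prob_space by simp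
    qed
    have pw: "integrable (\<Lambda> x) (\<lambda>t. t ^ i)" for i
      by (rule int[of _ 1]) (auto simp: power_le_one)
    have Pint: "(LINT t|\<Lambda> x. p n t) = P n x" for n
      unfolding p_def P_def using elim pw by (subst Bochner_Integration.integral_sum) auto
    have pint: "integrable (\<Lambda> x) (p n)" for n unfolding p_def[abs_def] using pw by auto
    have "\<bar>(LINT t|\<Lambda> x. \<psi> t) - P n x\<bar> \<le> 1 / real (Suc n)" for n
    proof -
      have "(LINT t|\<Lambda> x. \<psi> t) - P n x = (LINT t|\<Lambda> x. \<psi> t - p n t)"
        unfolding Pint[symmetric] by (rule Bochner_Integration.integral_diff[OF int[OF \<psi>m C(1)] pint, symmetric])
      moreover have "\<bar>LINT t|\<Lambda> x. \<psi> t - p n t\<bar> \<le> 1 / real (Suc n)"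
        by (rule bound[OF _ p]) (use \<psi>m in \<open>auto simp: p_def[abs_def]\<close>)
      ultimately show ?thesis by simp
    qed
    moreover have "\<bar>LINT t|\<Lambda> x. \<psi> t\<bar> \<le> C" by (rule bound[OF \<psi>m C(1)])
    ultimately show ?case by blast
  qed
  \<comment> \<open>a limit of combinations of the \<open>m i\<close> is measurable, whatever the dependence of \<open>\<Lambda>\<close> on \<open>x\<close>\<close>
  define \<Psi>0 where "\<Psi>0 x = lim (\<lambda>n. P n x)" for x
  have \<Psi>0m [measurable]: "\<Psi>0 \<in> borel_measurable M" unfolding \<Psi>0_def[abs_def] by (rule borel_measurable_lim_metric[OF Pm])
  have \<Psi>0eq: "AE x in M. \<Psi>0 x = (LINT t|\<Lambda> x. \<psi> t)"
    using AEx
  proof eventually_elim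
    case (elim x)
    have "(\<lambda>n. P n x - (LINT t|\<Lambda> x. \<psi> t)) \<longlonglongrightarrow> 0"
      by (rule Lim_null_comparison[OF _ LIMSEQ_Suc[OF lim_1_over_n]])
        (use elim in \<open>auto intro!: always_eventually simp: abs_minus_commute\<close>)
    then have "(\<lambda>n. P n x) \<longlonglongrightarrow> (LINT t|\<Lambda> x. \<psi> t)" by (simp add: LIM_zero_iff)
    then show ?case unfolding \<Psi>0_def by (rule limI)
  qed
  define \<Psi> where "\<Psi> x = max (- C) (min C (\<Psi>0 x))" for x
  have \<Psi>m [measurable]: "\<Psi> \<in> borel_measurable M" unfolding \<Psi>_def[abs_def] by measurable
  have \<Psi>C: "\<bar>\<Psi> x\<bar> \<le> C" for x using C(2) by (auto simp: \<Psi>_def abs_le_iff)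
  have \<Psi>eq: "AE x in M. \<Psi> x = (LINT t|\<Lambda> x. \<psi> t)"
    using \<Psi>0eq AEx by eventually_elim (auto simp: \<Psi>_def abs_le_iff)
  have \<Psi>P: "AE x in M. \<bar>\<Psi> x - P n x\<bar> \<le> 1 / real (Suc n)" for n
    using \<Psi>eq AEx by eventually_elim auto
  show ?thesis
  proof (rule that[OF \<Psi>m \<Psi>C \<Psi>eq])
    fix h :: "'a \<Rightarrow> real" assume h: "integrable M h"
    define H where "H = (LINT x|M. \<bar>h x\<bar>)"
    have H0: "0 \<le> H" unfolding H_def by (rule Bochner_Integration.integral_nonneg) simp
    have \<psi>g: "(\<lambda>x. \<psi> (g k x)) \<in> borel_measurable M" for k by (rule measurable_compose[OF g(1) \<psi>m])
    have int1: "integrable M (\<lambda>x. \<psi> (g k x) * h x)" for k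
      by (rule integrable_bounded_mult[OF \<psi>g _ h]) (use C(1) g(2) in blast)
    have gpow: "integrable M (\<lambda>x. g k x ^ i * h x)" for k i
      by (rule integrable_bounded_mult[OF _ _ h, where K=1]) (use g in \<open>auto simp: power_le_one abs_of_nonneg\<close>)
    have int2: "integrable M (\<lambda>x. p n (g k x) * h x)" for n k
      unfolding p_def sum_distrib_right using gpow by (auto simp: mult.assoc)
    have int3: "integrable M (\<lambda>x. \<Psi> x * h x)" by (rule integrable_bounded_mult[OF \<Psi>m \<Psi>C h])
    have int4: "integrable M (\<lambda>x. P n x * h x)" for n
      unfolding P_def sum_distrib_right using integrable_bounded_mult[OF m h] by (auto simp: mult.assoc)
    have limP: "(\<lambda>k. LINT x|M. p n (g k x) * h x) \<longlonglongrightarrow> (LINT x|M. P n x * h x)" for n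
    proof -
      have "(\<lambda>k. \<Sum>i\<le>N n. a n i * (LINT x|M. g k x ^ i * h x)) \<longlonglongrightarrow> (\<Sum>i\<le>N n. a n i * (LINT x|M. m i x * h x))"
        by (intro tendsto_sum tendsto_mult tendsto_const lim h)
      moreover have "(LINT x|M. p n (g k x) * h x) = (\<Sum>i\<le>N n. a n i * (LINT x|M. g k x ^ i * h x))" for k
        unfolding p_def sum_distrib_right using gpow by (subst Bochner_Integration.integral_sum) (auto simp: mult.assoc)
      moreover have "(LINT x|M. P n x * h x) = (\<Sum>i\<le>N n. a n i * (LINT x|M. m i x * h x))"
        unfolding P_def sum_distrib_right using integrable_bounded_mult[OF m h] by (subst Bochner_Integration.integral_sum) (auto simp: mult.assoc)
      ultimately show ?thesis by simp
    qed
    have d1: "\<bar>(LINT x|M. \<psi> (g k x) * h x) - (LINT x|M. p n (g k x) * h x)\<bar> \<le> H / real (Suc n)" for k n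
    proof -
      have "(LINT x|M. \<psi> (g k x) * h x) - (LINT x|M. p n (g k x) * h x) = (LINT x|M. \<psi> (g k x) * h x - p n (g k x) * h x)"
        by (rule Bochner_Integration.integral_diff[OF int1 int2, symmetric])
      also have "\<bar>\<dots>\<bar> \<le> (LINT x|M. \<bar>\<psi> (g k x) * h x - p n (g k x) * h x\<bar>)" by (rule integral_abs_bound)
      also have "\<dots> \<le> (LINT x|M. 1 / real (Suc n) * \<bar>h x\<bar>)"
      proof (rule integral_mono)
        show "integrable M (\<lambda>x. \<bar>\<psi> (g k x) * h x - p n (g k x) * h x\<bar>)" using int1 int2 by (intro integrable_abs Bochner_Integration.integrable_diff)
        show "\<bar>\<psi> (g k x) * h x - p n (g k x) * h x\<bar> \<le> 1 / real (Suc n) * \<bar>h x\<bar>" for x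
          unfolding left_diff_distrib[symmetric] abs_mult using g(2)[of k x] by (intro mult_right_mono p) auto
      qed (use h in simp)
      finally show ?thesis by (simp add: H_def)
    qed
    have d2: "\<bar>(LINT x|M. \<Psi> x * h x) - (LINT x|M. P n x * h x)\<bar> \<le> H / real (Suc n)" for n
    proof -
      have "(LINT x|M. \<Psi> x * h x) - (LINT x|M. P n x * h x) = (LINT x|M. \<Psi> x * h x - P n x * h x)"
        by (rule Bochner_Integration.integral_diff[OF int3 int4, symmetric])
      also have "\<bar>\<dots>\<bar> \<le> (LINT x|M. \<bar>\<Psi> x * h x - P n x * h x\<bar>)" by (rule integral_abs_bound)
      also have "\<dots> \<le> (LINT x|M. 1 / real (Suc n) * \<bar>h x\<bar>)"
      proof (rule integral_mono_AE)
        show "integrable M (\<lambda>x. \<bar>\<Psi> x * h x - P n x * h x\<bar>)" using int3 int4 by (intro integrable_abs Bochner_Integration.integrable_diff)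
        show "AE x in M. \<bar>\<Psi> x * h x - P n x * h x\<bar> \<le> 1 / real (Suc n) * \<bar>h x\<bar>"
          using \<Psi>P[of n]
        proof eventually_elim
          case (elim x)
          then show ?case unfolding left_diff_distrib[symmetric] abs_mult by (intro mult_right_mono) auto
        qed
      qed (use h in simp)
      finally show ?thesis by (simp add: H_def)
    qed
    show "(\<lambda>k. LINT x|M. \<psi> (g k x) * h x) \<longlonglongrightarrow> (LINT x|M. \<Psi> x * h x)"
    proof (rule LIMSEQ_I)
      fix e :: real assume e: "0 < e"
      have "(\<lambda>n. H / real (Suc n)) \<longlonglongrightarrow> 0"
        using tendsto_mult_right_zero[OF LIMSEQ_Suc[OF lim_1_over_n], of H] by simp
      then obtain n where n: "H / real (Suc n) < e / 3"
        using order_tendstoD(2)[of _ 0 sequentially "e / 3"] e by (metis eventually_happens' trivial_limit_sequentially divide_pos_pos zero_less_numeral)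
      obtain K where K: "\<And>k. K \<le> k \<Longrightarrow> norm ((LINT x|M. p n (g k x) * h x) - (LINT x|M. P n x * h x)) < e / 3"
        using LIMSEQ_D[OF limP[of n], of "e / 3"] e by auto
      show "\<exists>K. \<forall>k\<ge>K. norm ((LINT x|M. \<psi> (g k x) * h x) - (LINT x|M. \<Psi> x * h x)) < e"
      proof (intro exI allI impI)
        fix k assume "K \<le> k"
        from K[OF this] d1[of k n] d2[of n] n
        show "norm ((LINT x|M. \<psi> (g k x) * h x) - (LINT x|M. \<Psi> x * h x)) < e"
          unfolding real_norm_def by linarith
      qed
    qed
  qed
qed

text \<open>
  For fixed \<open>x\<close> the integrals over \<open>y\<close> converge and stay bounded, so that as functions of
  \<open>x\<close> they converge in \<open>L\<^sup>1\<close>; the product of a strongly and a weakly* convergent bounded sequence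
  passes to the limit.
\<close>

lemma (in finite_measure) weakstar_tendsto_tensor:
  fixes f g :: "nat \<Rightarrow> 'a \<Rightarrow> real"
  assumes f: "\<And>k. f k \<in> borel_measurable M" "\<And>k x. \<bar>f k x\<bar> \<le> K"
    and g: "\<And>k. g k \<in> borel_measurable M" "\<And>k x. \<bar>g k x\<bar> \<le> K"
    and f': "f' \<in> borel_measurable M" "\<And>x. \<bar>f' x\<bar> \<le> K"
    and g': "g' \<in> borel_measurable M" "\<And>x. \<bar>g' x\<bar> \<le> K"
    and flim: "\<And>h. integrable M h \<Longrightarrow> (\<lambda>k. LINT x|M. f k x * h x) \<longlonglongrightarrow> (LINT x|M. f' x * h x)"
    and glim: "\<And>h. integrable M h \<Longrightarrow> (\<lambda>k. LINT x|M. g k x * h x) \<longlonglongrightarrow> (LINT x|M. g' x * h x)"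
    and A: "A \<in> sets (M \<Otimes>\<^sub>M M)"
  shows "(\<lambda>k. LINT p|(M \<Otimes>\<^sub>M M). f k (fst p) * g k (snd p) * indicator A p)
    \<longlonglongrightarrow> (LINT p|(M \<Otimes>\<^sub>M M). f' (fst p) * g' (snd p) * indicator A p)"
    and "integrable (M \<Otimes>\<^sub>M M) (\<lambda>p. f' (fst p) * g' (snd p) * indicator A p)"
proof -
  note [measurable] = A
  define H where "H b x = (LINT y|M. b y * indicator A (x, y))" for b :: "'a \<Rightarrow> real" and x
  have Hm: "H b \<in> borel_measurable M" if [measurable]: "b \<in> borel_measurable M" for b
  proof -
    have "(\<lambda>(x, y). b y * indicator A (x, y)) = (\<lambda>p. b (snd p) * indicator A p)" by auto
    moreover have "(\<lambda>p. b (snd p) * indicator A p) \<in> borel_measurable (M \<Otimes>\<^sub>M M)" by measurable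
    ultimately have "(\<lambda>(x, y). b y * indicator A (x, y)) \<in> borel_measurable (M \<Otimes>\<^sub>M M)" by simp
    then show ?thesis unfolding H_def[abs_def] using borel_measurable_lebesgue_integral[of "\<lambda>x y. b y * indicator A (x, y)" M] by simp
  qed
  interpret pair_sigma_finite M M ..
  interpret P: finite_measure "M \<Otimes>\<^sub>M M" by (rule finite_measure_pair_measure) unfold_locales
  have K0: "0 \<le> K" using f(2)[of 0 undefined] by linarith
  note [measurable] = A
  have tensor_int: "integrable (M \<Otimes>\<^sub>M M) (\<lambda>p. a (fst p) * b (snd p) * indicator A p)"
    if ab [measurable]: "a \<in> borel_measurable M" "b \<in> borel_measurable M" and ab': "\<And>x. \<bar>a x\<bar> \<le> K" "\<And>x. \<bar>b x\<bar> \<le> K" for a b :: "'a \<Rightarrow> real"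
  proof (rule P.integrable_const_bound[where B="K * K"])
    show "(\<lambda>p. a (fst p) * b (snd p) * indicator A p) \<in> borel_measurable (M \<Otimes>\<^sub>M M)" by measurable
    show "AE p in M \<Otimes>\<^sub>M M. norm (a (fst p) * b (snd p) * indicator A p) \<le> K * K"
    proof (rule AE_I2)
      fix p
      have "\<bar>a (fst p)\<bar> * \<bar>b (snd p)\<bar> \<le> K * K" by (intro mult_mono ab' K0 abs_ge_zero)
      then show "norm (a (fst p) * b (snd p) * indicator A p) \<le> K * K"
        using K0 by (cases "p \<in> A") (simp_all add: abs_mult)
    qed
  qed
  show "integrable (M \<Otimes>\<^sub>M M) (\<lambda>p. f' (fst p) * g' (snd p) * indicator A p)"
    by (rule tensor_int[OF f'(1) g'(1) f'(2) g'(2)])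
  have sec: "integrable M (\<lambda>y. indicator A (x, y) :: real)" if "x \<in> space M" for x
  proof (rule integrable_const_bound[where B=1])
    show "(\<lambda>y. indicator A (x, y) :: real) \<in> borel_measurable M" using that by measurable
  qed auto
  have fub: "(LINT p|(M \<Otimes>\<^sub>M M). a (fst p) * b (snd p) * indicator A p) = (LINT x|M. a x * H b x)"
    if ab: "a \<in> borel_measurable M" "b \<in> borel_measurable M" "\<And>x. \<bar>a x\<bar> \<le> K" "\<And>x. \<bar>b x\<bar> \<le> K" for a b :: "'a \<Rightarrow> real"
    using integral_fst'[OF tensor_int[OF ab]] by (simp add: H_def mult.assoc)
  have Hb: "\<bar>H b x\<bar> \<le> K * measure M (space M)" if b: "b \<in> borel_measurable M" "\<And>x. \<bar>b x\<bar> \<le> K" and x: "x \<in> space M" for b x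
  proof -
    have "\<bar>H b x\<bar> \<le> K * (LINT y|M. \<bar>indicator A (x, y)\<bar>)"
      unfolding H_def by (rule integral_bounded_mult[OF b sec[OF x]])
    also have "\<dots> \<le> K * (LINT y|M. 1)"
      by (intro mult_left_mono K0 integral_mono integrable_abs sec[OF x]) (auto simp: indicator_def)
    finally show ?thesis by simp
  qed
  have Hint: "integrable M (H b)" if b: "b \<in> borel_measurable M" "\<And>x. \<bar>b x\<bar> \<le> K" for b
    by (rule integrable_const_bound[where B="K * measure M (space M)"]) (use Hb[OF b] Hm[OF b(1)] in auto)
  have strong: "(\<lambda>k. LINT x|M. \<bar>H (g k) x - H g' x\<bar>) \<longlonglongrightarrow> (LINT x|M. 0)"
  proof (rule integral_dominated_convergence)
    show "integrable M (\<lambda>x. 2 * (K * measure M (space M)))" by simp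
    show "AE x in M. (\<lambda>k. \<bar>H (g k) x - H g' x\<bar>) \<longlonglongrightarrow> 0"
    proof (rule AE_I2)
      fix x assume x: "x \<in> space M"
      have "(\<lambda>k. H (g k) x - H g' x) \<longlonglongrightarrow> 0"
        using glim[OF sec[OF x]] unfolding H_def by (rule LIM_zero)
      then show "(\<lambda>k. \<bar>H (g k) x - H g' x\<bar>) \<longlonglongrightarrow> 0" by (rule tendsto_rabs_zero)
    qed
    show "AE x in M. norm \<bar>H (g k) x - H g' x\<bar> \<le> 2 * (K * measure M (space M))" for k
    proof (rule AE_I2)
      fix x assume x: "x \<in> space M"
      show "norm \<bar>H (g k) x - H g' x\<bar> \<le> 2 * (K * measure M (space M))"
        using Hb[OF g x, of k] Hb[OF g' x] unfolding real_norm_def by linarith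
    qed
  qed (use Hm[OF g(1)] Hm[OF g'(1)] in measurable)
  have "(\<lambda>k. (LINT x|M. f k x * (H (g k) x - H g' x)) + (LINT x|M. f k x * H g' x)) \<longlonglongrightarrow> 0 + (LINT x|M. f' x * H g' x)"
  proof (intro tendsto_add flim Hint[OF g'])
    have le: "norm (LINT x|M. f k x * (H (g k) x - H g' x)) \<le> K * (LINT x|M. \<bar>H (g k) x - H g' x\<bar>)" for k
      unfolding real_norm_def
      by (rule integral_bounded_mult[OF f]) (intro Bochner_Integration.integrable_diff Hint g g')
    have Kl: "(\<lambda>k. K * (LINT x|M. \<bar>H (g k) x - H g' x\<bar>)) \<longlonglongrightarrow> 0"
      using tendsto_mult_right_zero[OF strong[unfolded Bochner_Integration.integral_zero], of K] .
    show "(\<lambda>k. LINT x|M. f k x * (H (g k) x - H g' x)) \<longlonglongrightarrow> 0"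
      by (rule Lim_null_comparison[OF always_eventually[OF allI[OF le]] Kl])
  qed
  moreover have "(LINT x|M. f k x * (H (g k) x - H g' x)) + (LINT x|M. f k x * H g' x) = (LINT x|M. f k x * H (g k) x)" for k
  proof -
    have "(LINT x|M. f k x * (H (g k) x - H g' x)) = (LINT x|M. f k x * H (g k) x) - (LINT x|M. f k x * H g' x)"
      unfolding right_diff_distrib
      by (rule Bochner_Integration.integral_diff[OF integrable_bounded_mult[OF f Hint[OF g]] integrable_bounded_mult[OF f Hint[OF g']]])
    then show ?thesis by simp
  qed
  ultimately show "(\<lambda>k. LINT p|(M \<Otimes>\<^sub>M M). f k (fst p) * g k (snd p) * indicator A p)
    \<longlonglongrightarrow> (LINT p|(M \<Otimes>\<^sub>M M). f' (fst p) * g' (snd p) * indicator A p)"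
    unfolding fub[OF f(1) g(1) f(2) g(2)] fub[OF f'(1) g'(1) f'(2) g'(2)] by simp
qed

text \<open>
  The integral of the limit over \<open>A\<close> is a limit of zeros, and the limit is nonnegative.
\<close>

lemma (in finite_measure) weakstar_tensor_AE_zero:
  fixes f g :: "nat \<Rightarrow> 'a \<Rightarrow> real"
  assumes f: "\<And>k. f k \<in> borel_measurable M" "\<And>k x. \<bar>f k x\<bar> \<le> K"
    and g: "\<And>k. g k \<in> borel_measurable M" "\<And>k x. \<bar>g k x\<bar> \<le> K"
    and f': "f' \<in> borel_measurable M" "\<And>x. \<bar>f' x\<bar> \<le> K" "AE x in M. 0 \<le> f' x"
    and g': "g' \<in> borel_measurable M" "\<And>x. \<bar>g' x\<bar> \<le> K" "AE x in M. 0 \<le> g' x"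
    and flim: "\<And>h. integrable M h \<Longrightarrow> (\<lambda>k. LINT x|M. f k x * h x) \<longlonglongrightarrow> (LINT x|M. f' x * h x)"
    and glim: "\<And>h. integrable M h \<Longrightarrow> (\<lambda>k. LINT x|M. g k x * h x) \<longlonglongrightarrow> (LINT x|M. g' x * h x)"
    and A: "A \<in> sets (M \<Otimes>\<^sub>M M)" and zero: "\<And>k p. p \<in> A \<Longrightarrow> f k (fst p) * g k (snd p) = 0"
  shows "AE p in M \<Otimes>\<^sub>M M. p \<in> A \<longrightarrow> f' (fst p) * g' (snd p) = 0"
proof -
  interpret pair_sigma_finite M M ..
  note lim = weakstar_tendsto_tensor[OF f g f'(1,2) g'(1,2) flim glim A]
  have z: "f k (fst p) * g k (snd p) * indicator A p = (0 :: real)" for k p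
    using zero[of p k] by (cases "p \<in> A") simp_all
  have "(LINT p|(M \<Otimes>\<^sub>M M). f' (fst p) * g' (snd p) * indicator A p) = 0"
    using lim(1) unfolding z by (simp add: LIMSEQ_const_iff)
  moreover have "AE p in M \<Otimes>\<^sub>M M. 0 \<le> f' (fst p) * g' (snd p) * indicator A p"
  proof -
    note [measurable] = f'(1) g'(1)
    have "AE p in M \<Otimes>\<^sub>M M. 0 \<le> f' (fst p)"
      by (rule AE_pair_measure) (use f'(3) in auto)
    moreover have "AE p in M \<Otimes>\<^sub>M M. 0 \<le> g' (snd p)"
      by (rule AE_pair_measure) (use g'(3) in auto)
    ultimately show ?thesis by eventually_elim simp
  qed
  ultimately have "AE p in M \<Otimes>\<^sub>M M. f' (fst p) * g' (snd p) * indicator A p = 0"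
    using integral_nonneg_eq_0_iff_AE[OF lim(2)] by blast
  then show ?thesis by eventually_elim (auto simp: indicator_def)
qed

section \<open>Smooth bump functions and test functions\<close>

text \<open>
  The one-dimensional counterpart of \<open>C_k\<close>. Test functions are built as products of functions of
  single coordinates, and \<open>C_k_prod\<close> transfers the regularity.
\<close>

primrec C1_k :: "nat \<Rightarrow> (real \<Rightarrow> real) \<Rightarrow> bool" where
  "C1_k 0 g \<longleftrightarrow> continuous_on UNIV g"
| "C1_k (Suc k) g \<longleftrightarrow> (\<exists>g'. (\<forall>t. (g has_real_derivative g' t) (at t)) \<and> C1_k k g')"

lemma C1_k_continuous: "C1_k k g \<Longrightarrow> continuous_on UNIV g"
proof (cases k)
  case (Suc l)
  moreover assume "C1_k k g"
  ultimately obtain g' where "\<And>t. (g has_real_derivative g' t) (at t)" by auto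
  then show ?thesis by (intro DERIV_continuous_on[of UNIV g g']) simp
qed simp

lemma C1_k_SucD: "C1_k (Suc k) g \<Longrightarrow> C1_k k g"
proof (induction k arbitrary: g)
  case 0 then show ?case using C1_k_continuous[of 1 g] by simp
next
  case (Suc k) then show ?case by auto
qed

lemma C1_k_add: "C1_k k f \<Longrightarrow> C1_k k g \<Longrightarrow> C1_k k (\<lambda>t. f t + g t)"
proof (induction k arbitrary: f g)
  case 0 then show ?case by (auto intro: continuous_intros)
next
  case (Suc k)
  then obtain f' g' where "\<forall>t. (f has_real_derivative f' t) (at t)" "C1_k k f'"
    "\<forall>t. (g has_real_derivative g' t) (at t)" "C1_k k g'" by auto
  with Suc.IH[of f' g'] show ?case by (auto intro!: exI[of _ "\<lambda>t. f' t + g' t"] DERIV_add)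
qed

lemma C1_k_mult: "C1_k k f \<Longrightarrow> C1_k k g \<Longrightarrow> C1_k k (\<lambda>t. f t * g t)"
proof (induction k arbitrary: f g)
  case 0 then show ?case by (auto intro: continuous_intros)
next
  case (Suc k)
  then obtain f' g' where d: "\<forall>t. (f has_real_derivative f' t) (at t)" "C1_k k f'"
    "\<forall>t. (g has_real_derivative g' t) (at t)" "C1_k k g'" by auto
  have "C1_k k (\<lambda>t. f' t * g t + g' t * f t)"
    using Suc.prems d by (intro C1_k_add Suc.IH C1_k_SucD[of k f] C1_k_SucD[of k g])
  moreover have "((\<lambda>t. f t * g t) has_real_derivative f' t * g t + g' t * f t) (at t)" for t
    using d by (intro DERIV_mult) auto
  ultimately show ?case by (auto intro!: exI[of _ "\<lambda>t. f' t * g t + g' t * f t"])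
qed

lemma C1_k_const: "C1_k k (\<lambda>t. c)"
proof (induction k arbitrary: c)
  case (Suc k) then show ?case by (auto intro!: exI[of _ "\<lambda>t. 0"])
qed auto

lemma C1_k_affine: "C1_k k g \<Longrightarrow> C1_k k (\<lambda>t. g (a + b * t))"
proof (induction k arbitrary: g)
  case 0 then show ?case
    unfolding C1_k.simps by (rule continuous_on_compose2) (auto intro!: continuous_intros)
next
  case (Suc k)
  then obtain g' where d: "\<forall>t. (g has_real_derivative g' t) (at t)" "C1_k k g'" by auto
  have "((\<lambda>t. g (a + b * t)) has_real_derivative g' (a + b * t) * b) (at t)" for t
  proof -
    have "((\<lambda>t. a + b * t) has_real_derivative 0 + b * 1) (at t)"
      by (intro DERIV_add DERIV_const DERIV_cmult DERIV_ident)
    then have "((\<lambda>t. a + b * t) has_real_derivative b) (at t)" unfolding add_0 mult_1_right .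
    then show ?thesis by (rule DERIV_chain2[OF spec[OF d(1)]])
  qed
  moreover have "C1_k k (\<lambda>t. g' (a + b * t) * b)"
    by (rule C1_k_mult[OF Suc.IH[OF d(2)] C1_k_const])
  ultimately show ?case
    unfolding C1_k.simps by (intro exI[of _ "\<lambda>t. g' (a + b * t) * b"] conjI allI)
qed

text \<open>
  The smooth functions \<open>p (1/t) * exp (- 1/t)\<close>, extended by \<open>0\<close> to \<open>t \<le> 0\<close>. With a polynomial factor
  the family is closed under differentiation, so that one derivative formula gives smoothness.
\<close>

definition exp_bump :: "real poly \<Rightarrow> real \<Rightarrow> real" where
  "exp_bump p t = (if 0 < t then poly p (1 / t) * exp (- (1 / t)) else 0)"

lemma poly_exp_decay: "((\<lambda>s. poly p s * exp (- s)) \<longlongrightarrow> 0) at_top" for p :: "real poly"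
proof -
  have "((\<lambda>s. \<Sum>i\<le>degree p. coeff p i * (s ^ i / exp s)) \<longlongrightarrow> (\<Sum>i\<le>degree p. coeff p i * 0)) at_top"
    by (intro tendsto_intros tendsto_power_div_exp_0)
  then show ?thesis by (simp add: poly_altdef exp_minus field_simps sum_distrib_left sum_distrib_right)
qed

lemma exp_bump_deriv:
  "(exp_bump p has_real_derivative exp_bump ([:0, 0, 1:] * (p - pderiv p)) t) (at t)"
proof -
  consider "t < 0" | "t = 0" | "0 < t" by linarith
  then show ?thesis
  proof cases
    case 1
    have "((\<lambda>t. 0 :: real) has_real_derivative 0) (at t)" by simp
    then have "(exp_bump p has_real_derivative 0) (at t)"
      by (rule has_field_derivative_transform_within_open[of _ _ _ "{..<0}"]) (use 1 in \<open>auto simp: exp_bump_def\<close>)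
    then show ?thesis using 1 by (simp add: exp_bump_def)
  next
    case 3
    have inv: "((\<lambda>t. 1 / t) has_real_derivative - ((1 / t) ^ 2)) (at t)"
      using 3 by (auto intro!: derivative_eq_intros simp: power2_eq_square)
    have "((\<lambda>t. poly p (1 / t)) has_real_derivative poly (pderiv p) (1 / t) * (- ((1 / t) ^ 2))) (at t)"
      by (rule DERIV_chain2[OF poly_DERIV inv])
    moreover have "((\<lambda>t. exp (- (1 / t))) has_real_derivative exp (- (1 / t)) * (- (- ((1 / t) ^ 2)))) (at t)"
      by (rule DERIV_chain2[OF DERIV_exp DERIV_minus[OF inv]])
    ultimately have "((\<lambda>t. poly p (1 / t) * exp (- (1 / t))) has_real_derivative
        poly (pderiv p) (1 / t) * (- ((1 / t) ^ 2)) * exp (- (1 / t))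
        + exp (- (1 / t)) * (- (- ((1 / t) ^ 2))) * poly p (1 / t)) (at t)"
      by (rule DERIV_mult)
    also have "poly (pderiv p) (1 / t) * (- ((1 / t) ^ 2)) * exp (- (1 / t))
        + exp (- (1 / t)) * (- (- ((1 / t) ^ 2))) * poly p (1 / t)
      = poly ([:0, 0, 1:] * (p - pderiv p)) (1 / t) * exp (- (1 / t))"
      by (simp add: power2_eq_square diff_divide_distrib left_diff_distrib)
    finally have "((\<lambda>t. poly p (1 / t) * exp (- (1 / t))) has_real_derivative
        poly ([:0, 0, 1:] * (p - pderiv p)) (1 / t) * exp (- (1 / t))) (at t)" .
    then have "(exp_bump p has_real_derivative poly ([:0, 0, 1:] * (p - pderiv p)) (1 / t) * exp (- (1 / t))) (at t)"
      by (rule has_field_derivative_transform_within_open[of _ _ _ "{0<..}"]) (use 3 in \<open>auto simp: exp_bump_def\<close>)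
    then show ?thesis using 3 by (simp add: exp_bump_def)
  next
    case 2
    have lim: "((\<lambda>h. poly (pCons 0 p) (1 / h) * exp (- (1 / h))) \<longlongrightarrow> 0) (at_right 0)"
      using filterlim_compose[OF poly_exp_decay[of "pCons 0 p"] filterlim_inverse_at_top_right]
      by (simp add: inverse_eq_divide)
    have "((\<lambda>h. (exp_bump p (0 + h) - exp_bump p 0) / h) \<longlongrightarrow> 0) (at_right 0)"
      by (rule Lim_transform_eventually[OF lim])
        (auto simp: exp_bump_def eventually_at_filter)
    moreover have "((\<lambda>h. (exp_bump p (0 + h) - exp_bump p 0) / h) \<longlongrightarrow> 0) (at_left 0)"
      by (rule Lim_transform_eventually[OF tendsto_const])
        (auto simp: exp_bump_def eventually_at_filter)
    ultimately have "((\<lambda>h. (exp_bump p (0 + h) - exp_bump p 0) / h) \<longlongrightarrow> 0) (at 0)"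
      by (simp add: filterlim_split_at)
    then have "(exp_bump p has_real_derivative 0) (at 0)" by (simp add: DERIV_def)
    then show ?thesis using 2 by (simp add: exp_bump_def)
  qed
qed

lemma C1_k_exp_bump: "C1_k k (exp_bump p)"
proof (induction k arbitrary: p)
  case 0 show ?case
    using DERIV_continuous_on[of UNIV "exp_bump p"] exp_bump_deriv[of p] by auto
next
  case (Suc k) then show ?case 
    unfolding C1_k.simps
    by (intro exI[of _ "exp_bump ([:0, 0, 1:] * (p - pderiv p))"] conjI allI exp_bump_deriv)
qed

text \<open>
  The support is \<open>[1/4, 3/4]\<close>, so that products of bumps have compact support inside the open unit cube.
\<close>

definition bump :: "real \<Rightarrow> real" where
  "bump t = exp_bump 1 (t - 1 / 4) * exp_bump 1 (3 / 4 - t)"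

lemma C1_k_bump: "C1_k k bump"
  using C1_k_mult[OF C1_k_affine[OF C1_k_exp_bump, of k 1 "-1/4" 1] C1_k_affine[OF C1_k_exp_bump, of k 1 "3/4" "-1"]]
  by (simp add: bump_def[abs_def])

lemma bump_nonneg: "0 \<le> bump t" and bump_le1: "bump t \<le> 1"
  and bump_pos: "1 / 4 < t \<Longrightarrow> t < 3 / 4 \<Longrightarrow> 0 < bump t"
  and bump_support: "bump t \<noteq> 0 \<Longrightarrow> 1 / 4 < t \<and> t < 3 / 4"
  by (auto simp: bump_def exp_bump_def mult_le_one intro!: mult_pos_pos split: if_splits)

text \<open>
  The antiderivative is constant on both sides of the support, hence the difference of two of its
  translates is a smooth function with compact support.
\<close>

lemma bump_antiderivative:
  obtains \<Gamma> where "\<And>t. (\<Gamma> has_real_derivative bump t) (at t)" "\<And>t. t \<le> 1 / 4 \<Longrightarrow> \<Gamma> t = 0"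
    "\<And>t. 3 / 4 \<le> t \<Longrightarrow> \<Gamma> t = \<Gamma> 1" "\<And>s t. s \<le> t \<Longrightarrow> \<Gamma> s \<le> \<Gamma> t" "\<Gamma> 1 \<le> 1"
proof -
  define \<Gamma>0 where "\<Gamma>0 u = (LBINT y=0..ereal u. bump y)" for u :: real
  have cont: "continuous_on A bump" for A
    using C1_k_continuous[OF C1_k_bump] continuous_on_subset by blast
  have D0: "(\<Gamma>0 has_real_derivative bump t) (at t)" for t
  proof -
    define b where "b = \<bar>t\<bar> + 1"
    have "((\<lambda>u. LBINT y=0..ereal u. bump y) has_vector_derivative bump t) (at t within {-b..b})"
      using interval_integral_FTC2[of "-b" 0 b bump t] cont by (auto simp: b_def zero_ereal_def)
    moreover have "at t within {-b..b} = at t"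
      by (rule at_within_interior) (auto simp: b_def)
    ultimately show ?thesis by (simp add: \<Gamma>0_def[abs_def] has_real_derivative_iff_has_vector_derivative)
  qed
  define \<Gamma> where "\<Gamma> u = \<Gamma>0 u - \<Gamma>0 (1 / 4)" for u
  have D: "(\<Gamma> has_real_derivative bump t) (at t)" for t
    unfolding \<Gamma>_def[abs_def] using DERIV_diff[OF D0[of t] DERIV_const[of "\<Gamma>0 (1 / 4)"]] by simp
  have mono: "\<Gamma> s \<le> \<Gamma> t" if "s \<le> t" for s t
    by (rule DERIV_nonneg_imp_nondecreasing[OF that]) (use D bump_nonneg in blast)
  have const: "\<Gamma> s = \<Gamma> t" if "s \<le> t" "\<And>x. s < x \<Longrightarrow> x < t \<Longrightarrow> bump x = 0" for s t
  proof (cases "s = t")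
    case False
    with that(1) have "s < t" by simp
    from MVT2[OF this, of \<Gamma> bump] D obtain z where "s < z" "z < t" "\<Gamma> t - \<Gamma> s = (t - s) * bump z" by blast
    then show ?thesis using that(2)[of z] by simp
  qed simp
  have z: "\<Gamma> t = 0" if "t \<le> 1 / 4" for t
  proof -
    have "\<Gamma> t = \<Gamma> (1 / 4)" by (rule const) (use that bump_support in force)+
    then show ?thesis by (simp add: \<Gamma>_def)
  qed
  have o: "\<Gamma> t = \<Gamma> 1" if "3 / 4 \<le> t" for t
  proof -
    have "\<Gamma> (3 / 4) = \<Gamma> t" by (rule const) (use that bump_support in force)+
    moreover have "\<Gamma> (3 / 4) = \<Gamma> 1" by (rule const) (use bump_support in force)+
    ultimately show ?thesis by simp
  qed
  from MVT2[of 0 1 \<Gamma> bump] D obtain w :: real where "\<Gamma> 1 - \<Gamma> 0 = (1 - 0) * bump w" by force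
  then have "\<Gamma> 1 \<le> 1" using z[of 0] bump_le1[of w] by simp
  with that[of \<Gamma>] D z o mono show ?thesis by blast
qed

lemma prod_has_derivative:
  fixes G :: "'n::finite \<Rightarrow> real \<Rightarrow> real"
  assumes "\<And>i t. (G i has_real_derivative G' i t) (at t)"
  shows "((\<lambda>x. \<Prod>i\<in>UNIV. G i (x $ i)) has_derivative
     (\<lambda>y. \<Sum>i\<in>UNIV. G' i (x $ i) * (y $ i) * (\<Prod>l\<in>UNIV - {i}. G l (x $ l)))) (at x)"
proof (rule has_derivative_prod)
  fix i :: 'n
  have "(G i has_derivative (*) (G' i (x $ i))) (at (x $ i))"
    using assms by (simp add: has_field_derivative_def)
  from has_derivative_compose[OF bounded_linear_imp_has_derivative[OF bounded_linear_vec_nth] this]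
  show "((\<lambda>x. G i (x $ i)) has_derivative (\<lambda>y. G' i (x $ i) * (y $ i))) (at x)" .
qed

lemma partial_deriv_prod:
  fixes G :: "'n::finite \<Rightarrow> real \<Rightarrow> real"
  assumes "\<And>i t. (G i has_real_derivative G' i t) (at t)"
  shows "partial_deriv j (\<lambda>x. \<Prod>i\<in>UNIV. G i (x $ i)) = (\<lambda>x. \<Prod>i\<in>UNIV. (if i = j then G' i else G i) (x $ i))"
proof
  fix x :: "real ^ 'n"
  have "partial_deriv j (\<lambda>x. \<Prod>i\<in>UNIV. G i (x $ i)) x
      = (\<Sum>i\<in>UNIV. G' i (x $ i) * (axis j 1 $ i) * (\<Prod>l\<in>UNIV - {i}. G l (x $ l)))"
    unfolding partial_deriv_def frechet_derivative_at[OF prod_has_derivative[OF assms], symmetric] ..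
  also have "\<dots> = (\<Sum>i\<in>UNIV. if i = j then G' j (x $ j) * (\<Prod>l\<in>UNIV - {j}. G l (x $ l)) else 0)"
    by (intro sum.cong) (auto simp: axis_def)
  also have "\<dots> = G' j (x $ j) * (\<Prod>l\<in>UNIV - {j}. G l (x $ l))" by simp
  also have "\<dots> = (\<Prod>i\<in>UNIV. (if i = j then G' i else G i) (x $ i))"
    by (subst prod.remove[of UNIV j]) (auto intro!: arg_cong2[where f="(*)"] prod.cong)
  finally show "partial_deriv j (\<lambda>x. \<Prod>i\<in>UNIV. G i (x $ i)) x
     = (\<Prod>i\<in>UNIV. (if i = j then G' i else G i) (x $ i))" .
qed

lemma C_k_prod:
  fixes G :: "'n::finite \<Rightarrow> real \<Rightarrow> real"
  shows "(\<And>i. C1_k k (G i)) \<Longrightarrow> C_k k (\<lambda>x. \<Prod>i\<in>UNIV. G i (x $ i))"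
proof (induction k arbitrary: G)
  case 0
  then have "continuous_on UNIV (\<lambda>x. G i (x $ i))" for i
    unfolding C1_k.simps by (rule continuous_on_compose2[of UNIV "G i"]) (auto intro!: continuous_intros)
  then show ?case by (auto intro!: continuous_on_prod)
next
  case (Suc k)
  then have "\<forall>i. \<exists>g'. (\<forall>t. (G i has_real_derivative g' t) (at t)) \<and> C1_k k g'" by auto
  then obtain G' where G': "\<And>i t. (G i has_real_derivative G' i t) (at t)" "\<And>i. C1_k k (G' i)" by metis
  have "C_k k (\<lambda>x. \<Prod>i\<in>UNIV. (if i = j then G' i else G i) (x $ i))" for j
    by (rule Suc.IH) (use G' C1_k_SucD Suc.prems in auto)
  moreover have "(\<lambda>x. \<Prod>i\<in>UNIV. G i (x $ i)) differentiable (at x)" for x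
    unfolding differentiable_def by (intro exI) (rule prod_has_derivative[OF G'(1)])
  ultimately show ?case by (simp add: partial_deriv_prod[OF G'(1)])
qed

lemma prod_test_function:
  fixes G :: "'n::finite \<Rightarrow> real \<Rightarrow> real"
  assumes "\<And>i k. C1_k k (G i)" and supp: "\<And>i t. G i t \<noteq> 0 \<Longrightarrow> a $ i \<le> t \<and> t \<le> b $ i"
    and sub: "cbox a b \<subseteq> \<Omega>"
  shows "(\<lambda>x. \<Prod>i\<in>UNIV. G i (x $ i)) \<in> test_functions \<Omega>"
proof -
  have "{x. (\<Prod>i\<in>UNIV. G i (x $ i)) \<noteq> 0} \<subseteq> cbox a b"
    using supp by (auto simp: mem_box_cart)
  then have "closure {x. (\<Prod>i\<in>UNIV. G i (x $ i)) \<noteq> 0} \<subseteq> cbox a b"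
    by (intro closure_minimal) auto
  moreover from this have "compact (closure {x. (\<Prod>i\<in>UNIV. G i (x $ i)) \<noteq> 0})"
    using bounded_subset[OF bounded_cbox] by (simp add: compact_eq_bounded_closed del: bounded_closure_image) blast
  ultimately show ?thesis
    unfolding test_functions_def using sub C_k_prod assms(1) by blast
qed

lemma C_k_continuous: "C_k k \<phi> \<Longrightarrow> continuous_on UNIV \<phi>"
proof (cases k)
  case (Suc l)
  moreover assume "C_k k \<phi>"
  ultimately have "\<phi> differentiable (at x)" for x by simp
  then show ?thesis
    by (intro continuous_at_imp_continuous_on ballI differentiable_imp_continuous_within)
qed simp

lemma partial_deriv_affine:
  assumes "\<And>x. \<phi> differentiable (at x)"
  shows "partial_deriv j (\<lambda>x. c * \<phi> (a + r *\<^sub>R x)) = (\<lambda>x. (c * r) * partial_deriv j \<phi> (a + r *\<^sub>R x))"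
    and "(\<lambda>x. c * \<phi> (a + r *\<^sub>R x)) differentiable (at x)"
proof -
  have D: "((\<lambda>x. c * \<phi> (a + r *\<^sub>R x)) has_derivative (\<lambda>y. c * frechet_derivative \<phi> (at (a + r *\<^sub>R x)) (r *\<^sub>R y))) (at x)" for x
  proof -
    have "(\<phi> has_derivative frechet_derivative \<phi> (at (a + r *\<^sub>R x))) (at (a + r *\<^sub>R x))"
      using assms frechet_derivative_works by blast
    moreover have "((\<lambda>x. a + r *\<^sub>R x) has_derivative (\<lambda>y. r *\<^sub>R y)) (at x)"
      by (auto intro!: derivative_eq_intros)
    ultimately show ?thesis
      by (intro has_derivative_mult_right) (rule has_derivative_compose)
  qed
  show "(\<lambda>x. c * \<phi> (a + r *\<^sub>R x)) differentiable (at x)" using D differentiable_def by blast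
  have lin: "linear (frechet_derivative \<phi> (at y))" for y using assms linear_frechet_derivative by blast
  show "partial_deriv j (\<lambda>x. c * \<phi> (a + r *\<^sub>R x)) = (\<lambda>x. (c * r) * partial_deriv j \<phi> (a + r *\<^sub>R x))"
    unfolding partial_deriv_def frechet_derivative_at[OF D, symmetric] by (simp add: linear_scale[OF lin] mult.assoc)
qed

lemma C_k_affine: "C_k k \<phi> \<Longrightarrow> C_k k (\<lambda>x. c * \<phi> (a + r *\<^sub>R x))"
proof (induction k arbitrary: \<phi> c)
  case 0
  have "continuous_on UNIV (\<lambda>x. \<phi> (a + r *\<^sub>R x))"
    by (rule continuous_on_compose2[of UNIV \<phi>]) (use 0 in \<open>auto intro!: continuous_intros\<close>)
  then show ?case by (simp add: continuous_on_mult_left)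
next
  case (Suc k)
  then have d: "\<And>x. \<phi> differentiable (at x)" by simp
  have "C_k k (\<lambda>x. (c * r) * partial_deriv j \<phi> (a + r *\<^sub>R x))" for j
    by (rule Suc.IH) (use Suc.prems in simp)
  then show ?case
    unfolding C_k.simps partial_deriv_affine(1)[OF d] using partial_deriv_affine(2)[OF d] by blast
qed

text \<open>
  Outside the closed support of \<open>\<phi>\<close> the function vanishes near the point, so its partial
  derivatives vanish there as well; continuity on the compact support gives the bounds.
\<close>

lemma test_function_regularity:
  fixes \<phi> :: "real ^ 'n::finite \<Rightarrow> real" and j :: 'n
  assumes "\<phi> \<in> test_functions \<Omega>"
  shows "\<And>x. \<phi> differentiable (at x)" "continuous_on UNIV \<phi>" "continuous_on UNIV (partial_deriv j \<phi>)"
    and "\<exists>a b. \<forall>x. x \<notin> cbox a b \<longrightarrow> \<phi> x = 0 \<and> partial_deriv j \<phi> x = 0"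
    and "\<exists>B. \<forall>x. \<bar>\<phi> x\<bar> \<le> B \<and> \<bar>partial_deriv j \<phi> x\<bar> \<le> B"
proof -
  have C: "C_k (Suc k) \<phi>" for k using assms unfolding test_functions_def by blast
  show d: "\<And>x. \<phi> differentiable (at x)" using C[of 0] by simp
  show c: "continuous_on UNIV \<phi>" by (rule C_k_continuous[OF C[of 0]])
  show c': "continuous_on UNIV (partial_deriv j \<phi>)" using C[of 0] by simp
  define K where "K = closure {x. \<phi> x \<noteq> 0}"
  have K: "compact K" using assms by (simp add: test_functions_def K_def)
  have z: "\<phi> x = 0" if "x \<notin> K" for x using that closure_subset[of "{x. \<phi> x \<noteq> 0}"] by (auto simp: K_def)
  have z': "partial_deriv j \<phi> x = 0" if "x \<notin> K" for x
  proof -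
    have "open (- K)" using K by (simp add: compact_imp_closed open_Compl)
    have "((\<lambda>x. 0) has_derivative (\<lambda>x. 0)) (at x)" by simp
    then have "(\<phi> has_derivative (\<lambda>x. 0)) (at x)"
      by (rule has_derivative_transform_within_open[OF _ \<open>open (- K)\<close>]) (use that z in auto)
    then show ?thesis unfolding partial_deriv_def by (subst frechet_derivative_at[symmetric]) auto
  qed
  obtain a where a: "K \<subseteq> cbox (-a) a"
    using bounded_subset_cbox_symmetric[OF compact_imp_bounded[OF K]] by blast
  then show "\<exists>a b. \<forall>x. x \<notin> cbox a b \<longrightarrow> \<phi> x = 0 \<and> partial_deriv j \<phi> x = 0"
    using z z' by blast
  have "bounded (\<phi> ` K)" "bounded (partial_deriv j \<phi> ` K)"
    using K c c' by (auto intro!: compact_imp_bounded compact_continuous_image elim: continuous_on_subset)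
  then obtain B1 B2 where "\<forall>x\<in>K. norm (\<phi> x) \<le> B1" "\<forall>x\<in>K. norm (partial_deriv j \<phi> x) \<le> B2"
    unfolding bounded_iff by auto
  then have "\<bar>\<phi> x\<bar> \<le> max 0 (max B1 B2) \<and> \<bar>partial_deriv j \<phi> x\<bar> \<le> max 0 (max B1 B2)" for x
    using z[of x] z'[of x] by (cases "x \<in> K") force+
  then show "\<exists>B. \<forall>x. \<bar>\<phi> x\<bar> \<le> B \<and> \<bar>partial_deriv j \<phi> x\<bar> \<le> B" by blast
qed

lemma integrable_indicator_cbox: "integrable lborel (\<lambda>x. B * indicator (cbox a b) x :: real)"
  using emeasure_lborel_cbox_finite[of a b] by (intro integrable_mult_right integrable_real_indicator) auto

lemma integrable_bounded_compact_support:
  fixes f :: "'a::euclidean_space \<Rightarrow> real"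
  assumes [measurable]: "f \<in> borel_measurable borel" and B: "\<And>x. \<bar>f x\<bar> \<le> B" and z: "\<And>x. x \<notin> cbox a b \<Longrightarrow> f x = 0"
  shows "integrable lborel f"
proof (rule Bochner_Integration.integrable_bound)
  show "integrable lborel (\<lambda>x. B * indicator (cbox a b) x :: real)"
    by (rule integrable_indicator_cbox)
  show "AE x in lborel. norm (f x) \<le> norm (B * indicator (cbox a b) x)"
    using B z by (intro AE_I2) (force simp: indicator_def intro: order_trans[OF B])
qed simp

text \<open>
  The integral of a test function is invariant under translations, and the derivative is the bounded
  limit of difference quotients.
\<close>

lemma integral_partial_deriv_eq_0:
  fixes \<phi> :: "real ^ 'n::finite \<Rightarrow> real" and j :: 'n
  assumes \<phi>: "\<phi> \<in> test_functions \<Omega>"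
  shows "(LINT x|lborel. partial_deriv j \<phi> x) = 0"
proof -
  note T = test_function_regularity(1,2)[OF \<phi>] test_function_regularity(3-5)[OF \<phi>, of j]
  obtain a b where z: "\<And>x. x \<notin> cbox a b \<Longrightarrow> \<phi> x = 0 \<and> partial_deriv j \<phi> x = 0" using T(4) by blast
  obtain B where B: "\<And>x. \<bar>\<phi> x\<bar> \<le> B \<and> \<bar>partial_deriv j \<phi> x\<bar> \<le> B" using T(5) by blast
  have [measurable]: "\<phi> \<in> borel_measurable borel" "partial_deriv j \<phi> \<in> borel_measurable borel"
    using T by (auto intro: borel_measurable_continuous_onI)
  define e :: "real ^ 'n" where "e = axis j 1"
  have e1: "\<bar>e \<bullet> i\<bar> \<le> 1" if "i \<in> Basis" for i
    using that Basis_le_norm[OF that, of e] by (simp add: e_def norm_axis_1)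
  define h where "h n = 1 / real (Suc n)" for n
  have h: "0 < h n" "h n \<le> 1" for n by (auto simp: h_def)
  have h0: "h \<longlonglongrightarrow> 0" unfolding h_def[abs_def] by (rule LIMSEQ_Suc[OF lim_1_over_n])
  have line: "((\<lambda>t. \<phi> (x + t *\<^sub>R e)) has_real_derivative partial_deriv j \<phi> (x + t *\<^sub>R e)) (at t)" for x t
  proof -
    have "((\<lambda>t. x + t *\<^sub>R e) has_derivative (\<lambda>s. s *\<^sub>R e)) (at t)" by (auto intro!: derivative_eq_intros)
    moreover have "(\<phi> has_derivative frechet_derivative \<phi> (at (x + t *\<^sub>R e))) (at (x + t *\<^sub>R e))"
      using T(1) frechet_derivative_works by blast
    ultimately have D: "((\<lambda>t. \<phi> (x + t *\<^sub>R e)) has_derivative (\<lambda>s. frechet_derivative \<phi> (at (x + t *\<^sub>R e)) (s *\<^sub>R e))) (at t)"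
      by (rule has_derivative_compose)
    have "linear (frechet_derivative \<phi> (at (x + t *\<^sub>R e)))" using T(1) linear_frechet_derivative by blast
    then have "(\<lambda>s. frechet_derivative \<phi> (at (x + t *\<^sub>R e)) (s *\<^sub>R e)) = (*) (partial_deriv j \<phi> (x + t *\<^sub>R e))"
      by (simp add: fun_eq_iff linear_scale partial_deriv_def e_def mult.commute)
    with D show ?thesis by (simp add: has_field_derivative_def)
  qed
  define q where "q n x = (\<phi> (x + h n *\<^sub>R e) - \<phi> x) / h n" for n x
  have q_B: "\<bar>q n x\<bar> \<le> B" for n x
  proof -
    obtain t where "\<phi> (x + h n *\<^sub>R e) - \<phi> (x + 0 *\<^sub>R e) = (h n - 0) * partial_deriv j \<phi> (x + t *\<^sub>R e)"
      using MVT2[OF h(1)[of n], of "\<lambda>t. \<phi> (x + t *\<^sub>R e)" "\<lambda>t. partial_deriv j \<phi> (x + t *\<^sub>R e)"] line by blast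
    then have "q n x = partial_deriv j \<phi> (x + t *\<^sub>R e)" using h(1)[of n] by (simp add: q_def)
    then show ?thesis using B by simp
  qed
  have q_supp: "q n x = 0" if "x \<notin> cbox (a - One) (b + One)" for n x
  proof -
    from that obtain i where i: "i \<in> Basis" "x \<bullet> i < a \<bullet> i - 1 \<or> b \<bullet> i + 1 < x \<bullet> i"
      by (auto simp: mem_box inner_simps not_le)
    have "\<bar>h n * (e \<bullet> i)\<bar> \<le> 1" using h[of n] e1[OF i(1)] by (simp add: abs_mult mult_le_one)
    then have "x \<bullet> i + h n * (e \<bullet> i) < a \<bullet> i \<or> b \<bullet> i < x \<bullet> i + h n * (e \<bullet> i)" using i(2) by linarith
    then have "x + h n *\<^sub>R e \<notin> cbox a b" using i(1) by (force simp: mem_box inner_simps)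
    moreover have "x \<notin> cbox a b" using i by (force simp: mem_box)
    ultimately show ?thesis using z by (simp add: q_def)
  qed
  have q_lim: "(\<lambda>n. q n x) \<longlonglongrightarrow> partial_deriv j \<phi> x" for x
  proof -
    have "((\<lambda>s. (\<phi> (x + (0 + s) *\<^sub>R e) - \<phi> (x + 0 *\<^sub>R e)) / s) \<longlongrightarrow> partial_deriv j \<phi> (x + 0 *\<^sub>R e)) (at 0)"
      using line[of x 0] by (simp add: DERIV_def)
    moreover have "filterlim h (at 0) sequentially"
      using h0 h(1) by (auto simp: filterlim_at less_imp_neq[symmetric] intro!: always_eventually)
    ultimately show ?thesis
      using filterlim_compose by (fastforce simp: q_def)
  qed
  have \<phi>_int: "integrable lborel \<phi>" by (rule integrable_bounded_compact_support[where B=B]) (use B z in auto)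
  have q_0: "(LINT x|lborel. q n x) = 0" for n
  proof -
    have "(LINT x|lborel. \<phi> (x + h n *\<^sub>R e)) = (LINT x|lborel. \<phi> x)"
      "integrable lborel (\<lambda>x. \<phi> (x + h n *\<^sub>R e))"
      by (subst (2) lborel_affine[of 1 "h n *\<^sub>R e"], simp, simp add: density_1 integral_distr add.commute)
         (use \<phi>_int in \<open>subst (asm) lborel_affine[of 1 "h n *\<^sub>R e"], simp, simp add: density_1 integrable_distr_eq add.commute\<close>)
    then show ?thesis using \<phi>_int by (simp add: q_def)
  qed
  have "(\<lambda>n. LINT x|lborel. q n x) \<longlonglongrightarrow> (LINT x|lborel. partial_deriv j \<phi> x)"
  proof (rule integral_dominated_convergence)
    show "integrable lborel (\<lambda>x. B * indicator (cbox (a - One) (b + One)) x :: real)"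
      by (rule integrable_indicator_cbox)
    show "AE x in lborel. norm (q n x) \<le> B * indicator (cbox (a - One) (b + One)) x" for n
      using q_B q_supp by (intro AE_I2) (auto simp: indicator_def)
  qed (use q_lim in \<open>auto simp: q_def\<close>)
  then show ?thesis using q_0 by (simp add: LIMSEQ_const_iff)
qed

section \<open>Weak gradients\<close>

definition bump_cart :: "real ^ 'n \<Rightarrow> real" where
  "bump_cart y = (\<Prod>i\<in>UNIV. bump (y $ i))"

text \<open>
  The bump is left unnormalized; its integral appears as a factor in the mollification lemmas.
\<close>

definition bump_mass :: "'n::finite itself \<Rightarrow> real" where
  "bump_mass _ = (LINT y|lebesgue_on (cube (0 :: real ^ 'n) 1). bump_cart y)"

lemma One_cart: "(One :: real ^ 'n) $ i = 1"
proof -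
  have "(One :: real ^ 'n) $ i = One \<bullet> (axis i 1 :: real ^ 'n)" by (rule cart_eq_inner_axis)
  also have "\<dots> = 1" by (simp add: axis_in_Basis_iff)
  finally show ?thesis .
qed

lemma mem_cube_cart: "y \<in> cube x r \<longleftrightarrow> (\<forall>i. x $ i < y $ i \<and> y $ i < x $ i + r)" for x y :: "real ^ 'n"
  by (simp add: cube_def mem_box_cart One_cart del: sum_component)

lemma bump_cart_bounds: "0 \<le> bump_cart y" "bump_cart y \<le> 1" "\<bar>bump_cart y\<bar> = bump_cart y"
proof -
  show "0 \<le> bump_cart y" by (auto simp: bump_cart_def bump_nonneg intro!: prod_nonneg)
  then show "\<bar>bump_cart y\<bar> = bump_cart y" by simp
  show "bump_cart y \<le> 1" by (auto simp: bump_cart_def bump_nonneg bump_le1 intro!: prod_le_1)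
qed

lemma continuous_bump: "continuous_on A bump"
  using C1_k_continuous[OF C1_k_bump] continuous_on_subset by blast

lemma borel_bump_cart [measurable]: "bump_cart \<in> borel_measurable borel"
proof -
  have "continuous_on UNIV (bump_cart :: real ^ 'n \<Rightarrow> real)"
    unfolding bump_cart_def[abs_def]
    by (intro continuous_on_prod continuous_on_compose2[OF continuous_bump[of UNIV]] continuous_intros) auto
  then show ?thesis by (rule borel_measurable_continuous_onI)
qed

lemma bump_cart_eq_0: "y \<notin> cube 0 1 \<Longrightarrow> bump_cart y = 0"
proof -
  assume "y \<notin> cube 0 1"
  then obtain i where "\<not> (0 < y $ i \<and> y $ i < 1)" by (auto simp: mem_cube_cart)
  then have "bump (y $ i) = 0" using bump_support[of "y $ i"] by (cases "bump (y $ i) = 0") auto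
  then show ?thesis by (auto simp: bump_cart_def)
qed

lemma bump_mass_pos: "0 < bump_mass TYPE('n::finite)"
proof -
  let ?Q = "cube (0 :: real ^ 'n) 1"
  interpret Q: prob_space "lebesgue_on ?Q" by (rule prob_space_cube)
  have int: "integrable (lebesgue_on ?Q) bump_cart"
    by (rule integrable_cube_bounded[where C=1]) (auto simp: bump_cart_bounds)
  have "bump_mass TYPE('n) \<noteq> 0"
  proof
    assume "bump_mass TYPE('n) = 0"
    then have "AE y in lebesgue_on ?Q. bump_cart y = 0"
      using integral_nonneg_eq_0_iff_AE[OF int] bump_cart_bounds by (auto simp: bump_mass_def)
    then have "AE y in lebesgue. y \<in> ?Q \<longrightarrow> bump_cart y = 0"
      by (simp add: AE_restrict_space_iff)
    then have AE0: "AE y in lborel. y \<in> ?Q \<longrightarrow> bump_cart y = 0"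
      by (simp add: AE_completion_iff)
    have sub: "y \<in> ?Q \<and> bump_cart y \<noteq> 0" if "y \<in> cube ((1 / 4) *\<^sub>R One) (1 / 2)" for y
    proof -
      have "0 < bump (y $ i) \<and> 0 < y $ i \<and> y $ i < 1" for i
      proof -
        have "1 / 4 < y $ i" "y $ i < 3 / 4"
          using that by (auto simp: mem_cube_cart One_cart simp del: sum_component)
        then show ?thesis using bump_pos[of "y $ i"] by linarith
      qed
      then show ?thesis by (auto simp: mem_cube_cart bump_cart_def less_imp_neq[symmetric])
    qed
    have "AE y in lborel. y \<notin> cube ((1 / 4) *\<^sub>R One :: real ^ 'n) (1 / 2)"
      using AE0 by (rule AE_mp) (use sub in \<open>intro AE_I2, blast\<close>)
    then have "emeasure lborel (cube ((1 / 4) *\<^sub>R One :: real ^ 'n) (1 / 2)) = 0"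
      by (subst (asm) AE_iff_measurable[OF _ refl]) auto
    then show False by (simp add: emeasure_cube)
  qed
  moreover have "0 \<le> bump_mass TYPE('n)"
    unfolding bump_mass_def by (intro Bochner_Integration.integral_nonneg bump_cart_bounds)
  ultimately show ?thesis by simp
qed

lemma integral_supported_in_cube:
  fixes f :: "'a::euclidean_space \<Rightarrow> real"
  assumes \<Omega>: "open \<Omega>" and f [measurable]: "f \<in> borel_measurable borel" and r: "0 < r"
    and sub: "cube x r \<subseteq> \<Omega>" and z: "\<And>y. y \<notin> cube x r \<Longrightarrow> f y = 0"
  shows "(LINT y|lebesgue_on \<Omega>. f y) = r ^ DIM('a) * (LINT y|lebesgue_on (cube 0 1). f (x + r *\<^sub>R y))"
proof -
  have [measurable]: "\<Omega> \<in> sets borel" using \<Omega> by simp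
  have "(LINT y|lebesgue_on \<Omega>. f y) = (LINT y|lborel. indicator \<Omega> y *\<^sub>R f y)"
    by (rule integral_lebesgue_on_borel) auto
  also have "(\<lambda>y. indicator \<Omega> y *\<^sub>R f y) = (\<lambda>y. indicator (cube x r) y *\<^sub>R f y)"
    using sub z by (auto simp: indicator_def fun_eq_iff)
  also have "(LINT y|lborel. indicator (cube x r) y *\<^sub>R f y) = (LINT y|lebesgue_on (cube x r). f y)"
    by (rule integral_lebesgue_on_borel(1)[symmetric]) auto
  also have "\<dots> = r ^ DIM('a) * (LINT y|lebesgue_on (cube 0 1). f (x + r *\<^sub>R y))"
    using integral_cube_rescale[OF f r, of x] by simp
  finally show ?thesis .
qed

text \<open>
  The bump is at most 1, so the error is bounded by the mean oscillation of \<open>f\<close> around the Lebesgue point.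
\<close>

lemma mollify_tendsto:
  fixes f :: "real ^ 'n \<Rightarrow> real"
  assumes f [measurable]: "f \<in> borel_measurable borel" and C: "\<And>x. \<bar>f x\<bar> \<le> C"
    and lp: "((\<lambda>r. LINT y|lebesgue_on (cube 0 1). \<bar>f (x + r *\<^sub>R y) - f x\<bar>) \<longlongrightarrow> 0) (at_right 0)"
  shows "((\<lambda>r. LINT y|lebesgue_on (cube 0 1). f (x + r *\<^sub>R y) * bump_cart y) \<longlongrightarrow> f x * bump_mass TYPE('n)) (at_right 0)"
proof -
  let ?Q = "lebesgue_on (cube (0 :: real ^ 'n) 1)"
  have i1: "integrable ?Q (\<lambda>y. f (x + r *\<^sub>R y) * bump_cart y)" for r
    by (rule integrable_cube_bounded[where C="C * 1"])
      (auto simp: abs_mult bump_cart_bounds intro!: mult_mono C order_trans[OF abs_ge_zero C] simp del: mult_1_right)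
  have i2: "integrable ?Q (\<lambda>y. f x * bump_cart y)"
    by (rule integrable_cube_bounded[where C="C * 1"])
      (auto simp: abs_mult bump_cart_bounds intro!: mult_mono C order_trans[OF abs_ge_zero C] simp del: mult_1_right)
  have i3: "integrable ?Q (\<lambda>y. \<bar>f (x + r *\<^sub>R y) - f x\<bar>)" for r
    by (rule integrable_cube_bounded[where C="C + C"])
      (simp, simp only: abs_abs, intro order_trans[OF abs_triangle_ineq4] add_mono C)
  have "\<bar>(LINT y|?Q. f (x + r *\<^sub>R y) * bump_cart y) - f x * bump_mass TYPE('n)\<bar>
      \<le> (LINT y|?Q. \<bar>f (x + r *\<^sub>R y) - f x\<bar>)" for r
  proof -
    have "(LINT y|?Q. f (x + r *\<^sub>R y) * bump_cart y) - f x * bump_mass TYPE('n)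
        = (LINT y|?Q. f (x + r *\<^sub>R y) * bump_cart y - f x * bump_cart y)"
      using i1[of r] i2 by (simp add: bump_mass_def)
    also have "\<bar>\<dots>\<bar> \<le> (LINT y|?Q. \<bar>f (x + r *\<^sub>R y) * bump_cart y - f x * bump_cart y\<bar>)"
      by (rule integral_abs_bound)
    also have "\<dots> \<le> (LINT y|?Q. \<bar>f (x + r *\<^sub>R y) - f x\<bar>)"
    proof (rule integral_mono)
      show "integrable ?Q (\<lambda>y. \<bar>f (x + r *\<^sub>R y) * bump_cart y - f x * bump_cart y\<bar>)" using i1[of r] i2 by auto
      fix y
      have "\<bar>f (x + r *\<^sub>R y) * bump_cart y - f x * bump_cart y\<bar> = \<bar>f (x + r *\<^sub>R y) - f x\<bar> * bump_cart y"
        using bump_cart_bounds(1)[of y] by (simp flip: left_diff_distrib add: abs_mult)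
      also have "\<dots> \<le> \<bar>f (x + r *\<^sub>R y) - f x\<bar>" using bump_cart_bounds[of y] by (simp add: mult_left_le)
      finally show "\<bar>f (x + r *\<^sub>R y) * bump_cart y - f x * bump_cart y\<bar> \<le> \<bar>f (x + r *\<^sub>R y) - f x\<bar>" .
    qed (rule i3)
    finally show ?thesis .
  qed
  then have "((\<lambda>r. (LINT y|?Q. f (x + r *\<^sub>R y) * bump_cart y) - f x * bump_mass TYPE('n)) \<longlongrightarrow> 0) (at_right 0)"
    by (intro Lim_null_comparison[OF always_eventually lp]) simp
  then show ?thesis by (simp add: LIM_zero_iff)
qed

lemma scaled_bump_test_function:
  assumes r: "0 < r" and sub: "cube x r \<subseteq> \<Omega>"
  shows "(\<lambda>z :: real ^ 'n. \<Prod>i\<in>UNIV. bump (- (x $ i) / r + (1 / r) * (z $ i))) \<in> test_functions \<Omega>"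
proof (rule prod_test_function[where a="\<chi> i. x $ i + r / 4" and b="\<chi> i. x $ i + 3 * r / 4"])
  show "C1_k k (\<lambda>t. bump (- (x $ i) / r + (1 / r) * t))" for i k by (rule C1_k_affine[OF C1_k_bump])
  show "(\<chi> i. x $ i + r / 4) $ i \<le> t \<and> t \<le> (\<chi> i. x $ i + 3 * r / 4) $ i"
    if "bump (- (x $ i) / r + (1 / r) * t) \<noteq> 0" for i t
    using bump_support[OF that] r by (simp add: field_simps)
  have "cbox (\<chi> i. x $ i + r / 4) (\<chi> i. x $ i + 3 * r / 4) \<subseteq> cube x r"
  proof
    fix y assume "y \<in> cbox (\<chi> i. x $ i + r / 4) (\<chi> i. x $ i + 3 * r / 4)"
    then have "x $ i + r / 4 \<le> y $ i" "y $ i \<le> x $ i + 3 * r / 4" for i by (simp_all add: mem_box_cart)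
    then have "x $ i < y $ i \<and> y $ i < x $ i + r" for i
    proof -
      have "x $ i + r / 4 \<le> y $ i" "y $ i \<le> x $ i + 3 * r / 4" by fact+
      then show ?thesis using r by linarith
    qed
    then show "y \<in> cube x r" by (simp add: mem_cube_cart)
  qed
  then show "cbox (\<chi> i. x $ i + r / 4) (\<chi> i. x $ i + 3 * r / 4) \<subseteq> \<Omega>" using sub by blast
qed

lemma scaled_bump_eq:
  fixes x z :: "real ^ 'n"
  shows "(\<Prod>i\<in>UNIV. bump (- (x $ i) / r + (1 / r) * (z $ i))) = bump_cart ((1 / r) *\<^sub>R (z - x))"
  by (simp add: bump_cart_def diff_divide_distrib)

lemma integral_scaled_bump:
  fixes f :: "real ^ 'n \<Rightarrow> real"
  assumes \<Omega>: "open \<Omega>" and f [measurable]: "f \<in> borel_measurable borel" and r: "0 < r" and sub: "cube x r \<subseteq> \<Omega>"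
  shows "(LINT z|lebesgue_on \<Omega>. f z * bump_cart ((1 / r) *\<^sub>R (z - x)))
    = r ^ CARD('n) * (LINT y|lebesgue_on (cube 0 1). f (x + r *\<^sub>R y) * bump_cart y)"
proof -
  have "f z * bump_cart ((1 / r) *\<^sub>R (z - x)) = 0" if "z \<notin> cube x r" for z
  proof -
    have "x + r *\<^sub>R ((1 / r) *\<^sub>R (z - x)) = z" using r by simp
    with mem_cube_affine[OF r, of x "(1 / r) *\<^sub>R (z - x)"] that have "(1 / r) *\<^sub>R (z - x) \<notin> cube 0 1" by simp
    then show ?thesis using bump_cart_eq_0 mult_eq_0_iff by blast
  qed
  then show ?thesis
    by (subst integral_supported_in_cube[OF \<Omega> _ r sub]) (use r in simp_all)
qed

lemma eventually_cube_subset: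
  assumes "open \<Omega>" "x \<in> (\<Omega> :: (real ^ 'n) set)"
  shows "\<forall>\<^sub>F r in at_right 0. cube x r \<subseteq> \<Omega>"
proof -
  obtain e where e: "0 < e" "ball x e \<subseteq> \<Omega>" using assms open_contains_ball by blast
  have "cube x r \<subseteq> \<Omega>" if r: "0 < r" "r < e / CARD('n)" for r
  proof
    fix y assume y: "y \<in> cube x r"
    have "norm (y - x) \<le> (\<Sum>i\<in>UNIV. \<bar>(y - x) $ i\<bar>)" by (rule norm_le_l1_cart)
    also have "\<dots> \<le> (\<Sum>i\<in>(UNIV :: 'n set). r)"
    proof (rule sum_mono)
      fix i
      have "x $ i < y $ i" "y $ i < x $ i + r" using y by (auto simp: mem_cube_cart)
      then show "\<bar>(y - x) $ i\<bar> \<le> r" by simp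
    qed
    also have "\<dots> < e" using r by (simp add: field_simps)
    finally show "y \<in> \<Omega>" using e by (auto simp: dist_norm norm_minus_commute)
  qed
  then show ?thesis unfolding eventually_at_right_field
    using e by (intro exI[of _ "e / CARD('n)"]) simp
qed

text \<open>
  Testing with bumps that shrink to a Lebesgue point recovers the value at that point.
\<close>

lemma fundamental_lemma_variations:
  fixes f :: "real ^ 'n \<Rightarrow> real"
  assumes \<Omega>: "open \<Omega>" and f: "f \<in> borel_measurable borel" and C: "\<And>x. \<bar>f x\<bar> \<le> C"
    and test: "\<And>\<phi>. \<phi> \<in> test_functions \<Omega> \<Longrightarrow> (LINT x|lebesgue_on \<Omega>. f x * \<phi> x) = 0"
  shows "AE x in lborel. x \<in> \<Omega> \<longrightarrow> f x = 0"
  using lebesgue_point_cube[OF f C]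
proof eventually_elim
  case (elim x)
  show ?case
  proof
    assume "x \<in> \<Omega>"
    have "\<forall>\<^sub>F r in at_right 0. (LINT y|lebesgue_on (cube 0 1). f (x + r *\<^sub>R y) * bump_cart y) = 0"
      using eventually_cube_subset[OF \<Omega> \<open>x \<in> \<Omega>\<close>] eventually_at_right_less[of 0]
    proof eventually_elim
      case (elim r)
      from integral_scaled_bump[OF \<Omega> f elim(2,1)]
        test[OF scaled_bump_test_function[OF elim(2,1)], unfolded scaled_bump_eq]
      have "r ^ CARD('n) * (LINT y|lebesgue_on (cube 0 1). f (x + r *\<^sub>R y) * bump_cart y) = 0" by simp
      with elim(2) show ?case by simp
    qed
    then have "((\<lambda>r. LINT y|lebesgue_on (cube 0 1). f (x + r *\<^sub>R y) * bump_cart y) \<longlongrightarrow> 0) (at_right 0)"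
      by (rule tendsto_eventually)
    from tendsto_unique[OF _ this mollify_tendsto[OF f C elim]] bump_mass_pos[where 'n='n]
    show "f x = 0" by simp
  qed
qed

lemma content_slab:
  fixes x :: "real ^ 'n"
  assumes "0 < r" "0 \<le> h"
  shows "measure lborel (cbox x (\<chi> i. x $ i + (if i = j then h + r else r))) = (h + r) * r ^ (CARD('n) - 1)"
proof -
  have "cbox x (\<chi> i. x $ i + (if i = j then h + r else r)) \<noteq> {}"
    using assms by (simp add: interval_ne_empty_cart)
  from content_cbox_cart[OF this]
  have "measure lborel (cbox x (\<chi> i. x $ i + (if i = j then h + r else r)))
      = (\<Prod>i\<in>UNIV. if i = j then h + r else r)"
    by simp
  also have "\<dots> = (h + r) * (\<Prod>i\<in>UNIV - {j}. if i = j then h + r else r)"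
    by (subst prod.remove[of UNIV j]) simp_all
  also have "(\<Prod>i\<in>UNIV - {j}. if i = j then h + r else r) = (\<Prod>i\<in>UNIV - {j}. r)"
    by (rule prod.cong) auto
  finally show ?thesis by simp
qed

text \<open>
  The difference of two bumps translated in one coordinate direction is the derivative of a
  test function, namely of a product in which one factor is an antiderivative. Hence the averages of
  \<open>u\<close> against the two bumps differ by an integral of the weak derivative over a box.
\<close>

lemma mollified_difference_bound:
  fixes u g :: "real ^ 'n \<Rightarrow> real"
  assumes \<Omega>: "open \<Omega>" and u [measurable]: "u \<in> borel_measurable borel" and uC: "\<And>x. \<bar>u x\<bar> \<le> C"
    and g [measurable]: "g \<in> borel_measurable borel" and M: "\<And>x. \<bar>g x\<bar> \<le> M"
    and weak: "\<And>\<phi>. \<phi> \<in> test_functions \<Omega> \<Longrightarrow>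
      (LINT x|lebesgue_on \<Omega>. u x * partial_deriv j \<phi> x) = - (LINT x|lebesgue_on \<Omega>. g x * \<phi> x)"
    and r: "0 < r" and h: "0 \<le> h"
    and sub: "cbox x (\<chi> i. x $ i + (if i = j then h + r else r)) \<subseteq> \<Omega>"
  shows "\<bar>(LINT y|lebesgue_on (cube 0 1). u (x + r *\<^sub>R y) * bump_cart y)
     - (LINT y|lebesgue_on (cube 0 1). u (x + h *\<^sub>R axis j 1 + r *\<^sub>R y) * bump_cart y)\<bar> \<le> M * (h + r)"
proof -
  let ?Q = "lebesgue_on (cube (0 :: real ^ 'n) 1)"
  let ?B = "cbox x (\<chi> i. x $ i + (if i = j then h + r else r))"
  define x' where "x' = x + h *\<^sub>R axis j 1"
  obtain \<Gamma> where \<Gamma>: "\<And>t. (\<Gamma> has_real_derivative bump t) (at t)" "\<And>t. t \<le> 1 / 4 \<Longrightarrow> \<Gamma> t = 0"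
    "\<And>t. 3 / 4 \<le> t \<Longrightarrow> \<Gamma> t = \<Gamma> 1" "\<And>s t. s \<le> t \<Longrightarrow> \<Gamma> s \<le> \<Gamma> t" "\<Gamma> 1 \<le> 1"
    using bump_antiderivative by blast
  have \<Gamma>C: "C1_k k \<Gamma>" for k
  proof (cases k)
    case 0 then show ?thesis using DERIV_continuous_on[of UNIV \<Gamma> bump] \<Gamma>(1) by simp
  next
    case (Suc l) then show ?thesis unfolding Suc C1_k.simps using \<Gamma>(1) C1_k_bump by blast
  qed
  have \<Gamma>01: "0 \<le> \<Gamma> t" "\<Gamma> t \<le> 1" for t
  proof -
    show "0 \<le> \<Gamma> t" using \<Gamma>(2)[of "min t 0"] \<Gamma>(4)[of "min t 0" t] by simp
    show "\<Gamma> t \<le> 1" using \<Gamma>(3)[of "max t 1"] \<Gamma>(4)[of t "max t 1"] \<Gamma>(5) by simp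
  qed
  \<comment> \<open>the factors of the test function; in the direction \<open>j\<close> the two antiderivatives cancel beyond \<open>x $ j + h + r\<close>\<close>
  define H where "H i t = (if i = j then \<Gamma> (- (x $ j) / r + (1 / r) * t) - \<Gamma> (- (x $ j + h) / r + (1 / r) * t)
    else bump (- (x $ i) / r + (1 / r) * t))" for i t
  define H' where "H' t = (1 / r) * (bump (- (x $ j) / r + (1 / r) * t) - bump (- (x $ j + h) / r + (1 / r) * t))" for t
  define \<Phi> where "\<Phi> z = (\<Prod>i\<in>UNIV. H i (z $ i))" for z
  have HC: "C1_k k (H i)" for i k
  proof (cases "i = j")
    case True
    have "C1_k k (\<lambda>t. \<Gamma> (- (x $ j) / r + (1 / r) * t) + (- 1) * \<Gamma> (- (x $ j + h) / r + (1 / r) * t))"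
      by (rule C1_k_add[OF C1_k_affine[OF \<Gamma>C] C1_k_mult[OF C1_k_const C1_k_affine[OF \<Gamma>C]]])
    then show ?thesis using True by (simp add: H_def[abs_def])
  next
    case False
    then show ?thesis using C1_k_affine[OF C1_k_bump, of k "- (x $ i) / r" "1 / r"] by (simp add: H_def[abs_def])
  qed
  have chain: "((\<lambda>t. \<Gamma> (a + (1 / r) * t)) has_real_derivative bump (a + (1 / r) * t) * (1 / r)) (at t)" for a t
    by (rule DERIV_chain2[OF \<Gamma>(1)]) (use r in \<open>auto intro!: derivative_eq_intros\<close>)
  have Hj: "(H j has_real_derivative H' t) (at t)" for t
    unfolding H_def[abs_def] H'_def using DERIV_diff[OF chain[of "- (x $ j) / r" t] chain[of "- (x $ j + h) / r" t]]
    by (simp add: right_diff_distrib mult.commute)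
  have "\<exists>D. \<forall>t. (H i has_real_derivative D t) (at t)" for i using HC[of 1 i] by auto
  then obtain D where D: "\<And>i t. (H i has_real_derivative D i t) (at t)" by metis
  have HD: "(H i has_real_derivative (if i = j then H' else D i) t) (at t)" for i t
    by (cases "i = j") (simp_all add: Hj D)
  have conv: "- a / r + (1 / r) * t = (t - a) / r" for a t by (simp add: diff_divide_distrib)
  have Hsupp: "x $ i \<le> t \<and> t \<le> x $ i + (if i = j then h + r else r)" if nz: "H i t \<noteq> 0" for i t
  proof (cases "i = j")
    case True
    have "\<not> t < x $ j"
    proof
      assume t: "t < x $ j"
      have "- (x $ j) / r + (1 / r) * t \<le> 1 / 4" "- (x $ j + h) / r + (1 / r) * t \<le> 1 / 4"
        unfolding conv using r h t by (simp_all add: pos_le_divide_eq pos_divide_le_eq)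
      then have "H j t = 0" unfolding H_def by (simp only: simp_thms \<Gamma>(2) if_True diff_self refl)
      then show False using nz True by simp
    qed
    moreover have "\<not> x $ j + (h + r) < t"
    proof
      assume t: "x $ j + (h + r) < t"
      have "3 / 4 \<le> - (x $ j) / r + (1 / r) * t" "3 / 4 \<le> - (x $ j + h) / r + (1 / r) * t"
        unfolding conv using r h t by (simp_all add: pos_le_divide_eq pos_divide_le_eq)
      then have "H j t = 0" unfolding H_def by (simp only: simp_thms \<Gamma>(3)[of "- (x $ j) / r + (1 / r) * t"] \<Gamma>(3)[of "- (x $ j + h) / r + (1 / r) * t"] if_True diff_self refl)
      then show False using nz True by simp
    qed
    ultimately show ?thesis using True by auto
  next
    case False
    then have "bump (- (x $ i) / r + (1 / r) * t) \<noteq> 0" using nz unfolding H_def by (simp only: if_False simp_thms)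
    then have "1 / 4 < - (x $ i) / r + (1 / r) * t \<and> - (x $ i) / r + (1 / r) * t < 3 / 4" by (rule bump_support)
    then have "r / 4 < t - x $ i" "t - x $ i < 3 * r / 4"
      unfolding conv using r by (simp_all add: pos_less_divide_eq pos_divide_less_eq)
    then show ?thesis using False r by simp
  qed
  have \<Phi>: "\<Phi> \<in> test_functions \<Omega>"
    unfolding \<Phi>_def[abs_def] by (rule prod_test_function[OF HC _ sub]) (use Hsupp in auto)
  have part: "partial_deriv j \<Phi> z = (1 / r) * (bump_cart ((1 / r) *\<^sub>R (z - x)) - bump_cart ((1 / r) *\<^sub>R (z - x')))" for z
  proof -
    have split: "bump_cart w = bump (w $ j) * (\<Prod>i\<in>UNIV - {j}. bump (w $ i))" for w :: "real ^ 'n"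
      unfolding bump_cart_def by (rule prod.remove) auto
    have "partial_deriv j \<Phi> z = (\<Prod>i\<in>UNIV. (if i = j then (if i = j then H' else D i) else H i) (z $ i))"
      unfolding \<Phi>_def[abs_def] partial_deriv_prod[OF HD] ..
    also have "\<dots> = H' (z $ j) * (\<Prod>i\<in>UNIV - {j}. H i (z $ i))"
    proof (subst prod.remove[of UNIV j])
      have "(\<Prod>i\<in>UNIV - {j}. (if i = j then (if i = j then H' else D i) else H i) (z $ i)) = (\<Prod>i\<in>UNIV - {j}. H i (z $ i))"
        by (rule prod.cong) auto
      then show "(if j = j then (if j = j then H' else D j) else H j) (z $ j) *
          (\<Prod>i\<in>UNIV - {j}. (if i = j then (if i = j then H' else D i) else H i) (z $ i))
        = H' (z $ j) * (\<Prod>i\<in>UNIV - {j}. H i (z $ i))" by simp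
    qed simp_all
    also have "(\<Prod>i\<in>UNIV - {j}. H i (z $ i)) = (\<Prod>i\<in>UNIV - {j}. bump (((1 / r) *\<^sub>R (z - x)) $ i))"
      by (intro prod.cong) (auto simp: H_def diff_divide_distrib)
    finally have 1: "partial_deriv j \<Phi> z = H' (z $ j) * (\<Prod>i\<in>UNIV - {j}. bump (((1 / r) *\<^sub>R (z - x)) $ i))" .
    have 2: "(\<Prod>i\<in>UNIV - {j}. bump (((1 / r) *\<^sub>R (z - x')) $ i)) = (\<Prod>i\<in>UNIV - {j}. bump (((1 / r) *\<^sub>R (z - x)) $ i))"
      by (intro prod.cong) (auto simp: x'_def axis_def)
    have 3: "H' (z $ j) = (1 / r) * (bump (((1 / r) *\<^sub>R (z - x)) $ j) - bump (((1 / r) *\<^sub>R (z - x')) $ j))"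
      unfolding H'_def conv by (simp add: x'_def)
    show ?thesis unfolding 1 3 split 2 by (simp add: algebra_simps)
  qed
  have sub1: "cube x r \<subseteq> \<Omega>"
  proof -
    have "cube x r \<subseteq> ?B"
    proof
      fix y assume y: "y \<in> cube x r"
      show "y \<in> ?B" unfolding mem_box_cart
      proof
        fix i
        have "x $ i < y $ i" "y $ i < x $ i + r" using y by (auto simp: mem_cube_cart)
        then show "x $ i \<le> y $ i \<and> y $ i \<le> (\<chi> i. x $ i + (if i = j then h + r else r)) $ i"
          using h by auto
      qed
    qed
    then show ?thesis using sub by blast
  qed
  have sub2: "cube x' r \<subseteq> \<Omega>"
  proof -
    have "cube x' r \<subseteq> ?B"
    proof
      fix y assume y: "y \<in> cube x' r"
      show "y \<in> ?B" unfolding mem_box_cart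
      proof
        fix i
        have "x' $ i < y $ i" "y $ i < x' $ i + r" using y by (auto simp: mem_cube_cart)
        then show "x $ i \<le> y $ i \<and> y $ i \<le> (\<chi> i. x $ i + (if i = j then h + r else r)) $ i"
          using h by (auto simp: x'_def axis_def)
      qed
    qed
    then show ?thesis using sub by blast
  qed
  have [measurable]: "\<Omega> \<in> sets borel" using \<Omega> by simp
  have meas\<Phi> [measurable]: "\<Phi> \<in> borel_measurable borel"
    using test_function_regularity(2)[OF \<Phi>] by (rule borel_measurable_continuous_onI)
  have \<Phi>01: "0 \<le> \<Phi> z \<and> \<Phi> z \<le> 1" for z
  proof -
    have "0 \<le> H i t \<and> H i t \<le> 1" for i t
    proof (cases "i = j")
      case True
      have "\<Gamma> (- (x $ j + h) / r + (1 / r) * t) \<le> \<Gamma> (- (x $ j) / r + (1 / r) * t)"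
        using r h unfolding conv by (intro \<Gamma>(4) divide_right_mono) auto
      then show ?thesis using True \<Gamma>01[of "- (x $ j) / r + (1 / r) * t"] \<Gamma>01[of "- (x $ j + h) / r + (1 / r) * t"]
        by (simp add: H_def)
    qed (simp add: H_def bump_nonneg bump_le1)
    then show ?thesis by (auto simp: \<Phi>_def intro!: prod_nonneg prod_le_1)
  qed
  have \<Phi>0: "\<Phi> z = 0" if "z \<notin> ?B" for z
  proof -
    from that obtain i where "\<not> (x $ i \<le> z $ i \<and> z $ i \<le> x $ i + (if i = j then h + r else r))"
      by (auto simp: mem_box_cart)
    then have "H i (z $ i) = 0" using Hsupp[of i "z $ i"] by blast
    then show ?thesis by (auto simp: \<Phi>_def)
  qed
  have M0: "0 \<le> M" using M[of 0] abs_ge_zero order_trans by blast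
  let ?I = "\<lambda>x. LINT y|?Q. u (x + r *\<^sub>R y) * bump_cart y"
  have intu: "integrable (lebesgue_on \<Omega>) (\<lambda>z. u z * bump_cart ((1 / r) *\<^sub>R (z - w)))" for w
  proof (subst integral_lebesgue_on_borel)
    show "integrable lborel (\<lambda>z. indicator \<Omega> z *\<^sub>R (u z * bump_cart ((1 / r) *\<^sub>R (z - w))))"
    proof (rule integrable_bounded_compact_support[where B=C and a=w and b="w + r *\<^sub>R One"])
      show "indicator \<Omega> z *\<^sub>R (u z * bump_cart ((1 / r) *\<^sub>R (z - w))) = 0" if "z \<notin> cbox w (w + r *\<^sub>R One)" for z
      proof -
        have "w + r *\<^sub>R ((1 / r) *\<^sub>R (z - w)) \<notin> cube w r"
          using that r box_subset_cbox by (auto simp: cube_def)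
        then show ?thesis
          using mem_cube_affine[OF r, of w "(1 / r) *\<^sub>R (z - w)"] bump_cart_eq_0[of "(1 / r) *\<^sub>R (z - w)"] by simp
      qed
      show "\<bar>indicator \<Omega> z *\<^sub>R (u z * bump_cart ((1 / r) *\<^sub>R (z - w)))\<bar> \<le> C" for z
        using uC[of z] bump_cart_bounds[of "(1 / r) *\<^sub>R (z - w)"] mult_left_le[of "bump_cart ((1 / r) *\<^sub>R (z - w))" "\<bar>u z\<bar>"]
        by (auto simp: indicator_def abs_mult)
    qed simp
  qed simp_all
  have "u z * partial_deriv j \<Phi> z
      = (1 / r) * (u z * bump_cart ((1 / r) *\<^sub>R (z - x)) - u z * bump_cart ((1 / r) *\<^sub>R (z - x')))" for z
    unfolding part by (simp only: right_diff_distrib mult.left_commute)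
  then have "(LINT z|lebesgue_on \<Omega>. u z * partial_deriv j \<Phi> z)
      = (LINT z|lebesgue_on \<Omega>. (1 / r) * (u z * bump_cart ((1 / r) *\<^sub>R (z - x)) - u z * bump_cart ((1 / r) *\<^sub>R (z - x'))))"
    by (simp only:)
  also have "\<dots> = (1 / r) * ((LINT z|lebesgue_on \<Omega>. u z * bump_cart ((1 / r) *\<^sub>R (z - x)))
      - (LINT z|lebesgue_on \<Omega>. u z * bump_cart ((1 / r) *\<^sub>R (z - x'))))"
    by (subst integral_mult_right_zero) (simp only: Bochner_Integration.integral_diff[OF intu intu])
  also have "\<dots> = (1 / r) * (r ^ CARD('n) * ?I x - r ^ CARD('n) * ?I x')"
    by (simp only: integral_scaled_bump[OF \<Omega> u r sub1] integral_scaled_bump[OF \<Omega> u r sub2])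
  also have "\<dots> = r ^ (CARD('n) - 1) * (?I x - ?I x')"
  proof -
    have "r ^ CARD('n) = r ^ (CARD('n) - 1) * r" by (simp only: power_minus_mult zero_less_card_finite)
    moreover have "(1 / r) * (p * r * A - p * r * B) = p * (A - B)" for p A B :: real using r by (simp add: field_simps)
    ultimately show ?thesis by (simp only:)
  qed
  finally have lhs: "(LINT z|lebesgue_on \<Omega>. u z * partial_deriv j \<Phi> z) = r ^ (CARD('n) - 1) * (?I x - ?I x')" .
  have "\<bar>LINT z|lebesgue_on \<Omega>. g z * \<Phi> z\<bar> = \<bar>LINT z|lborel. indicator \<Omega> z *\<^sub>R (g z * \<Phi> z)\<bar>"
    by (subst integral_lebesgue_on_borel) auto
  also have "\<dots> \<le> (LINT z|lborel. \<bar>indicator \<Omega> z *\<^sub>R (g z * \<Phi> z)\<bar>)" by (rule integral_abs_bound)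
  also have "\<dots> \<le> (LINT z|lborel. M * indicator ?B z)"
  proof (rule integral_mono_AE[OF _ integrable_indicator_cbox])
    have le: "\<bar>indicator \<Omega> z *\<^sub>R (g z * \<Phi> z)\<bar> \<le> M * indicator ?B z" for z
      using M[of z] \<Phi>01[of z] \<Phi>0[of z] M0 mult_mono[of "\<bar>g z\<bar>" M "\<Phi> z" 1]
      by (auto simp: indicator_def abs_mult)
    then show "AE z in lborel. \<bar>indicator \<Omega> z *\<^sub>R (g z * \<Phi> z)\<bar> \<le> M * indicator ?B z" by simp
    show "integrable lborel (\<lambda>z. \<bar>indicator \<Omega> z *\<^sub>R (g z * \<Phi> z)\<bar>)"
      by (rule Bochner_Integration.integrable_bound[OF integrable_indicator_cbox[of M x "\<chi> i. x $ i + (if i = j then h + r else r)"]])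
        (use le M0 in \<open>auto simp: abs_mult\<close>)
  qed
  also have "\<dots> = M * ((h + r) * r ^ (CARD('n) - 1))"
    using content_slab[OF r h, of x j] by simp
  finally have rhs: "\<bar>LINT z|lebesgue_on \<Omega>. g z * \<Phi> z\<bar> \<le> M * ((h + r) * r ^ (CARD('n) - 1))" .
  have "r ^ (CARD('n) - 1) * \<bar>?I x - ?I x'\<bar> = \<bar>LINT z|lebesgue_on \<Omega>. u z * partial_deriv j \<Phi> z\<bar>"
    using r by (simp add: lhs abs_mult)
  also have "\<dots> \<le> r ^ (CARD('n) - 1) * (M * (h + r))"
    unfolding weak[OF \<Phi>] using rhs by (simp add: mult_ac)
  finally have "\<bar>?I x - ?I x'\<bar> \<le> M * (h + r)" using r by simp
  then show ?thesis by (simp add: x'_def)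
qed

lemma borel_measurable_vec_nth_comp:
  fixes f :: "'a \<Rightarrow> 'b::euclidean_space ^ 'n"
  assumes "f \<in> borel_measurable M" shows "(\<lambda>x. f x $ i) \<in> borel_measurable M"
  by (rule measurable_compose[OF assms]) (intro borel_measurable_continuous_onI continuous_intros)

text \<open>
  The coordinates in \<open>S\<close> are changed one after the other. All intermediate points
  remain in the box, so every step costs at most \<open>M * R\<close>.
\<close>

lemma mollified_coordinate_path:
  fixes u :: "real ^ 'n \<Rightarrow> real" and g :: "'n \<Rightarrow> real ^ 'n \<Rightarrow> real" and C M R r :: real
  assumes \<Omega>: "open \<Omega>" and u: "u \<in> borel_measurable borel" and uC: "\<And>x. \<bar>u x\<bar> \<le> C"
    and g: "\<And>j. g j \<in> borel_measurable borel" and M: "\<And>j x. \<bar>g j x\<bar> \<le> M"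
    and weak: "\<And>\<phi> j. \<phi> \<in> test_functions \<Omega> \<Longrightarrow>
      (LINT x|lebesgue_on \<Omega>. u x * partial_deriv j \<phi> x) = - (LINT x|lebesgue_on \<Omega>. g j x * \<phi> x)"
    and r: "0 < r" and sub: "cube a R \<subseteq> \<Omega>"
    and "finite S"
    and "\<And>i. a $ i < x $ i \<and> x $ i < a $ i + R - r" "\<And>i. a $ i < x' $ i \<and> x' $ i < a $ i + R - r"
    and "\<And>i. i \<notin> S \<Longrightarrow> x $ i = x' $ i"
  shows "\<bar>(LINT y|lebesgue_on (cube 0 1). u (x + r *\<^sub>R y) * bump_cart y)
      - (LINT y|lebesgue_on (cube 0 1). u (x' + r *\<^sub>R y) * bump_cart y)\<bar> \<le> card S * (M * R)"
proof -
  define I where "I x = (LINT y|lebesgue_on (cube 0 1). u (x + r *\<^sub>R y) * bump_cart y)" for x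
  have "\<bar>I x - I x'\<bar> \<le> card S * (M * R)"
    using assms(9-)
  proof (induction S arbitrary: x)
    case empty
    then have "x = x'" by (simp add: vec_eq_iff)
    then show ?case by simp
  next
    case (insert j S)
    have M0: "0 \<le> M" using M[of j 0] abs_ge_zero order_trans by blast
    have step: "\<bar>I w - I (w + h *\<^sub>R axis j 1)\<bar> \<le> M * R"
      if w: "\<And>i. a $ i < w $ i \<and> w $ i < a $ i + R - r" and h: "0 \<le> h" "w $ j + h < a $ j + R - r" for w h
    proof -
      have "cbox w (\<chi> i. w $ i + (if i = j then h + r else r)) \<subseteq> cube a R"
      proof
        fix y assume y: "y \<in> cbox w (\<chi> i. w $ i + (if i = j then h + r else r))"
        have "a $ i < y $ i \<and> y $ i < a $ i + R" for i
        proof -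
          have "w $ i \<le> y $ i" "y $ i \<le> w $ i + (if i = j then h + r else r)" using y by (simp_all add: mem_box_cart)
          then show ?thesis using w[of i] h r by (cases "i = j") auto
        qed
        then show "y \<in> cube a R" by (simp add: mem_cube_cart)
      qed
      then have "\<bar>I w - I (w + h *\<^sub>R axis j 1)\<bar> \<le> M * (h + r)"
        unfolding I_def using sub by (intro mollified_difference_bound[OF \<Omega> u uC g M weak r h(1)]) auto
      also have "\<dots> \<le> M * R" using w[of j] h M0 by (intro mult_left_mono) auto
      finally show ?thesis .
    qed
    define w where "w = x + (x' $ j - x $ j) *\<^sub>R axis j 1"
    have wj: "w $ j = x' $ j" and wi: "\<And>i. i \<noteq> j \<Longrightarrow> w $ i = x $ i" by (auto simp: w_def axis_def)
    have wbox: "a $ i < w $ i \<and> w $ i < a $ i + R - r" for i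
      using wj wi[of i] insert.prems(1)[of i] insert.prems(2)[of i] by (cases "i = j") auto
    have "\<bar>I w - I x'\<bar> \<le> card S * (M * R)"
    proof (rule insert.IH)
      show "w $ i = x' $ i" if "i \<notin> S" for i
        using wj wi[of i] insert.prems(3)[of i] that by (cases "i = j") auto
    qed (use wbox insert.prems(2) in auto)
    moreover have "\<bar>I x - I w\<bar> \<le> M * R"
    proof (cases "x $ j \<le> x' $ j")
      case True
      then show ?thesis
        unfolding w_def using insert.prems(2)[of j] by (intro step insert.prems(1)) auto
    next
      case False
      \<comment> \<open>the step has a nonnegative length, so it is taken in the opposite direction\<close>
      have "x = w + (x $ j - x' $ j) *\<^sub>R axis j 1" by (simp add: w_def algebra_simps)
      moreover have "\<bar>I w - I (w + (x $ j - x' $ j) *\<^sub>R axis j 1)\<bar> \<le> M * R"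
        using False insert.prems(1)[of j] wj by (intro step wbox) auto
      ultimately show ?thesis by (simp add: abs_minus_commute)
    qed
    ultimately have "\<bar>I x - I x'\<bar> \<le> M * R + card S * (M * R)" by linarith
    also have "\<dots> = card (insert j S) * (M * R)" using insert.hyps by (simp add: algebra_simps)
    finally show ?case .
  qed
  then show ?thesis by (simp add: I_def)
qed

text \<open>
  At Lebesgue points the mollified values converge to the values of \<open>u\<close> times the mass of the bump, and
  the bound for their differences does not depend on \<open>r\<close>. The estimate replaces the Lipschitz
  continuity of functions in \<open>W\<^sup>1\<^sup>,\<^sup>\<infinity>\<close> on a cube.
\<close>

lemma weak_gradient_oscillation_bound:
  fixes u :: "real ^ 'n \<Rightarrow> real" and g :: "'n \<Rightarrow> real ^ 'n \<Rightarrow> real" and C M R r :: real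
  assumes \<Omega>: "open \<Omega>" and u: "u \<in> borel_measurable borel" and uC: "\<And>x. \<bar>u x\<bar> \<le> C"
    and g: "\<And>j. g j \<in> borel_measurable borel" and M: "\<And>j x. \<bar>g j x\<bar> \<le> M"
    and weak: "\<And>\<phi> j. \<phi> \<in> test_functions \<Omega> \<Longrightarrow>
      (LINT x|lebesgue_on \<Omega>. u x * partial_deriv j \<phi> x) = - (LINT x|lebesgue_on \<Omega>. g j x * \<phi> x)"
    and sub: "cube a R \<subseteq> \<Omega>"
  shows "\<exists>c. AE y in lborel. y \<in> cube a R \<longrightarrow> \<bar>u y - c\<bar> \<le> CARD('n) * (M * R) / bump_mass TYPE('n)"
proof -
  define L where "L = {x. ((\<lambda>r. LINT y|lebesgue_on (cube 0 1). \<bar>u (x + r *\<^sub>R y) - u x\<bar>) \<longlongrightarrow> 0) (at_right 0)}"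
  have AEL: "AE x in lborel. x \<in> L" unfolding L_def using lebesgue_point_cube[OF u uC] by simp
  have key: "\<bar>u x - u x'\<bar> \<le> CARD('n) * (M * R) / bump_mass TYPE('n)"
    if x: "x \<in> L" "x \<in> cube a R" and x': "x' \<in> L" "x' \<in> cube a R" for x x'
  proof -
    let ?I = "\<lambda>r x. LINT y|lebesgue_on (cube 0 1). u (x + r *\<^sub>R y) * bump_cart y"
    have ev: "\<forall>\<^sub>F r in at_right 0. w $ i < a $ i + R - r" if "w \<in> cube a R" for w i
    proof -
      have "0 < a $ i + R - w $ i" using that by (simp add: mem_cube_cart)
      then show ?thesis unfolding eventually_at_right_field by (intro exI[of _ "a $ i + R - w $ i"]) auto
    qed
    have "\<forall>\<^sub>F r in at_right 0. \<forall>i. x $ i < a $ i + R - r" "\<forall>\<^sub>F r in at_right 0. \<forall>i. x' $ i < a $ i + R - r"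
      using ev[OF x(2)] ev[OF x'(2)] by (simp_all add: eventually_all_finite)
    then have "\<forall>\<^sub>F r in at_right 0. \<bar>?I r x - ?I r x'\<bar> \<le> CARD('n) * (M * R)"
      using eventually_at_right_less[of 0]
    proof eventually_elim
      case (elim r)
      show ?case
        by (rule mollified_coordinate_path[OF \<Omega> u uC g M weak elim(3) sub])
          (use elim x x' in \<open>auto simp: mem_cube_cart\<close>)
    qed
    moreover have "((\<lambda>r. \<bar>?I r x - ?I r x'\<bar>) \<longlongrightarrow> \<bar>u x * bump_mass TYPE('n) - u x' * bump_mass TYPE('n)\<bar>) (at_right 0)"
      using x(1) x'(1) by (intro tendsto_intros mollify_tendsto[OF u uC]) (auto simp: L_def)
    ultimately have "\<bar>u x * bump_mass TYPE('n) - u x' * bump_mass TYPE('n)\<bar> \<le> CARD('n) * (M * R)"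
      by (intro tendsto_upperbound[of _ _ "at_right (0::real)"]) auto
    then have "\<bar>u x - u x'\<bar> * bump_mass TYPE('n) \<le> CARD('n) * (M * R)"
      using bump_mass_pos[where 'n='n] by (simp flip: left_diff_distrib add: abs_mult)
    then show ?thesis using bump_mass_pos[where 'n='n] by (simp add: pos_le_divide_eq)
  qed
  show ?thesis
  proof (cases "\<exists>x0. x0 \<in> L \<and> x0 \<in> cube a R")
    case True
    then obtain x0 where x0: "x0 \<in> L" "x0 \<in> cube a R" by blast
    show ?thesis
      by (rule exI[of _ "u x0"]) (rule AE_mp[OF AEL], intro AE_I2 impI key x0)
  next
    case False
    show ?thesis by (rule exI[of _ 0]) (rule AE_mp[OF AEL], use False in \<open>intro AE_I2, blast\<close>)
  qed
qed

text \<open>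
  The representative is Borel on the whole space, vanishes outside \<open>U\<close> and is bounded everywhere,
  so that it can be composed with affine maps and sampled at every point.
\<close>

lemma Linf_borel_representative:
  fixes f :: "'a::euclidean_space \<Rightarrow> 'b::euclidean_space"
  assumes f: "f \<in> Linf U" and U: "U \<in> sets borel" and C: "AE x in lebesgue_on U. norm (f x) \<le> C" "0 \<le> C"
  obtains g where "g \<in> borel_measurable borel" "\<And>x. norm (g x) \<le> C" "\<And>x. x \<notin> U \<Longrightarrow> g x = 0"
    "AE x in lebesgue_on U. g x = f x"
proof -
  have Ul: "U \<in> sets lebesgue" using U by simp
  define f0 where "f0 x = (if x \<in> U then f x else 0)" for x
  have f0: "f0 \<in> borel_measurable lebesgue"
    unfolding f0_def[abs_def] using f Ul by (subst borel_measurable_if) (auto simp: Linf_def)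
  have "\<exists>g\<in>borel_measurable lborel. AE x in lborel. f0 x \<bullet> b = g x" for b
    by (rule completion_ex_borel_measurable_real) (use f0 in measurable)
  then obtain g where g: "\<And>b. g b \<in> borel_measurable lborel" "\<And>b. AE x in lborel. f0 x \<bullet> b = g b x" by metis
  define g0 where "g0 x = (\<Sum>b\<in>Basis. g b x *\<^sub>R b)" for x
  have [measurable]: "g b \<in> borel_measurable borel" for b using g(1) by simp
  have g0 [measurable]: "g0 \<in> borel_measurable borel" unfolding g0_def[abs_def] by measurable
  have "AE x in lborel. \<forall>b\<in>Basis. f0 x \<bullet> b = g b x"
    by (subst AE_finite_all) (use g in auto)
  then have AE0: "AE x in lborel. g0 x = f0 x"
  proof (rule AE_mp, intro AE_I2 impI)
    fix x assume "\<forall>b\<in>Basis. f0 x \<bullet> b = g b x"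
    then have "g0 x = (\<Sum>b\<in>Basis. (f0 x \<bullet> b) *\<^sub>R b)" by (simp add: g0_def)
    then show "g0 x = f0 x" by (simp only: euclidean_representation)
  qed
  define g1 where "g1 x = (if x \<in> U \<and> norm (g0 x) \<le> C then g0 x else 0)" for x
  have "g1 \<in> borel_measurable borel" unfolding g1_def[abs_def] using U by measurable
  moreover have "norm (g1 x) \<le> C" for x using C(2) by (simp add: g1_def)
  moreover have "g1 x = 0" if "x \<notin> U" for x using that by (simp add: g1_def)
  moreover have "AE x in lebesgue_on U. g1 x = f x"
  proof -
    have "AE x in lebesgue. x \<in> U \<longrightarrow> norm (f x) \<le> C"
      using C(1) Ul by (simp add: AE_restrict_space_iff)
    moreover have "AE x in lebesgue. g0 x = f0 x" using AE0 by (simp add: AE_completion_iff)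
    ultimately have "AE x in lebesgue. x \<in> U \<longrightarrow> g1 x = f x"
      by eventually_elim (auto simp: g1_def f0_def)
    then show ?thesis using Ul by (simp add: AE_restrict_space_iff)
  qed
  ultimately show ?thesis by (rule that)
qed

lemma borel_measurable_test_function:
  assumes "\<phi> \<in> test_functions \<Omega>"
  shows "\<phi> \<in> borel_measurable borel" "partial_deriv j \<phi> \<in> borel_measurable borel"
  using test_function_regularity(2)[OF assms] test_function_regularity(3)[OF assms, of j]
  by (auto intro: borel_measurable_continuous_onI)

lemma has_weak_gradient_cong_AE:
  assumes w: "has_weak_gradient \<Omega> u z" and u: "u \<in> borel_measurable (lebesgue_on \<Omega>)"
    and u': "u' \<in> borel_measurable (lebesgue_on \<Omega>)" "AE x in lebesgue_on \<Omega>. u' x = u x"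
    and z': "z' \<in> borel_measurable (lebesgue_on \<Omega>)" "AE x in lebesgue_on \<Omega>. z' x = z x"
  shows "has_weak_gradient \<Omega> u' z'"
proof -
  have z: "z \<in> borel_measurable (lebesgue_on \<Omega>)" and zL: "z \<in> Linf \<Omega>"
    using w by (auto simp: has_weak_gradient_def Linf_def)
  have "z' \<in> Linf \<Omega>"
  proof -
    obtain C where "AE x in lebesgue_on \<Omega>. norm (z x) \<le> C" using zL by (auto simp: Linf_def)
    with z'(2) have "AE x in lebesgue_on \<Omega>. norm (z' x) \<le> C" by eventually_elim simp
    then show ?thesis using z' by (auto simp: Linf_def)
  qed
  moreover have "(LINT x|lebesgue_on \<Omega>. u' x $ i * partial_deriv j \<phi> x) = - (LINT x|lebesgue_on \<Omega>. z' x $ i $ j * \<phi> x)"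
    if \<phi>: "\<phi> \<in> test_functions \<Omega>" for \<phi> i j
  proof -
    note [measurable] = borel_lebesgue_on[OF borel_measurable_test_function(1)[OF \<phi>]]
      borel_lebesgue_on[OF borel_measurable_test_function(2)[OF \<phi>]]
      borel_measurable_vec_nth_comp[OF u] borel_measurable_vec_nth_comp[OF u'(1)]
      borel_measurable_vec_nth_comp[OF borel_measurable_vec_nth_comp[OF z]]
      borel_measurable_vec_nth_comp[OF borel_measurable_vec_nth_comp[OF z'(1)]]
    have "(LINT x|lebesgue_on \<Omega>. u' x $ i * partial_deriv j \<phi> x) = (LINT x|lebesgue_on \<Omega>. u x $ i * partial_deriv j \<phi> x)"
      by (rule integral_cong_AE, measurable) (rule AE_mp[OF u'(2)], simp)
    moreover have "(LINT x|lebesgue_on \<Omega>. z' x $ i $ j * \<phi> x) = (LINT x|lebesgue_on \<Omega>. z x $ i $ j * \<phi> x)"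
      by (rule integral_cong_AE, measurable) (rule AE_mp[OF z'(2)], simp)
    ultimately show ?thesis using w \<phi> by (simp add: has_weak_gradient_def)
  qed
  ultimately show ?thesis by (simp add: has_weak_gradient_def)
qed

text \<open>
  The difference of bounded Borel representatives of two weak gradients is orthogonal to all test
  functions.
\<close>

lemma weak_gradient_unique:
  assumes \<Omega>: "open \<Omega>" and u: "u \<in> borel_measurable (lebesgue_on \<Omega>)"
    and z: "has_weak_gradient \<Omega> u z" and z': "has_weak_gradient \<Omega> u z'"
  shows "AE x in lebesgue_on \<Omega>. z x = z' x"
proof -
  have \<Omega>b: "\<Omega> \<in> sets borel" using \<Omega> by simp
  have rep: "\<exists>g. g \<in> borel_measurable borel \<and> (\<exists>C. \<forall>x. norm (g x) \<le> C) \<and> (AE x in lebesgue_on \<Omega>. g x = y x)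
      \<and> has_weak_gradient \<Omega> u g" if y: "has_weak_gradient \<Omega> u y" for y
  proof -
    have yL: "y \<in> Linf \<Omega>" using y by (simp add: has_weak_gradient_def)
    then obtain C where "AE x in lebesgue_on \<Omega>. norm (y x) \<le> C" by (auto simp: Linf_def)
    then have bd: "AE x in lebesgue_on \<Omega>. norm (y x) \<le> max C 0" by eventually_elim (rule max.coboundedI1)
    obtain g where g: "g \<in> borel_measurable borel" "\<And>x. norm (g x) \<le> max C 0"
        "\<And>x. x \<notin> \<Omega> \<Longrightarrow> g x = 0" "AE x in lebesgue_on \<Omega>. g x = y x"
      by (rule Linf_borel_representative[OF yL \<Omega>b bd max.cobounded2]) (rule that)
    have "has_weak_gradient \<Omega> u g"
      by (rule has_weak_gradient_cong_AE[OF y u u _ borel_lebesgue_on[OF g(1)] g(4)]) simp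
    then show ?thesis using g by (intro exI[of _ g] conjI exI[of _ "max C 0"]) auto
  qed
  obtain g C where g: "g \<in> borel_measurable borel" "\<And>x. norm (g x) \<le> C" "AE x in lebesgue_on \<Omega>. g x = z x"
    "has_weak_gradient \<Omega> u g" using rep[OF z] by (elim exE conjE) auto
  obtain g' C' where g': "g' \<in> borel_measurable borel" "\<And>x. norm (g' x) \<le> C'" "AE x in lebesgue_on \<Omega>. g' x = z' x"
    "has_weak_gradient \<Omega> u g'" using rep[OF z'] by (elim exE conjE) auto
  have comp: "\<bar>A $ i $ j\<bar> \<le> norm A" for A :: "real ^ 'a ^ 'b" and i j
    using component_le_norm_cart[of "A $ i" j] Finite_Cartesian_Product.norm_nth_le[of A i] by linarith
  have "AE x in lborel. x \<in> \<Omega> \<longrightarrow> g x $ i $ j - g' x $ i $ j = 0" for i j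
  proof (rule fundamental_lemma_variations[OF \<Omega>])
    have m [measurable]: "(\<lambda>x. g x $ i $ j) \<in> borel_measurable borel" "(\<lambda>x. g' x $ i $ j) \<in> borel_measurable borel"
      by (intro borel_measurable_vec_nth_comp g(1) g'(1))+
    show "(\<lambda>x. g x $ i $ j - g' x $ i $ j) \<in> borel_measurable borel" by measurable
    show "\<bar>g x $ i $ j - g' x $ i $ j\<bar> \<le> C + C'" for x
      using comp[of "g x" i j] comp[of "g' x" i j] g(2)[of x] g'(2)[of x] by linarith
    fix \<phi> assume \<phi>: "\<phi> \<in> test_functions \<Omega>"
    obtain a b where ab: "\<forall>x. x \<notin> cbox a b \<longrightarrow> \<phi> x = 0" using test_function_regularity(4)[OF \<phi>] by blast
    obtain B where B: "\<forall>x. \<bar>\<phi> x\<bar> \<le> B" using test_function_regularity(5)[OF \<phi>] by blast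
    note m\<phi> [measurable] = borel_measurable_test_function(1)[OF \<phi>]
    have int: "integrable (lebesgue_on \<Omega>) (\<lambda>x. f x * \<phi> x)" if f [measurable]: "f \<in> borel_measurable borel" and K: "\<And>x. \<bar>f x\<bar> \<le> K" for f K
    proof (subst integral_lebesgue_on_borel(2)[OF \<Omega>b])
      show "integrable lborel (\<lambda>x. indicator \<Omega> x *\<^sub>R (f x * \<phi> x))"
      proof (rule integrable_bounded_compact_support[where B="K * B" and a=a and b=b])
        show "\<bar>indicator \<Omega> x *\<^sub>R (f x * \<phi> x)\<bar> \<le> K * B" for x
        proof -
          have "0 \<le> K" using K[of x] by linarith
          have "0 \<le> B" using spec[OF B, of x] by linarith
          have le: "\<bar>f x\<bar> * \<bar>\<phi> x\<bar> \<le> K * B" by (intro mult_mono K spec[OF B] abs_ge_zero \<open>0 \<le> K\<close>)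
          show ?thesis
          proof (cases "x \<in> \<Omega>")
            case True
            then have "\<bar>indicator \<Omega> x *\<^sub>R (f x * \<phi> x)\<bar> = \<bar>f x\<bar> * \<bar>\<phi> x\<bar>" by (simp add: abs_mult)
            with le show ?thesis by simp
          next
            case False
            then show ?thesis using \<open>0 \<le> K\<close> \<open>0 \<le> B\<close> by simp
          qed
        qed
      qed (use ab \<Omega>b in auto)
    qed auto
    have "(LINT x|lebesgue_on \<Omega>. (g x $ i $ j - g' x $ i $ j) * \<phi> x)
        = (LINT x|lebesgue_on \<Omega>. g x $ i $ j * \<phi> x - g' x $ i $ j * \<phi> x)"
      by (simp only: left_diff_distrib)
    also have "\<dots> = (LINT x|lebesgue_on \<Omega>. g x $ i $ j * \<phi> x) - (LINT x|lebesgue_on \<Omega>. g' x $ i $ j * \<phi> x)"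
      by (rule Bochner_Integration.integral_diff[OF int[OF m(1) order_trans[OF comp g(2)]] int[OF m(2) order_trans[OF comp g'(2)]]])
    also have "\<dots> = 0"
    proof -
      have "(LINT x|lebesgue_on \<Omega>. u x $ i * partial_deriv j \<phi> x) = - (LINT x|lebesgue_on \<Omega>. g x $ i $ j * \<phi> x)"
        using g(4) \<phi> unfolding has_weak_gradient_def by blast
      moreover have "(LINT x|lebesgue_on \<Omega>. u x $ i * partial_deriv j \<phi> x) = - (LINT x|lebesgue_on \<Omega>. g' x $ i $ j * \<phi> x)"
        using g'(4) \<phi> unfolding has_weak_gradient_def by blast
      ultimately show ?thesis by linarith
    qed
    finally show "(LINT x|lebesgue_on \<Omega>. (g x $ i $ j - g' x $ i $ j) * \<phi> x) = 0" .
  qed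
  then have "AE x in lborel. \<forall>i j. x \<in> \<Omega> \<longrightarrow> g x $ i $ j - g' x $ i $ j = 0"
    by (intro eventually_all_finite)
  then have "AE x in lborel. x \<in> \<Omega> \<longrightarrow> g x = g' x"
    by eventually_elim (simp add: vec_eq_iff)
  then have "AE x in lebesgue. x \<in> \<Omega> \<longrightarrow> g x = g' x" by (simp add: AE_completion_iff)
  then have "AE x in lebesgue_on \<Omega>. g x = g' x" using \<Omega>b by (simp add: AE_restrict_space_iff)
  with g(3) g'(3) show ?thesis by eventually_elim simp
qed

lemma open_cube: "open (cube x r)"
  by (simp add: cube_def open_box)

text \<open>
  Pulling a test function on the unit cube back to the small cube produces the factor \<open>1 / r\<close> in its
  derivative, and the constant \<open>c\<close> drops out because derivatives of test functions have integral \<open>0\<close>.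
\<close>

lemma has_weak_gradient_rescale:
  fixes u :: "real ^ 'n \<Rightarrow> real ^ 'd"
  assumes \<Omega>: "open \<Omega>" and w: "has_weak_gradient \<Omega> u z"
    and u: "u \<in> borel_measurable borel" and uC: "\<And>x. norm (u x) \<le> C"
    and z: "z \<in> borel_measurable borel" and zM: "\<And>x. norm (z x) \<le> M"
    and r: "0 < r" and sub: "cube a r \<subseteq> \<Omega>"
  shows "has_weak_gradient (cube 0 1) (\<lambda>y. (1 / r) *\<^sub>R (u (a + r *\<^sub>R y) - c)) (\<lambda>y. z (a + r *\<^sub>R y))"
  unfolding has_weak_gradient_def
proof (intro conjI ballI allI)
  let ?Q = "cube (0 :: real ^ 'n) 1"
  have aff: "(\<lambda>y. a + r *\<^sub>R y) \<in> borel_measurable borel" by measurable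
  have zm: "(\<lambda>y. z (a + r *\<^sub>R y)) \<in> borel_measurable borel" by (rule measurable_compose[OF aff z])
  then show "(\<lambda>y. z (a + r *\<^sub>R y)) \<in> Linf ?Q"
    using zM borel_lebesgue_on unfolding Linf_def by blast
  fix \<phi> :: "real ^ 'n \<Rightarrow> real" and i j assume \<phi>: "\<phi> \<in> test_functions ?Q"
  note T = test_function_regularity(1,2)[OF \<phi>] test_function_regularity(3-5)[OF \<phi>, of j]
  note \<phi>m = borel_measurable_test_function(1)[OF \<phi>]
  note \<phi>'m = borel_measurable_test_function(2)[OF \<phi>, of j]
  obtain B where B: "\<And>x. \<bar>\<phi> x\<bar> \<le> B" "\<And>x. \<bar>partial_deriv j \<phi> x\<bar> \<le> B" using T(5) by blast
  \<comment> \<open>the pulled-back test function, in the form of \<open>C_k_affine\<close>\<close>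
  define \<psi> where "\<psi> x = 1 * \<phi> ((- (1 / r)) *\<^sub>R a + (1 / r) *\<^sub>R x)" for x
  have arg: "(- (1 / r)) *\<^sub>R a + (1 / r) *\<^sub>R x = (1 / r) *\<^sub>R (x - a)" for x by (simp add: scaleR_diff_right)
  have inv_arg: "(- (1 / r)) *\<^sub>R a + (1 / r) *\<^sub>R (a + r *\<^sub>R y) = y" for y using r by (simp add: scaleR_add_right)
  define K where "K = closure {y. \<phi> y \<noteq> 0}"
  have K: "compact K" "K \<subseteq> ?Q" using \<phi> by (auto simp: test_functions_def K_def)
  have zero: "\<phi> y = 0 \<and> partial_deriv j \<phi> y = 0" if "y \<notin> ?Q" for y
  proof
    show "\<phi> y = 0" using that K(2) closure_subset[of "{y. \<phi> y \<noteq> 0}"] by (auto simp: K_def)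
    have "open (- K)" using K by (simp add: compact_imp_closed open_Compl)
    have "((\<lambda>x. 0) has_derivative (\<lambda>x. 0)) (at y)" by simp
    then have "(\<phi> has_derivative (\<lambda>x. 0)) (at y)"
      by (rule has_derivative_transform_within_open[OF _ \<open>open (- K)\<close>])
        (use that K(2) closure_subset[of "{y. \<phi> y \<noteq> 0}"] in \<open>auto simp: K_def\<close>)
    then show "partial_deriv j \<phi> y = 0"
      unfolding partial_deriv_def by (subst frechet_derivative_at[symmetric]) auto
  qed
  have \<psi>: "\<psi> \<in> test_functions \<Omega>"
  proof -
    let ?K = "(\<lambda>y. a + r *\<^sub>R y) ` K"
    have "C_k k \<psi>" for k
      unfolding \<psi>_def[abs_def] by (rule C_k_affine) (use \<phi> in \<open>simp add: test_functions_def\<close>)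
    have sup: "{x. \<psi> x \<noteq> 0} \<subseteq> ?K"
    proof
      fix x assume "x \<in> {x. \<psi> x \<noteq> 0}"
      then have "\<phi> ((1 / r) *\<^sub>R (x - a)) \<noteq> 0" unfolding mem_Collect_eq \<psi>_def arg mult_1_left .
      then have "(1 / r) *\<^sub>R (x - a) \<in> K" using closure_subset[of "{y. \<phi> y \<noteq> 0}"] by (auto simp: K_def)
      moreover have "x = a + r *\<^sub>R ((1 / r) *\<^sub>R (x - a))" using r by simp
      ultimately show "x \<in> ?K" by blast
    qed
    have cK: "compact ?K"
      by (intro compact_continuous_image K continuous_intros)
    with sup have cl: "closure {x. \<psi> x \<noteq> 0} \<subseteq> ?K" by (simp add: closure_minimal compact_imp_closed)
    have "?K \<subseteq> cube a r" using K(2) mem_cube_affine[OF r, of a] by blast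
    with cl sub have "closure {x. \<psi> x \<noteq> 0} \<subseteq> \<Omega>" by blast
    moreover have "compact (closure {x. \<psi> x \<noteq> 0})"
      using compact_Int_closed[OF cK closed_closure] cl by (metis Int_absorb1)
    ultimately show ?thesis using \<open>\<And>k. C_k k \<psi>\<close> by (simp add: test_functions_def)
  qed
  have \<psi>': "partial_deriv j \<psi> = (\<lambda>x. (1 / r) * partial_deriv j \<phi> ((- (1 / r)) *\<^sub>R a + (1 / r) *\<^sub>R x))"
    unfolding \<psi>_def[abs_def] partial_deriv_affine(1)[OF T(1)] by simp
  have outside: "(- (1 / r)) *\<^sub>R a + (1 / r) *\<^sub>R x \<notin> ?Q" if "x \<notin> cube a r" for x
  proof -
    have "x = a + r *\<^sub>R ((1 / r) *\<^sub>R (x - a))" using r by simp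
    then show ?thesis using that mem_cube_affine[OF r, of a "(1 / r) *\<^sub>R (x - a)"] unfolding arg by simp
  qed
  have um: "(\<lambda>x. u x $ i) \<in> borel_measurable borel" by (rule borel_measurable_vec_nth_comp[OF u])
  have zim: "(\<lambda>x. z x $ i $ j) \<in> borel_measurable borel" by (intro borel_measurable_vec_nth_comp z)
  have \<psi>m: "\<psi> \<in> borel_measurable borel" and \<psi>'m: "partial_deriv j \<psi> \<in> borel_measurable borel"
    by (rule borel_measurable_test_function[OF \<psi>])+
  have 1: "(LINT x|lebesgue_on \<Omega>. u x $ i * partial_deriv j \<psi> x)
    = r ^ DIM(real ^ 'n) * (LINT y|lebesgue_on ?Q. u (a + r *\<^sub>R y) $ i * ((1 / r) * partial_deriv j \<phi> y))"
  proof -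
    have "(LINT x|lebesgue_on \<Omega>. u x $ i * partial_deriv j \<psi> x)
      = r ^ DIM(real ^ 'n) * (LINT y|lebesgue_on ?Q. u (a + r *\<^sub>R y) $ i * partial_deriv j \<psi> (a + r *\<^sub>R y))"
    proof (rule integral_supported_in_cube[OF \<Omega> _ r sub])
      show "(\<lambda>x. u x $ i * partial_deriv j \<psi> x) \<in> borel_measurable borel" using um \<psi>'m by simp
      show "u x $ i * partial_deriv j \<psi> x = 0" if "x \<notin> cube a r" for x
        using zero[OF outside[OF that]] by (simp add: \<psi>')
    qed
    then show ?thesis unfolding \<psi>' inv_arg .
  qed
  have 2: "(LINT x|lebesgue_on \<Omega>. z x $ i $ j * \<psi> x)
    = r ^ DIM(real ^ 'n) * (LINT y|lebesgue_on ?Q. z (a + r *\<^sub>R y) $ i $ j * \<phi> y)"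
  proof -
    have "(LINT x|lebesgue_on \<Omega>. z x $ i $ j * \<psi> x)
      = r ^ DIM(real ^ 'n) * (LINT y|lebesgue_on ?Q. z (a + r *\<^sub>R y) $ i $ j * \<psi> (a + r *\<^sub>R y))"
    proof (rule integral_supported_in_cube[OF \<Omega> _ r sub])
      show "(\<lambda>x. z x $ i $ j * \<psi> x) \<in> borel_measurable borel" using zim \<psi>m by simp
      show "z x $ i $ j * \<psi> x = 0" if "x \<notin> cube a r" for x
        using zero[OF outside[OF that]] by (simp add: \<psi>_def)
    qed
    then show ?thesis unfolding \<psi>_def inv_arg mult_1_left .
  qed
  have weak: "(LINT x|lebesgue_on \<Omega>. u x $ i * partial_deriv j \<psi> x) = - (LINT x|lebesgue_on \<Omega>. z x $ i $ j * \<psi> x)"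
    using w \<psi> unfolding has_weak_gradient_def by blast
  have d0: "(LINT y|lebesgue_on ?Q. partial_deriv j \<phi> y) = 0"
  proof -
    have "(LINT y|lebesgue_on ?Q. partial_deriv j \<phi> y) = (LINT y|lborel. indicator ?Q y *\<^sub>R partial_deriv j \<phi> y)"
      by (rule integral_lebesgue_on_borel(1)[OF borel_cube \<phi>'m])
    also have "(\<lambda>y. indicator ?Q y *\<^sub>R partial_deriv j \<phi> y) = partial_deriv j \<phi>"
    proof
      fix y show "indicator ?Q y *\<^sub>R partial_deriv j \<phi> y = partial_deriv j \<phi> y"
        using zero[of y] by (cases "y \<in> ?Q") simp_all
    qed
    finally show ?thesis using integral_partial_deriv_eq_0[OF \<phi>] by simp
  qed
  have int: "integrable (lebesgue_on ?Q) (\<lambda>y. (1 / r) * (u (a + r *\<^sub>R y) $ i * partial_deriv j \<phi> y))"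
  proof (intro integrable_mult_right integrable_cube_bounded[where C="C * B"] borel_lebesgue_on)
    show "(\<lambda>y. u (a + r *\<^sub>R y) $ i * partial_deriv j \<phi> y) \<in> borel_measurable borel"
      using measurable_compose[OF aff um] \<phi>'m by simp
    show "\<bar>u (a + r *\<^sub>R y) $ i * partial_deriv j \<phi> y\<bar> \<le> C * B" for y
    proof -
      have "\<bar>u (a + r *\<^sub>R y) $ i\<bar> \<le> C" using component_le_norm_cart uC order_trans by blast
      moreover from this have "0 \<le> C" by linarith
      ultimately show ?thesis unfolding abs_mult by (intro mult_mono B abs_ge_zero)
    qed
  qed
  have int2: "integrable (lebesgue_on ?Q) (\<lambda>y. (1 / r) * (c $ i) * partial_deriv j \<phi> y)"
    by (intro integrable_mult_right integrable_cube_bounded[where C=B] borel_lebesgue_on \<phi>'m B)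
  have "(LINT y|lebesgue_on ?Q. ((1 / r) *\<^sub>R (u (a + r *\<^sub>R y) - c)) $ i * partial_deriv j \<phi> y)
      = (LINT y|lebesgue_on ?Q. (1 / r) * (u (a + r *\<^sub>R y) $ i * partial_deriv j \<phi> y) - (1 / r) * (c $ i) * partial_deriv j \<phi> y)"
    by (rule Bochner_Integration.integral_cong) (simp_all add: left_diff_distrib right_diff_distrib diff_divide_distrib)
  also have "\<dots> = (LINT y|lebesgue_on ?Q. (1 / r) * (u (a + r *\<^sub>R y) $ i * partial_deriv j \<phi> y))
      - (LINT y|lebesgue_on ?Q. (1 / r) * (c $ i) * partial_deriv j \<phi> y)"
    by (rule Bochner_Integration.integral_diff[OF int int2])
  also have "(LINT y|lebesgue_on ?Q. (1 / r) * (c $ i) * partial_deriv j \<phi> y) = 0"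
    using d0 by simp
  also have "(LINT y|lebesgue_on ?Q. (1 / r) * (u (a + r *\<^sub>R y) $ i * partial_deriv j \<phi> y))
      = (LINT y|lebesgue_on ?Q. u (a + r *\<^sub>R y) $ i * ((1 / r) * partial_deriv j \<phi> y))"
    by (simp only: mult.left_commute)
  also have "\<dots> = - (LINT y|lebesgue_on ?Q. z (a + r *\<^sub>R y) $ i $ j * \<phi> y)"
  proof -
    have "r ^ DIM(real ^ 'n) * (LINT y|lebesgue_on ?Q. u (a + r *\<^sub>R y) $ i * ((1 / r) * partial_deriv j \<phi> y))
      = r ^ DIM(real ^ 'n) * (- (LINT y|lebesgue_on ?Q. z (a + r *\<^sub>R y) $ i $ j * \<phi> y))"
      using weak unfolding 1 2 by (simp only: mult_minus_right)
    then show ?thesis using r by (simp only: mult_cancel_left) simp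
  qed
  finally show "(LINT y|lebesgue_on ?Q. ((1 / r) *\<^sub>R (u (a + r *\<^sub>R y) - c)) $ i * partial_deriv j \<phi> y)
      = - (LINT y|lebesgue_on ?Q. z (a + r *\<^sub>R y) $ i $ j * \<phi> y)" by simp
qed

section \<open>Blow-up at a point\<close>

lemma AE_lborel_affine:
  fixes a :: "'a::euclidean_space"
  assumes P: "Measurable.pred borel P" and r: "r \<noteq> 0" and AE: "AE x in lborel. P x"
  shows "AE y in lborel. P (a + r *\<^sub>R y)"
proof -
  have "AE x in density (distr lborel borel (\<lambda>x. a + r *\<^sub>R x)) (\<lambda>_. \<bar>r\<bar> ^ DIM('a)). P x"
    by (subst lborel_affine[OF r, of a, symmetric]) (rule AE)
  then have "AE x in distr lborel borel (\<lambda>x. a + r *\<^sub>R x). P x"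
    using r by (simp add: AE_density)
  then show ?thesis by (subst (asm) AE_distr_iff) (use P in auto)
qed

lemma abs_entry_le_norm: "\<bar>A $ i $ j\<bar> \<le> norm A" for A :: "real ^ 'a ^ 'b"
  using component_le_norm_cart[of "A $ i" j] Finite_Cartesian_Product.norm_nth_le[of A i] by linarith

lemma gradient_oscillation_vector:
  fixes u :: "real ^ 'n \<Rightarrow> real ^ 'd" and C M r R :: real
  assumes \<Omega>: "open \<Omega>" and w: "has_weak_gradient \<Omega> u z"
    and u: "u \<in> borel_measurable borel" and uC: "\<And>x. norm (u x) \<le> C"
    and z: "z \<in> borel_measurable borel" and zM: "\<And>x. norm (z x) \<le> M"
    and sub: "cube a R \<subseteq> \<Omega>"
  shows "\<exists>c. AE y in lborel. y \<in> cube a R \<longrightarrow>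
    norm (u y - c) \<le> CARD('d) * (CARD('n) * (M * R) / bump_mass TYPE('n))"
proof -
  let ?B = "CARD('n) * (M * R) / bump_mass TYPE('n)"
  have "\<forall>i. \<exists>c. AE y in lborel. y \<in> cube a R \<longrightarrow> \<bar>u y $ i - c\<bar> \<le> ?B"
  proof
    fix i
    show "\<exists>c. AE y in lborel. y \<in> cube a R \<longrightarrow> \<bar>u y $ i - c\<bar> \<le> ?B"
    proof (rule weak_gradient_oscillation_bound[OF \<Omega>, of _ C "\<lambda>j x. z x $ i $ j"])
      show "(\<lambda>x. u x $ i) \<in> borel_measurable borel" by (rule borel_measurable_vec_nth_comp[OF u])
      show "\<bar>u x $ i\<bar> \<le> C" for x using component_le_norm_cart[of "u x" i] uC[of x] by linarith
      show "(\<lambda>x. z x $ i $ j) \<in> borel_measurable borel" for j by (intro borel_measurable_vec_nth_comp z)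
      show "\<bar>z x $ i $ j\<bar> \<le> M" for j x using abs_entry_le_norm[of "z x" i j] zM[of x] by linarith
      show "(LINT x|lebesgue_on \<Omega>. u x $ i * partial_deriv j \<phi> x) = - (LINT x|lebesgue_on \<Omega>. z x $ i $ j * \<phi> x)"
        if "\<phi> \<in> test_functions \<Omega>" for \<phi> j using w that unfolding has_weak_gradient_def by blast
    qed (rule sub)
  qed
  from choice[OF this] obtain c where c: "\<And>i. AE y in lborel. y \<in> cube a R \<longrightarrow> \<bar>u y $ i - c i\<bar> \<le> ?B" by auto
  have "AE y in lborel. \<forall>i. y \<in> cube a R \<longrightarrow> \<bar>u y $ i - c i\<bar> \<le> ?B"
    by (intro eventually_all_finite c)
  then have "AE y in lborel. y \<in> cube a R \<longrightarrow> norm (u y - (\<chi> i. c i)) \<le> CARD('d) * ?B"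
  proof eventually_elim
    case (elim y)
    show ?case
    proof
      assume y: "y \<in> cube a R"
      have "norm (u y - (\<chi> i. c i)) \<le> (\<Sum>i\<in>UNIV. \<bar>(u y - (\<chi> i. c i)) $ i\<bar>)" by (rule norm_le_l1_cart)
      also have "\<dots> \<le> (\<Sum>i\<in>(UNIV :: 'd set). ?B)" by (intro sum_mono) (use elim y in simp)
      finally show "norm (u y - (\<chi> i. c i)) \<le> CARD('d) * ?B" by simp
    qed
  qed
  then show ?thesis by blast
qed

lemma has_weak_gradient_weak_gradient:
  "has_weak_gradient \<Omega> u z \<Longrightarrow> has_weak_gradient \<Omega> u (weak_gradient \<Omega> u)"
  unfolding weak_gradient_def by (rule someI[of "has_weak_gradient \<Omega> u"])

text \<open>
  With a suitable constant subtracted, the blow-up is bounded in terms of \<open>M\<close>, uniformly in \<open>r\<close> and \<open>C\<close>,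
  because the oscillation of \<open>u\<close> on the small cube is at most a multiple of \<open>M * r\<close>.
\<close>

lemma blow_up_W1inf:
  fixes u :: "real ^ 'n \<Rightarrow> real ^ 'd" and C M r R :: real
  assumes \<Omega>: "open \<Omega>" and w: "has_weak_gradient \<Omega> u z"
    and u: "u \<in> borel_measurable borel" and uC: "\<And>x. norm (u x) \<le> C"
    and z: "z \<in> borel_measurable borel" and zM: "\<And>x. norm (z x) \<le> M"
    and r: "0 < r" and sub: "cube a r \<subseteq> \<Omega>"
  obtains w where "w \<in> W1inf (cube 0 1)"
    "AE y in lebesgue_on (cube 0 1). weak_gradient (cube 0 1) w y = z (a + r *\<^sub>R y)"
    "AE y in lebesgue_on (cube 0 1). norm (w y) \<le> CARD('d) * (CARD('n) * M / bump_mass TYPE('n))"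
proof -
  let ?Q = "cube (0 :: real ^ 'n) 1"
  let ?K = "CARD('d) * (CARD('n) * M / bump_mass TYPE('n))"
  obtain c where c: "AE y in lborel. y \<in> cube a r \<longrightarrow>
    norm (u y - c) \<le> CARD('d) * (CARD('n) * (M * r) / bump_mass TYPE('n))"
    using gradient_oscillation_vector[OF \<Omega> w u uC z zM sub] by blast
  define v where "v y = (1 / r) *\<^sub>R (u (a + r *\<^sub>R y) - c)" for y
  have wg: "has_weak_gradient ?Q v (\<lambda>y. z (a + r *\<^sub>R y))"
    unfolding v_def[abs_def] by (rule has_weak_gradient_rescale[OF \<Omega> w u uC z zM r sub])
  have aff: "(\<lambda>y. a + r *\<^sub>R y) \<in> borel_measurable borel" by measurable
  have vm: "v \<in> borel_measurable borel"
    unfolding v_def[abs_def] using measurable_compose[OF aff u] by measurable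
  have "AE y in lborel. (a + r *\<^sub>R y \<in> cube a r \<longrightarrow>
    norm (u (a + r *\<^sub>R y) - c) \<le> CARD('d) * (CARD('n) * (M * r) / bump_mass TYPE('n)))"
    by (rule AE_lborel_affine[OF _ _ c]) (use r u in auto)
  then have "AE y in lborel. y \<in> ?Q \<longrightarrow> norm (v y) \<le> ?K"
  proof eventually_elim
    case (elim y)
    show ?case
    proof
      assume "y \<in> ?Q"
      then have "norm (u (a + r *\<^sub>R y) - c) \<le> CARD('d) * (CARD('n) * (M * r) / bump_mass TYPE('n))"
        using elim mem_cube_affine[OF r, of a y] by simp
      also have "\<dots> = ?K * r" by simp
      finally show "norm (v y) \<le> ?K" using r by (simp add: v_def pos_divide_le_eq)
    qed
  qed
  then have vK: "AE y in lebesgue_on ?Q. norm (v y) \<le> ?K"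
    by (simp add: AE_restrict_space_iff AE_completion_iff)
  have vL: "v \<in> Linf ?Q"
    using borel_lebesgue_on[OF vm] vK unfolding Linf_def by blast
  have AEeq: "AE y in lebesgue_on ?Q. weak_gradient ?Q v y = z (a + r *\<^sub>R y)"
    by (rule weak_gradient_unique[OF open_cube borel_lebesgue_on[OF vm] has_weak_gradient_weak_gradient[OF wg] wg])
  have "v \<in> W1inf ?Q" using vL wg unfolding W1inf_def by blast
  then show ?thesis by (rule that[OF _ AEeq vK])
qed

lemma borel_measurable_gradient:
  "w \<in> W1inf U \<Longrightarrow> weak_gradient U w \<in> borel_measurable (lebesgue_on U)"
proof -
  assume "w \<in> W1inf U"
  then obtain z where "has_weak_gradient U w z" by (auto simp: W1inf_def)
  from has_weak_gradient_weak_gradient[OF this] show ?thesis by (simp add: has_weak_gradient_def Linf_def)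
qed

text \<open>
  Replaces the powers by bounded continuous functions on the whole line, as weak convergence of
  measures demands, and moves limit measures to the unit interval.
\<close>

definition clamp01 :: "real \<Rightarrow> real" where
  "clamp01 t = max 0 (min 1 t)"

lemma clamp01: "0 \<le> clamp01 t" "clamp01 t \<le> 1" "0 \<le> t \<Longrightarrow> t \<le> 1 \<Longrightarrow> clamp01 t = t"
  by (auto simp: clamp01_def)

lemma continuous_clamp01: "continuous_on UNIV clamp01"
  unfolding clamp01_def[abs_def] by (intro continuous_intros)

text \<open>
  The distributions of the \<open>g k\<close> live on the unit interval, hence they are tight, and by Helly's theorem a
  subsequence converges weakly. Clamping leaves the \<open>g k\<close> unchanged, hence the clamped
  limit has the limit moments.
\<close>

lemma moment_limit_measure:
  fixes g :: "nat \<Rightarrow> 'a \<Rightarrow> real"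
  assumes Q: "prob_space Q" and g: "\<And>k. g k \<in> borel_measurable Q" "\<And>k y. 0 \<le> g k y \<and> g k y \<le> 1"
    and lim: "\<And>i. (\<lambda>k. LINT y|Q. g k y ^ i) \<longlonglongrightarrow> \<mu> i"
  obtains lam where "prob_space lam" "sets lam = sets borel" "AE t in lam. 0 \<le> t \<and> t \<le> 1"
    "\<And>i. (LINT t|lam. t ^ i) = \<mu> i"
proof -
  interpret Q: prob_space Q by fact
  have rd: "real_distribution (distr Q borel (g k))" for k
    unfolding real_distribution_def real_distribution_axioms_def using Q.prob_space_distr[OF g(1)] by simp
  have meas: "measure (distr Q borel (g k)) {-1<..1} = 1" for k
  proof -
    have "g k y \<in> {-1<..1}" for y using g(2)[of k y] by auto
    then have "g k -` {-1<..1} \<inter> space Q = space Q" by blast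
    then show ?thesis using Q.prob_space by (simp add: measure_distr g(1))
  qed
  have "tight (\<lambda>k. distr Q borel (g k))"
    unfolding tight_def
  proof (intro conjI allI impI rd)
    fix e :: real assume "0 < e"
    then show "\<exists>a b. a < b \<and> (\<forall>n. 1 - e < measure (distr Q borel (g n)) {a<..b})"
      by (intro exI[of _ "-1"] exI[of _ 1]) (simp only: meas, simp)
  qed
  from tight_imp_convergent_subsubsequence[OF this strict_mono_id]
  obtain p L where p: "strict_mono (p :: nat \<Rightarrow> nat)" "real_distribution L"
    "weak_conv_m ((\<lambda>k. distr Q borel (g k)) \<circ> id \<circ> p) L" by blast
  interpret L: real_distribution L by fact
  have cm [measurable]: "clamp01 \<in> borel_measurable borel"
    using continuous_clamp01 by (rule borel_measurable_continuous_onI)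
  have cL: "clamp01 \<in> L \<rightarrow>\<^sub>M borel" using cm by simp
  have mom: "(LINT t|L. clamp01 t ^ i) = \<mu> i" for i
  proof -
    have "(\<lambda>n. integral\<^sup>L (((\<lambda>k. distr Q borel (g k)) \<circ> id \<circ> p) n) (\<lambda>t. clamp01 t ^ i))
        \<longlonglongrightarrow> (LINT t|L. clamp01 t ^ i)"
    proof (rule weak_conv_imp_integral_bdd_continuous_conv[where B=1])
      show "real_distribution (((\<lambda>k. distr Q borel (g k)) \<circ> id \<circ> p) n)" for n using rd by simp
      show "isCont (\<lambda>t. clamp01 t ^ i) x" for x
        using continuous_on_power[OF continuous_clamp01, of i] by (simp add: continuous_on_eq_continuous_at)
      show "norm (clamp01 t ^ i) \<le> 1" for t using clamp01[of t] by (simp add: power_le_one)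
    qed (rule p(2), rule p(3))
    moreover have "integral\<^sup>L (((\<lambda>k. distr Q borel (g k)) \<circ> id \<circ> p) n) (\<lambda>t. clamp01 t ^ i) = (LINT y|Q. g (p n) y ^ i)" for n
    proof -
      have "integral\<^sup>L (distr Q borel (g (p n))) (\<lambda>t. clamp01 t ^ i) = (LINT y|Q. clamp01 (g (p n) y) ^ i)"
        by (rule integral_distr[OF g(1)]) measurable
      then show ?thesis using g(2) clamp01(3) by simp
    qed
    moreover have "(\<lambda>n. LINT y|Q. g (p n) y ^ i) \<longlonglongrightarrow> \<mu> i"
      using LIMSEQ_subseq_LIMSEQ[OF lim p(1), of i] by (simp add: comp_def)
    ultimately show ?thesis using LIMSEQ_unique by auto
  qed
  show ?thesis
  proof (rule that[of "distr L borel clamp01"])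
    show "prob_space (distr L borel clamp01)" by (rule L.prob_space_distr[OF cL])
    show "AE t in distr L borel clamp01. 0 \<le> t \<and> t \<le> 1"
      by (subst AE_distr_iff[OF cL]) (auto simp: clamp01)
    show "(LINT t|distr L borel clamp01. t ^ i) = \<mu> i" for i
      by (subst integral_distr[OF cL]) (auto simp: mom)
  qed simp
qed

text \<open>
  For a common Lebesgue point \<open>x\<close> of the limit moments \<open>m i\<close>, scales \<open>r k\<close> are chosen first, so small that
  \<open>m i\<close> is close to \<open>m i x\<close> in mean on the cube of side \<open>r k\<close> for all \<open>i \<le> k\<close>. Weak* convergence on this cube
  then gives an index \<open>j k\<close> for which the powers of \<open>code (z (j k) (x + r k y))\<close> are close to \<open>m i (x + r k y)\<close> when
  tested on the first \<open>k\<close> sets of a countable dense family. Hence these powers converge weakly* to the constants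
  \<open>m i x\<close>. This gives the measure \<open>lam\<close> with these moments, and shows that its image under \<open>dec\<close> is generated
  by the rescaled gradients.
\<close>

theorem blow_up_homogeneous_gradient_young_measure:
  fixes \<Omega> :: "(real ^ 'n) set" and u :: "nat \<Rightarrow> real ^ 'n \<Rightarrow> real ^ 'd" and z :: "nat \<Rightarrow> real ^ 'n \<Rightarrow> real ^ 'n ^ 'd"
    and dec :: "real \<Rightarrow> real ^ 'n ^ 'd" and M :: real
  assumes \<Omega>: "open \<Omega>" and wg: "\<And>j. has_weak_gradient \<Omega> (u j) (z j)"
    and u: "\<And>j. u j \<in> borel_measurable borel" "\<And>j x. norm (u j x) \<le> C j"
    and z: "\<And>j. z j \<in> borel_measurable borel" "\<And>j x. norm (z j x) \<le> M"
    and dec: "continuous_on UNIV dec" and code: "code \<in> borel_measurable borel" "\<And>\<xi>. 0 \<le> code \<xi> \<and> code \<xi> \<le> 1"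
      "\<And>\<xi>. norm \<xi> \<le> M \<Longrightarrow> dec (code \<xi>) = \<xi>"
    and m: "\<And>i. m i \<in> borel_measurable borel" "\<And>i x. 0 \<le> m i x \<and> m i x \<le> 1"
    and lim: "\<And>i h. integrable (lebesgue_on \<Omega>) h \<Longrightarrow>
      (\<lambda>j. LINT x|lebesgue_on \<Omega>. code (z j x) ^ i * h x) \<longlonglongrightarrow> (LINT x|lebesgue_on \<Omega>. m i x * h x)"
  shows "AE x in lborel. x \<in> \<Omega> \<longrightarrow> (\<exists>lam. prob_space lam \<and> sets lam = sets borel \<and> (AE t in lam. 0 \<le> t \<and> t \<le> 1) \<and>
    (\<forall>i. (LINT t|lam. t ^ i) = m i x) \<and> homogeneous_W1inf_gradient_young_measure (distr lam borel dec))"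
proof -
  let ?Q = "cube (0 :: real ^ 'n) 1" and ?LQ = "lebesgue_on (cube (0 :: real ^ 'n) 1)"
  interpret Q: prob_space ?LQ by (rule prob_space_cube)
  have \<Omega>b [measurable]: "\<Omega> \<in> sets borel" using \<Omega> by simp
  define s where "s j x = code (z j x)" for j x
  have s [measurable]: "s j \<in> borel_measurable borel" for j
    unfolding s_def[abs_def] by (rule measurable_compose[OF z(1) code(1)])
  have s01: "0 \<le> s j x" "s j x \<le> 1" for j x using code(2) by (auto simp: s_def)
  have mabs: "\<bar>m i x\<bar> \<le> 1" for i x using m(2)[of i x] by simp
  note [measurable] = m(1)
  obtain E :: "nat \<Rightarrow> (real ^ 'n) set" where E: "\<And>n. open (E n)"
    "\<And>A e. A \<in> sets ?LQ \<Longrightarrow> 0 < e \<Longrightarrow> \<exists>n. measure ?LQ ((A - E n) \<union> (?Q \<inter> E n - A)) < e"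
    using lebesgue_countable_dense_sets[OF cube_lebesgue[of "0 :: real ^ 'n" 1]] Q.finite_measure_axioms by metis
  have Eb [measurable]: "E n \<in> sets borel" for n using E(1) by simp
  have "AE x in lborel. \<forall>i. ((\<lambda>r. LINT y|?LQ. \<bar>m i (x + r *\<^sub>R y) - m i x\<bar>) \<longlongrightarrow> 0) (at_right 0)"
    by (subst AE_all_countable) (intro allI lebesgue_point_cube[OF m(1) mabs])
  then show ?thesis
  proof eventually_elim
    case (elim x)
    note LP = this
    show ?case
    proof
      assume x: "x \<in> \<Omega>"
      \<comment> \<open>the scales are determined by the limit moments alone\<close>
      have "\<exists>r>0. cube x r \<subseteq> \<Omega> \<and> (\<forall>i\<le>k. (LINT y|?LQ. \<bar>m i (x + r *\<^sub>R y) - m i x\<bar>) < 1 / real (Suc k))" for k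
      proof -
        have "\<forall>\<^sub>F r in at_right 0. (LINT y|?LQ. \<bar>m i (x + r *\<^sub>R y) - m i x\<bar>) < 1 / real (Suc k)" for i
          using LP by (intro order_tendstoD(2)[of _ 0]) auto
        then have "\<forall>\<^sub>F r in at_right 0. \<forall>i\<in>{..k}. (LINT y|?LQ. \<bar>m i (x + r *\<^sub>R y) - m i x\<bar>) < 1 / real (Suc k)"
          by (intro eventually_ball_finite) auto
        with eventually_cube_subset[OF \<Omega> x] eventually_at_right_less[of 0]
        have "\<forall>\<^sub>F r in at_right 0. 0 < r \<and> cube x r \<subseteq> \<Omega> \<and> (\<forall>i\<le>k. (LINT y|?LQ. \<bar>m i (x + r *\<^sub>R y) - m i x\<bar>) < 1 / real (Suc k))"
          by eventually_elim auto
        then show ?thesis by (rule eventually_happens'[rotated]) simp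
      qed
      then obtain r where r: "\<And>k. 0 < r k" "\<And>k. cube x (r k) \<subseteq> \<Omega>"
        "\<And>k i. i \<le> k \<Longrightarrow> (LINT y|?LQ. \<bar>m i (x + r k *\<^sub>R y) - m i x\<bar>) < 1 / real (Suc k)" by metis
      have aff: "(\<lambda>y. x + t *\<^sub>R y) \<in> borel_measurable borel" for t by measurable
      have mr [measurable]: "(\<lambda>y. m i (x + t *\<^sub>R y)) \<in> borel_measurable borel" for i t
        by (rule measurable_compose[OF aff m(1)])
      have sr [measurable]: "(\<lambda>y. s j (x + t *\<^sub>R y)) \<in> borel_measurable borel" for j t
        by (rule measurable_compose[OF aff s])
      have iQ: "integrable ?LQ (\<lambda>y. a y * indicator (E n) y)" if "a \<in> borel_measurable borel" "\<And>y. \<bar>a y\<bar> \<le> 1" for a :: "real ^ 'n \<Rightarrow> real" and n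
        by (rule integrable_cube_bounded[where C=1]) (use that in \<open>auto simp: indicator_def intro!: borel_lebesgue_on\<close>)
      have spow: "\<bar>s j y ^ i\<bar> \<le> 1" for j y i using s01[of j y] by (simp add: power_le_one)
      have ex_j: "\<exists>j. \<forall>i\<le>k. \<forall>n\<le>k. \<bar>LINT y|?LQ. (s j (x + r k *\<^sub>R y) ^ i - m i (x + r k *\<^sub>R y)) * indicator (E n) y\<bar> < 1 / real (Suc k)" for k
      proof -
        have "(\<lambda>j. LINT y|?LQ. (s j (x + r k *\<^sub>R y) ^ i - m i (x + r k *\<^sub>R y)) * indicator (E n) y) \<longlonglongrightarrow> 0" for i n
        proof -
          \<comment> \<open>testing with \<open>E n\<close> on the unit cube is testing with the indicator function of a small copy of \<open>E n\<close>\<close>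
          define h where "h w = indicator (cube x (r k)) w * indicator (E n) ((1 / r k) *\<^sub>R (w - x)) * (1 :: real)" for w :: "real ^ 'n"
          have hm [measurable]: "h \<in> borel_measurable borel" unfolding h_def[abs_def] by measurable
          have hint: "integrable (lebesgue_on \<Omega>) h"
          proof (subst integral_lebesgue_on_borel(2)[OF \<Omega>b hm])
            show "integrable lborel (\<lambda>w. indicator \<Omega> w *\<^sub>R h w)"
            proof (rule integrable_bounded_compact_support[where B=1 and a=x and b="x + r k *\<^sub>R One"])
              show "indicator \<Omega> w *\<^sub>R h w = 0" if "w \<notin> cbox x (x + r k *\<^sub>R One)" for w
              proof -
                have "w \<notin> cube x (r k)" using that box_subset_cbox by (auto simp: cube_def)
                then show ?thesis by (simp add: h_def)
              qed
            qed (auto simp: h_def indicator_def)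
          qed
          have back_eq: "(1 / r k) *\<^sub>R ((x + r k *\<^sub>R y) - x) = y" for y using r(1)[of k] by simp
          have trans: "(LINT w|lebesgue_on \<Omega>. a w * h w) = r k ^ CARD('n) * (LINT y|?LQ. a (x + r k *\<^sub>R y) * indicator (E n) y)"
            if [measurable]: "a \<in> borel_measurable borel" for a :: "real ^ 'n \<Rightarrow> real"
          proof -
            have "(LINT w|lebesgue_on \<Omega>. a w * h w) = r k ^ DIM(real ^ 'n) * (LINT y|?LQ. a (x + r k *\<^sub>R y) * h (x + r k *\<^sub>R y))"
              by (rule integral_supported_in_cube[OF \<Omega> _ r(1) r(2)]) (auto simp: h_def)
            also have "(LINT y|?LQ. a (x + r k *\<^sub>R y) * h (x + r k *\<^sub>R y)) = (LINT y|?LQ. a (x + r k *\<^sub>R y) * indicator (E n) y)"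
            proof (rule Bochner_Integration.integral_cong)
              fix y assume "y \<in> space ?LQ"
              then have "x + r k *\<^sub>R y \<in> cube x (r k)" using mem_cube_affine[OF r(1)[of k], of x y] by simp
              then show "a (x + r k *\<^sub>R y) * h (x + r k *\<^sub>R y) = a (x + r k *\<^sub>R y) * indicator (E n) y"
                unfolding h_def back_eq by simp
            qed simp
            finally show ?thesis by simp
          qed
          have "(\<lambda>j. LINT w|lebesgue_on \<Omega>. s j w ^ i * h w) \<longlonglongrightarrow> (LINT w|lebesgue_on \<Omega>. m i w * h w)"
            using lim[OF hint, of i] by (simp only: s_def)
          then have "(\<lambda>j. r k ^ CARD('n) * (LINT y|?LQ. s j (x + r k *\<^sub>R y) ^ i * indicator (E n) y))
            \<longlonglongrightarrow> r k ^ CARD('n) * (LINT y|?LQ. m i (x + r k *\<^sub>R y) * indicator (E n) y)"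
            using trans[OF m(1), of i] trans[OF borel_measurable_power[OF s]] by simp
          then have "(\<lambda>j. (LINT y|?LQ. s j (x + r k *\<^sub>R y) ^ i * indicator (E n) y))
            \<longlonglongrightarrow> (LINT y|?LQ. m i (x + r k *\<^sub>R y) * indicator (E n) y)"
            using tendsto_mult_left_iff[of "r k ^ CARD('n)"] r(1)[of k] by simp
          moreover have "(LINT y|?LQ. (s j (x + r k *\<^sub>R y) ^ i - m i (x + r k *\<^sub>R y)) * indicator (E n) y)
            = (LINT y|?LQ. s j (x + r k *\<^sub>R y) ^ i * indicator (E n) y) - (LINT y|?LQ. m i (x + r k *\<^sub>R y) * indicator (E n) y)" for j
            unfolding left_diff_distrib
            by (rule Bochner_Integration.integral_diff[OF iQ iQ]) (use spow mabs in simp_all)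
          ultimately show ?thesis by (simp add: LIM_zero_iff)
        qed
        then have "\<forall>\<^sub>F j in sequentially. \<bar>LINT y|?LQ. (s j (x + r k *\<^sub>R y) ^ i - m i (x + r k *\<^sub>R y)) * indicator (E n) y\<bar> < 1 / real (Suc k)" for i n
          by (intro order_tendstoD(2)[of _ 0] tendsto_rabs_zero) auto
        then have "\<forall>\<^sub>F j in sequentially. \<forall>i\<in>{..k}. \<forall>n\<in>{..k}.
            \<bar>LINT y|?LQ. (s j (x + r k *\<^sub>R y) ^ i - m i (x + r k *\<^sub>R y)) * indicator (E n) y\<bar> < 1 / real (Suc k)"
          by (intro eventually_ball_finite ballI) auto
        then obtain j where "\<forall>i\<in>{..k}. \<forall>n\<in>{..k}.
            \<bar>LINT y|?LQ. (s j (x + r k *\<^sub>R y) ^ i - m i (x + r k *\<^sub>R y)) * indicator (E n) y\<bar> < 1 / real (Suc k)"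
          using eventually_happens'[OF trivial_limit_sequentially] by blast
        then show ?thesis by auto
      qed
      have "\<forall>k. \<exists>j. \<forall>i\<le>k. \<forall>n\<le>k. \<bar>LINT y|?LQ. (s j (x + r k *\<^sub>R y) ^ i - m i (x + r k *\<^sub>R y)) * indicator (E n) y\<bar> < 1 / real (Suc k)"
        by (intro allI ex_j)
      from choice[OF this] obtain j where
        "\<forall>k. \<forall>i\<le>k. \<forall>n\<le>k. \<bar>LINT y|?LQ. (s (j k) (x + r k *\<^sub>R y) ^ i - m i (x + r k *\<^sub>R y)) * indicator (E n) y\<bar> < 1 / real (Suc k)"
        by (elim exE)
      then have j: "\<And>k i n. i \<le> k \<Longrightarrow> n \<le> k \<Longrightarrow>
        \<bar>LINT y|?LQ. (s (j k) (x + r k *\<^sub>R y) ^ i - m i (x + r k *\<^sub>R y)) * indicator (E n) y\<bar> < 1 / real (Suc k)"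
        by simp
      define g where "g k y = s (j k) (x + r k *\<^sub>R y)" for k y
      have gm [measurable]: "g k \<in> borel_measurable borel" for k unfolding g_def[abs_def] by measurable
      have g01: "0 \<le> g k y \<and> g k y \<le> 1" for k y using s01 by (simp add: g_def)
      have gpow: "\<bar>g k y ^ i\<bar> \<le> 1" for k y i using g01[of k y] by (simp add: power_le_one)
      have gLQ: "g k \<in> borel_measurable ?LQ" for k by (rule borel_lebesgue_on[OF gm])
      have glim: "(\<lambda>k. LINT y|?LQ. g k y ^ i * h y) \<longlonglongrightarrow> (LINT y|?LQ. m i x * h y)" if h: "integrable ?LQ h" for i h
      proof -
        have "(\<lambda>k. LINT y|?LQ. (g k y ^ i - m i x) * h y) \<longlonglongrightarrow> 0"
        proof (rule Q.weakstar_null_of_dense_sets[where K=1 and E=E])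
          show "(\<lambda>y. g k y ^ i - m i x) \<in> borel_measurable ?LQ" for k using gLQ by measurable
          show "\<bar>g k y ^ i - m i x\<bar> \<le> 1" for k y
            using g01[of k y] m(2)[of i x] zero_le_power[of "g k y" i] power_le_one[of "g k y" i] by linarith
          show "E n \<inter> space ?LQ \<in> sets ?LQ" for n
            using Eb[of n] by (auto simp: sets_restrict_space)
          show "\<exists>n. measure ?LQ (A - E n \<union> (space ?LQ \<inter> E n - A)) < e" if "A \<in> sets ?LQ" "0 < e" for A e
            using E(2)[OF that] by simp
          fix n
          have bd: "norm (LINT y|?LQ. (g k y ^ i - m i x) * indicator (E n) y) \<le> 2 * (1 / real (Suc k))" if k: "max i n \<le> k" for k
          proof -
            let ?m = "\<lambda>y. m i (x + r k *\<^sub>R y)"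
            have i1: "integrable ?LQ (\<lambda>y. (g k y ^ i - ?m y) * indicator (E n) y)"
            proof (rule iQ)
              show "\<bar>g k y ^ i - ?m y\<bar> \<le> 1" for y
                using g01[of k y] m(2)[of i "x + r k *\<^sub>R y"] zero_le_power[of "g k y" i] power_le_one[of "g k y" i] by linarith
            qed measurable
            have dm: "\<bar>?m y - m i x\<bar> \<le> 1" for y using m(2)[of i "x + r k *\<^sub>R y"] m(2)[of i x] by linarith
            have i2: "integrable ?LQ (\<lambda>y. (?m y - m i x) * indicator (E n) y)" by (rule iQ[OF _ dm]) measurable
            have i3: "integrable ?LQ (\<lambda>y. \<bar>?m y - m i x\<bar>)"
              by (rule integrable_cube_bounded[where C=1]) (use dm in auto)
            have "(LINT y|?LQ. (g k y ^ i - m i x) * indicator (E n) y)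
              = (LINT y|?LQ. (g k y ^ i - ?m y) * indicator (E n) y + (?m y - m i x) * indicator (E n) y)"
              by (rule Bochner_Integration.integral_cong) (simp_all add: algebra_simps)
            also have "\<dots> = (LINT y|?LQ. (g k y ^ i - ?m y) * indicator (E n) y) + (LINT y|?LQ. (?m y - m i x) * indicator (E n) y)"
              by (rule Bochner_Integration.integral_add[OF i1 i2])
            finally have eq: "(LINT y|?LQ. (g k y ^ i - m i x) * indicator (E n) y)
              = (LINT y|?LQ. (g k y ^ i - ?m y) * indicator (E n) y) + (LINT y|?LQ. (?m y - m i x) * indicator (E n) y)" .
            have "\<bar>LINT y|?LQ. (?m y - m i x) * indicator (E n) y\<bar> \<le> (LINT y|?LQ. \<bar>(?m y - m i x) * indicator (E n) y\<bar>)"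
              by (rule integral_abs_bound)
            also have "\<dots> \<le> (LINT y|?LQ. \<bar>?m y - m i x\<bar>)"
              by (rule integral_mono[OF integrable_abs[OF i2] i3]) (auto simp: indicator_def)
            finally have "\<bar>LINT y|?LQ. (?m y - m i x) * indicator (E n) y\<bar> < 1 / real (Suc k)"
              using r(3)[of i k] k by simp
            moreover have "\<bar>LINT y|?LQ. (g k y ^ i - ?m y) * indicator (E n) y\<bar> < 1 / real (Suc k)"
              using j[of i k n] k by (simp add: g_def)
            ultimately show ?thesis unfolding eq real_norm_def by linarith
          qed
          have lim0: "(\<lambda>k. 2 * (1 / real (Suc k))) \<longlonglongrightarrow> 0"
            by (rule tendsto_mult_right_zero[OF LIMSEQ_Suc[OF lim_1_over_n]])
          have "\<forall>\<^sub>F k in sequentially. norm (LINT y|?LQ. (g k y ^ i - m i x) * indicator (E n) y) \<le> 2 * (1 / real (Suc k))"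
            using bd by (intro eventually_sequentiallyI[of "max i n"])
          then show "(\<lambda>k. LINT y|?LQ. (g k y ^ i - m i x) * indicator (E n) y) \<longlonglongrightarrow> 0"
            by (rule Lim_null_comparison[OF _ lim0])
        qed (rule h)
        moreover have "(LINT y|?LQ. (g k y ^ i - m i x) * h y) = (LINT y|?LQ. g k y ^ i * h y) - (LINT y|?LQ. m i x * h y)" for k
          unfolding left_diff_distrib
          by (rule Bochner_Integration.integral_diff[OF Q.integrable_bounded_mult[OF _ gpow h] integrable_mult_right[OF h]]) (use gLQ in measurable)
        ultimately show ?thesis by (simp add: LIM_zero_iff)
      qed
      have mlim: "(\<lambda>k. LINT y|?LQ. g k y ^ i) \<longlonglongrightarrow> m i x" for i
        using glim[of "\<lambda>y. 1" i] Q.prob_space by simp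
      obtain lam where lam: "prob_space lam" "sets lam = sets borel" "AE t in lam. 0 \<le> t \<and> t \<le> 1"
        "\<And>i. (LINT t|lam. t ^ i) = m i x"
        by (rule moment_limit_measure[OF prob_space_cube gLQ g01 mlim]) (rule that)
      interpret lam: prob_space lam by fact
      have decm: "dec \<in> borel_measurable borel" using dec by (rule borel_measurable_continuous_onI)
      then have declam: "dec \<in> lam \<rightarrow>\<^sub>M borel" using lam(2) measurable_cong_sets by blast
      have ex_w: "\<exists>w. w \<in> W1inf ?Q \<and> (AE y in ?LQ. weak_gradient ?Q w y = z (j k) (x + r k *\<^sub>R y)) \<and>
          (AE y in ?LQ. norm (w y) \<le> CARD('d) * (CARD('n) * M / bump_mass TYPE('n)))" for k
        by (rule blow_up_W1inf[OF \<Omega> wg[of "j k"] u(1)[of "j k"] u(2)[of "j k"] z(1)[of "j k"] z(2)[of "j k"] r(1)[of k] r(2)[of k]]) blast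
      have "\<forall>k. \<exists>w. w \<in> W1inf ?Q \<and> (AE y in ?LQ. weak_gradient ?Q w y = z (j k) (x + r k *\<^sub>R y)) \<and>
          (AE y in ?LQ. norm (w y) \<le> CARD('d) * (CARD('n) * M / bump_mass TYPE('n)))"
        by (intro allI ex_w)
      from choice[OF this] obtain w where
        "\<forall>k. w k \<in> W1inf ?Q \<and> (AE y in ?LQ. weak_gradient ?Q (w k) y = z (j k) (x + r k *\<^sub>R y)) \<and>
          (AE y in ?LQ. norm (w k y) \<le> CARD('d) * (CARD('n) * M / bump_mass TYPE('n)))" by (elim exE)
      then have w: "\<And>k. w k \<in> W1inf ?Q" "\<And>k. AE y in ?LQ. weak_gradient ?Q (w k) y = z (j k) (x + r k *\<^sub>R y)"
          "\<And>k. AE y in ?LQ. norm (w k y) \<le> CARD('d) * (CARD('n) * M / bump_mass TYPE('n))" by simp_all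
      have bs: "W1inf_bounded_sequence ?Q w"
        unfolding W1inf_bounded_sequence_def
      proof (intro conjI allI w(1))
        let ?C = "max M (CARD('d) * (CARD('n) * M / bump_mass TYPE('n)))"
        show "\<exists>C. \<forall>k. AE y in ?LQ. norm (w k y) \<le> C \<and> norm (weak_gradient ?Q (w k) y) \<le> C"
        proof (intro exI[of _ ?C] allI)
          fix k
          show "AE y in ?LQ. norm (w k y) \<le> ?C \<and> norm (weak_gradient ?Q (w k) y) \<le> ?C"
            using w(2)[of k] w(3)[of k]
          proof eventually_elim
            case (elim y)
            have "norm (weak_gradient ?Q (w k) y) \<le> M" using elim(1) z(2)[of "j k" "x + r k *\<^sub>R y"] by simp
            with elim(2) show ?case by (simp add: max.coboundedI1 max.coboundedI2)
          qed
        qed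
      qed
      have gen: "generates ?Q (\<lambda>k. weak_gradient ?Q (w k)) (\<lambda>_. distr lam borel dec)"
        unfolding generates_def
      proof (intro conjI allI ballI impI)
        show "weak_gradient ?Q (w k) \<in> borel_measurable ?LQ" for k by (rule borel_measurable_gradient[OF w(1)])
        fix h :: "real ^ 'n \<Rightarrow> real" and \<phi> :: "real ^ 'n ^ 'd \<Rightarrow> real"
        assume \<phi>: "\<phi> \<in> C_0" and h: "integrable ?LQ h"
        have \<phi>c: "continuous_on UNIV \<phi>" using \<phi> by (simp add: C_0_def)
        have \<phi>m: "\<phi> \<in> borel_measurable borel" using \<phi>c by (rule borel_measurable_continuous_onI)
        have \<psi>: "continuous_on UNIV (\<lambda>t. \<phi> (dec t))" by (rule continuous_on_compose2[OF \<phi>c dec]) simp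
        have \<Lambda>: "AE y in ?LQ. prob_space lam \<and> sets lam = sets borel \<and> (AE t in lam. 0 \<le> t \<and> t \<le> 1) \<and> (\<forall>i. (LINT t|lam. t ^ i) = m i x)"
          using lam by simp
        obtain \<Psi> K where \<Psi>: "\<Psi> \<in> borel_measurable ?LQ" "AE y in ?LQ. \<Psi> y = (LINT t|lam. \<phi> (dec t))"
          "(\<lambda>k. LINT y|?LQ. \<phi> (dec (g k y)) * h y) \<longlonglongrightarrow> (LINT y|?LQ. \<Psi> y * h y)"
          by (rule Q.weakstar_limit_of_moments[of g "\<lambda>i y. m i x" "\<lambda>y. lam" "\<lambda>t. \<phi> (dec t)", OF gLQ g01 _ mabs glim \<Lambda> \<psi>]) (use h in auto)
        have 1: "(LINT y|?LQ. h y * \<phi> (weak_gradient ?Q (w k) y)) = (LINT y|?LQ. \<phi> (dec (g k y)) * h y)" for k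
        proof (rule integral_cong_AE)
          show "(\<lambda>y. h y * \<phi> (weak_gradient ?Q (w k) y)) \<in> borel_measurable ?LQ"
            using h measurable_compose[OF borel_measurable_gradient[OF w(1)] \<phi>m] by measurable
          show "(\<lambda>y. \<phi> (dec (g k y)) * h y) \<in> borel_measurable ?LQ"
            using h measurable_compose[OF gLQ measurable_compose[OF decm \<phi>m]] by measurable
          show "AE y in ?LQ. h y * \<phi> (weak_gradient ?Q (w k) y) = \<phi> (dec (g k y)) * h y"
            using w(2)[of k] by eventually_elim (simp add: g_def s_def code(3)[OF z(2)])
        qed
        have 2: "(LINT y|?LQ. \<Psi> y * h y) = (LINT y|?LQ. h y * (LINT \<xi>|distr lam borel dec. \<phi> \<xi>))"
        proof (rule integral_cong_AE)
          have eq: "(LINT \<xi>|distr lam borel dec. \<phi> \<xi>) = (LINT t|lam. \<phi> (dec t))" by (rule integral_distr[OF declam \<phi>m])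
          show "AE y in ?LQ. \<Psi> y * h y = h y * (LINT \<xi>|distr lam borel dec. \<phi> \<xi>)"
            using \<Psi>(2) by eventually_elim (simp add: eq)
        qed (use \<Psi>(1) h in measurable)
        show "(\<lambda>k. LINT y|?LQ. h y * \<phi> (weak_gradient ?Q (w k) y))
          \<longlonglongrightarrow> (LINT y|?LQ. h y * (LINT \<xi>|distr lam borel dec. \<phi> \<xi>))"
          unfolding 1 2[symmetric] by (rule \<Psi>(3))
      qed
      have pd: "prob_space (distr lam borel dec)" by (rule lam.prob_space_distr[OF declam])
      have ym: "young_measure ?Q (\<lambda>_. distr lam borel dec)" unfolding young_measure_def using pd by simp
      have "homogeneous_W1inf_gradient_young_measure (distr lam borel dec)"
        unfolding homogeneous_W1inf_gradient_young_measure_def W1inf_gradient_young_measure_def unit_cube_eq_cube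
        using pd ym bs gen by (intro conjI exI[of _ w]) auto
      then show "\<exists>lam. prob_space lam \<and> sets lam = sets borel \<and> (AE t in lam. 0 \<le> t \<and> t \<le> 1) \<and>
        (\<forall>i. (LINT t|lam. t ^ i) = m i x) \<and> homogeneous_W1inf_gradient_young_measure (distr lam borel dec)"
        using lam by blast
    qed
  qed
qed

section \<open>Gradient Young measures of weakly* convergent sequences\<close>

lemma choice_of_all_ex: "(\<And>j. \<exists>y. P j y) \<Longrightarrow> \<exists>f. \<forall>j. P j (f j)"
  by metis

text \<open>
  The conclusion contains, besides the measures \<open>\<nu> x\<close>, Borel representatives \<open>z k\<close> of the
  gradients. For every continuous \<open>\<phi>\<close> it gives the weak* limit \<open>\<Psi>\<close> of \<open>\<phi> (z k)\<close>, which is almost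
  everywhere the integral of \<open>\<phi>\<close> with respect to \<open>\<nu> x\<close>; arbitrary continuous functions are admissible because
  the matrices remain in a fixed ball.
\<close>

theorem gradient_young_measure_exists:
  fixes \<Omega> :: "(real ^ 'n) set" and u :: "nat \<Rightarrow> real ^ 'n \<Rightarrow> real ^ 'd" and v :: "real ^ 'n \<Rightarrow> real ^ 'd"
  assumes \<Omega>: "open \<Omega>" "bounded \<Omega>" and u: "\<And>j. u j \<in> W1inf \<Omega>" and v: "v \<in> W1inf \<Omega>"
    and lim: "Linf_weakstar_tendsto \<Omega> (\<lambda>j. weak_gradient \<Omega> (u j)) (weak_gradient \<Omega> v)"
  obtains q :: "nat \<Rightarrow> nat" and z :: "nat \<Rightarrow> real ^ 'n \<Rightarrow> real ^ 'n ^ 'd" and \<nu> :: "real ^ 'n \<Rightarrow> (real ^ 'n ^ 'd) measure"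
  where "strict_mono q" "\<And>k. z k \<in> borel_measurable borel"
    "\<And>k. AE x in lebesgue_on \<Omega>. z k x = weak_gradient \<Omega> (u (q k)) x"
    "AE x in lebesgue_on \<Omega>. homogeneous_W1inf_gradient_young_measure (\<nu> x)"
    "AE x in lebesgue_on \<Omega>. barycenter (\<nu> x) = weak_gradient \<Omega> v x"
    "\<And>\<phi> :: real ^ 'n ^ 'd \<Rightarrow> real. continuous_on UNIV \<phi> \<Longrightarrow> \<exists>\<Psi> C. \<Psi> \<in> borel_measurable (lebesgue_on \<Omega>) \<and> (\<forall>x. \<bar>\<Psi> x\<bar> \<le> C) \<and>
      (\<forall>k x. \<bar>\<phi> (z k x)\<bar> \<le> C) \<and> (AE x in lebesgue_on \<Omega>. integrable (\<nu> x) \<phi> \<and> \<Psi> x = (LINT \<xi>|\<nu> x. \<phi> \<xi>)) \<and>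
      (\<forall>h. integrable (lebesgue_on \<Omega>) h \<longrightarrow>
        (\<lambda>k. LINT x|lebesgue_on \<Omega>. \<phi> (z k x) * h x) \<longlonglongrightarrow> (LINT x|lebesgue_on \<Omega>. \<Psi> x * h x))"
proof -
  let ?L = "lebesgue_on \<Omega>"
  have \<Omega>b [measurable]: "\<Omega> \<in> sets borel" using \<Omega> by simp
  have \<Omega>l: "\<Omega> \<in> sets lebesgue" using \<Omega>b by simp
  interpret L: finite_measure ?L by (rule finite_measure_lebesgue_on_open_bounded[OF \<Omega>])
  have wg: "has_weak_gradient \<Omega> w (weak_gradient \<Omega> w)" if w: "w \<in> W1inf \<Omega>" for w :: "real ^ 'n \<Rightarrow> real ^ 'd"
  proof -
    obtain y where "has_weak_gradient \<Omega> w y" using w by (auto simp: W1inf_def)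
    then show ?thesis by (rule has_weak_gradient_weak_gradient)
  qed
  have GL: "weak_gradient \<Omega> w \<in> Linf \<Omega>" if "w \<in> W1inf \<Omega>" for w :: "real ^ 'n \<Rightarrow> real ^ 'd"
    using wg[OF that] by (simp add: has_weak_gradient_def)
  obtain M0 where "\<forall>j. AE x in ?L. norm (weak_gradient \<Omega> (u j) x) \<le> M0"
    using Linf_weakstar_convergent_bounded[OF L.finite_measure_axioms GL[OF u] lim] by blast
  then have M0: "AE x in ?L. norm (weak_gradient \<Omega> (u j) x) \<le> M0" for j by blast
  define M where "M = max M0 0"
  have M: "AE x in ?L. norm (weak_gradient \<Omega> (u j) x) \<le> M" for j
    using M0[of j] by eventually_elim (simp add: M_def)
  have M_nn: "0 \<le> M" by (simp add: M_def)
  have "\<exists>y. y \<in> borel_measurable borel \<and> (\<forall>x. norm (y x) \<le> M) \<and> (AE x in ?L. y x = weak_gradient \<Omega> (u j) x)" for j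
    by (rule Linf_borel_representative[OF GL[OF u] \<Omega>b M[of j] M_nn]) blast
  then have "\<exists>z. \<forall>j. z j \<in> borel_measurable borel \<and> (\<forall>x. norm (z j x) \<le> M) \<and> (AE x in ?L. z j x = weak_gradient \<Omega> (u j) x)"
    by (rule choice_of_all_ex)
  then obtain z0 where z0_all: "\<forall>j. z0 j \<in> borel_measurable borel \<and> (\<forall>x. norm (z0 j x) \<le> M) \<and>
      (AE x in ?L. z0 j x = weak_gradient \<Omega> (u j) x)" by (elim exE)
  have z0: "\<And>j. z0 j \<in> borel_measurable borel" "\<And>j x. norm (z0 j x) \<le> M"
      "\<And>j. AE x in ?L. z0 j x = weak_gradient \<Omega> (u j) x" using z0_all by simp_all
  have uL: "u j \<in> Linf \<Omega>" for j using u[of j] by (simp add: W1inf_def)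
  have "\<exists>w. w \<in> borel_measurable borel \<and> (\<exists>C. \<forall>x. norm (w x) \<le> C) \<and> (AE x in ?L. w x = u j x)" for j
  proof -
    obtain C where "AE x in ?L. norm (u j x) \<le> C" using uL[of j] by (auto simp: Linf_def)
    then have C: "AE x in ?L. norm (u j x) \<le> max C 0" by eventually_elim (rule max.coboundedI1)
    show ?thesis by (rule Linf_borel_representative[OF uL \<Omega>b C max.cobounded2]) blast
  qed
  then have "\<exists>w. \<forall>j. w j \<in> borel_measurable borel \<and> (\<exists>C. \<forall>x. norm (w j x) \<le> C) \<and> (AE x in ?L. w j x = u j x)"
    by (rule choice_of_all_ex)
  then obtain u0 where u0_all: "\<forall>j. u0 j \<in> borel_measurable borel \<and> (\<exists>C. \<forall>x. norm (u0 j x) \<le> C) \<and>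
      (AE x in ?L. u0 j x = u j x)" by (elim exE)
  have u0: "\<And>j. u0 j \<in> borel_measurable borel" "\<And>j. \<exists>C. \<forall>x. norm (u0 j x) \<le> C"
      "\<And>j. AE x in ?L. u0 j x = u j x" using u0_all by simp_all
  from choice_of_all_ex[of "\<lambda>j C. \<forall>x. norm (u0 j x) \<le> C", OF u0(2)]
  obtain C0 where C0_all: "\<forall>j x. norm (u0 j x) \<le> C0 j" by (elim exE)
  have C0: "\<And>j x. norm (u0 j x) \<le> C0 j" using C0_all by simp
  have um: "u j \<in> borel_measurable ?L" for j using uL[of j] by (simp add: Linf_def)
  have wg0: "has_weak_gradient \<Omega> (u0 j) (z0 j)" for j
    by (rule has_weak_gradient_cong_AE[OF wg[OF u] um borel_lebesgue_on[OF u0(1)] u0(3) borel_lebesgue_on[OF z0(1)] z0(3)])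
  obtain dec :: "real \<Rightarrow> real ^ 'n ^ 'd" where dec: "continuous_on UNIV dec" "cball 0 M \<subseteq> dec ` {0..1}"
    by (rule continuous_curve_through_ball[of M]) (rule that)
  obtain code :: "real ^ 'n ^ 'd \<Rightarrow> real" where code: "code \<in> borel_measurable borel"
    "\<And>x. 0 \<le> code x \<and> code x \<le> 1" "\<And>x. x \<in> dec ` {0..1} \<Longrightarrow> dec (code x) = x"
    by (rule borel_section_of_continuous_image[OF dec(1)]) (rule that)
  have code_inv: "dec (code \<xi>) = \<xi>" if "norm \<xi> \<le> M" for \<xi>
    using code(3)[of \<xi>] dec(2) that by auto
  define s where "s j x = code (z0 j x)" for j x
  have sm: "s j \<in> borel_measurable ?L" for j
    unfolding s_def[abs_def] by (rule borel_lebesgue_on[OF measurable_compose[OF z0(1) code(1)]])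
  have s01: "0 \<le> s j x \<and> s j x \<le> 1" for j x using code(2) by (simp add: s_def)
  obtain q m0 where q: "strict_mono q" and m0: "\<And>i. m0 i \<in> borel_measurable ?L" "\<And>i x. 0 \<le> m0 i x" "\<And>i x. m0 i x \<le> 1"
    "\<And>i h. integrable ?L h \<Longrightarrow> (\<lambda>j. LINT x|?L. s (q j) x ^ i * h x) \<longlonglongrightarrow> (LINT x|?L. m0 i x * h x)"
  proof (rule weakstar_compactness[OF \<Omega>l L.finite_measure_axioms, of "\<lambda>i j x. s j x ^ i"])
    show "(\<lambda>x. s j x ^ i) \<in> borel_measurable ?L" for i j using sm by measurable
    show "0 \<le> s j x ^ i" "s j x ^ i \<le> 1" for i j x using s01[of j x] by (simp_all add: power_le_one)
  qed (rule that)
  have "\<exists>y. y \<in> borel_measurable borel \<and> (\<forall>x. norm (y x) \<le> 1) \<and> (AE x in ?L. y x = m0 i x)" for i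
  proof -
    have n: "norm (m0 i x) \<le> 1" for x using m0(2,3)[of i x] by simp
    then have mL: "m0 i \<in> Linf \<Omega>" unfolding Linf_def using m0(1) by blast
    have b: "AE x in ?L. norm (m0 i x) \<le> 1" using n by simp
    show ?thesis by (rule Linf_borel_representative[OF mL \<Omega>b b zero_le_one]) blast
  qed
  then have "\<exists>y. \<forall>i. y i \<in> borel_measurable borel \<and> (\<forall>x. norm (y i x) \<le> 1) \<and> (AE x in ?L. y i x = m0 i x)"
    by (rule choice_of_all_ex)
  then obtain m1 where m1_all: "\<forall>i. m1 i \<in> borel_measurable borel \<and> (\<forall>x. norm (m1 i x) \<le> 1) \<and>
      (AE x in ?L. m1 i x = m0 i x)" by (elim exE)
  have m1: "\<And>i. m1 i \<in> borel_measurable borel" "\<And>i x. norm (m1 i x) \<le> (1::real)"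
      "\<And>i. AE x in ?L. m1 i x = m0 i x" using m1_all by simp_all
  \<comment> \<open>a Borel representative of \<open>m0\<close> with values in the unit interval at every point\<close>
  define m where "m i x = max 0 (m1 i x)" for i x
  have mm: "m i \<in> borel_measurable borel" for i unfolding m_def[abs_def] using m1(1) by measurable
  have m01: "0 \<le> m i x \<and> m i x \<le> 1" for i x using m1(2)[of i x] by (auto simp: m_def)
  have m_eq: "AE x in ?L. m i x = m0 i x" for i
    using m1(3)[of i] by eventually_elim (use m0(2) in \<open>simp add: m_def\<close>)
  have slim: "(\<lambda>j. LINT x|?L. s (q j) x ^ i * h x) \<longlonglongrightarrow> (LINT x|?L. m i x * h x)" if h: "integrable ?L h" for i h
  proof -
    have "(LINT x|?L. m i x * h x) = (LINT x|?L. m0 i x * h x)"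
    proof (rule integral_cong_AE)
      show "AE x in ?L. m i x * h x = m0 i x * h x" using m_eq[of i] by eventually_elim simp
    qed (use h m0(1) borel_lebesgue_on[OF mm] in measurable)
    then show ?thesis using m0(4)[OF h, of i] by simp
  qed
  define good where "good x lam \<longleftrightarrow> prob_space lam \<and> sets lam = sets borel \<and> (AE t in lam. 0 \<le> t \<and> t \<le> 1) \<and>
    (\<forall>i. (LINT t|lam. t ^ i) = m i x) \<and> homogeneous_W1inf_gradient_young_measure (distr lam borel dec)" for x lam
  have blow: "AE x in lborel. x \<in> \<Omega> \<longrightarrow> (\<exists>lam. good x lam)"
    unfolding good_def
  proof (rule blow_up_homogeneous_gradient_young_measure[OF \<Omega>(1), of "\<lambda>k. u0 (q k)" "\<lambda>k. z0 (q k)" "\<lambda>k. C0 (q k)" M dec code m])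
    show "(\<lambda>j. LINT x|?L. code (z0 (q j) x) ^ i * h x) \<longlonglongrightarrow> (LINT x|?L. m i x * h x)" if "integrable ?L h" for i h
      using slim[OF that, of i] by (simp only: s_def)
  qed (use wg0 u0(1) C0 z0 dec code code_inv mm m01 in simp_all)
  \<comment> \<open>a choice without regard to measurability: integrals with respect to \<open>\<Lambda> x\<close> only occur as values of weak* limits\<close>
  define \<Lambda> where "\<Lambda> x = (SOME lam. good x lam)" for x
  have "AE x in lborel. x \<in> \<Omega> \<longrightarrow> good x (\<Lambda> x)"
    using blow by eventually_elim (auto simp: \<Lambda>_def intro: someI)
  then have good: "AE x in ?L. good x (\<Lambda> x)" using AE_lebesgue_on_iff[OF \<Omega>b] by blast
  define \<nu> where "\<nu> x = distr (\<Lambda> x) borel dec" for x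
  have decm: "dec \<in> borel_measurable borel" using dec(1) by (rule borel_measurable_continuous_onI)
  have comp: "(LINT \<xi>|\<nu> x. \<phi> \<xi>) = (LINT t|\<Lambda> x. \<phi> (dec t)) \<and> integrable (\<nu> x) \<phi>"
    if gx: "good x (\<Lambda> x)" and \<phi>: "continuous_on UNIV \<phi>" for x and \<phi> :: "real ^ 'n ^ 'd \<Rightarrow> 'c::euclidean_space"
  proof -
    have sl: "sets (\<Lambda> x) = sets borel" and pl: "prob_space (\<Lambda> x)" and t01: "AE t in \<Lambda> x. 0 \<le> t \<and> t \<le> 1"
      using gx by (auto simp: good_def)
    interpret prob_space "\<Lambda> x" by fact
    have dm: "dec \<in> \<Lambda> x \<rightarrow>\<^sub>M borel" using decm measurable_cong_sets[OF sl refl] by blast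
    have \<phi>m: "\<phi> \<in> borel_measurable borel" using \<phi> by (rule borel_measurable_continuous_onI)
    have "compact ((\<lambda>t. \<phi> (dec t)) ` {0..1})"
      by (intro compact_continuous_image continuous_on_subset[OF continuous_on_compose2[OF \<phi> dec(1)]]) auto
    then obtain K where K: "\<forall>w\<in>(\<lambda>t. \<phi> (dec t)) ` {0..1}. norm w \<le> K" using compact_imp_bounded bounded_iff by blast
    have "integrable (\<Lambda> x) (\<lambda>t. \<phi> (dec t))"
    proof (rule integrable_const_bound)
      show "AE t in \<Lambda> x. norm (\<phi> (dec t)) \<le> K" using t01 by eventually_elim (use K in auto)
      show "(\<lambda>t. \<phi> (dec t)) \<in> borel_measurable (\<Lambda> x)" by (rule measurable_compose[OF dm \<phi>m])
    qed
    then show ?thesis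
      unfolding \<nu>_def using integral_distr[OF dm \<phi>m] integrable_distr_eq[OF dm \<phi>m] by blast
  qed
  have rep: "\<exists>\<Psi> C. \<Psi> \<in> borel_measurable ?L \<and> (\<forall>x. \<bar>\<Psi> x\<bar> \<le> C) \<and>
      (\<forall>k x. \<bar>\<phi> (z0 (q k) x)\<bar> \<le> C) \<and> (AE x in ?L. integrable (\<nu> x) \<phi> \<and> \<Psi> x = (LINT \<xi>|\<nu> x. \<phi> \<xi>)) \<and>
      (\<forall>h. integrable ?L h \<longrightarrow>
        (\<lambda>k. LINT x|?L. \<phi> (z0 (q k) x) * h x) \<longlonglongrightarrow> (LINT x|?L. \<Psi> x * h x))"
    if \<phi>: "continuous_on UNIV \<phi>" for \<phi> :: "real ^ 'n ^ 'd \<Rightarrow> real"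
  proof -
    have \<psi>: "continuous_on UNIV (\<lambda>t. \<phi> (dec t))" by (rule continuous_on_compose2[OF \<phi> dec(1)]) simp
    have mabs: "\<bar>m i x\<bar> \<le> 1" for i x using m01[of i x] by simp
    have \<Lambda>: "AE x in ?L. prob_space (\<Lambda> x) \<and> sets (\<Lambda> x) = sets borel \<and> (AE t in \<Lambda> x. 0 \<le> t \<and> t \<le> 1)
      \<and> (\<forall>i. (LINT t|\<Lambda> x. t ^ i) = m i x)"
      using good by eventually_elim (simp add: good_def)
    obtain \<Psi> C1 where \<Psi>: "\<Psi> \<in> borel_measurable ?L" "\<And>x. \<bar>\<Psi> x\<bar> \<le> C1" "AE x in ?L. \<Psi> x = (LINT t|\<Lambda> x. \<phi> (dec t))"
      "\<And>h. integrable ?L h \<Longrightarrow> (\<lambda>k. LINT x|?L. \<phi> (dec (s (q k) x)) * h x) \<longlonglongrightarrow> (LINT x|?L. \<Psi> x * h x)"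
      by (rule L.weakstar_limit_of_moments[of "\<lambda>k. s (q k)" m \<Lambda> "\<lambda>t. \<phi> (dec t)", OF sm s01 borel_lebesgue_on[OF mm] mabs slim \<Lambda> \<psi>]) (assumption, rule that)
    have dz: "dec (s j x) = z0 j x" for j x by (simp add: s_def code_inv z0(2))
    have "compact (\<phi> ` cball 0 M)" by (intro compact_continuous_image continuous_on_subset[OF \<phi>]) auto
    then obtain C2 where C2: "\<forall>w\<in>\<phi> ` cball 0 M. norm w \<le> C2" using compact_imp_bounded bounded_iff by blast
    have zb: "\<bar>\<phi> (z0 j x)\<bar> \<le> C2" for j x using C2 z0(2)[of j x] by auto
    have "AE x in ?L. integrable (\<nu> x) \<phi> \<and> \<Psi> x = (LINT \<xi>|\<nu> x. \<phi> \<xi>)"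
      using good \<Psi>(3) by eventually_elim (use comp[OF _ \<phi>] in simp)
    then show ?thesis
      using \<Psi>(1,2,4) zb unfolding dz
      by (intro exI[of _ \<Psi>] exI[of _ "max C1 C2"]) (auto intro: max.coboundedI1 max.coboundedI2)
  qed
  have bary: "AE x in ?L. barycenter (\<nu> x) = weak_gradient \<Omega> v x"
  proof -
    let ?G = "weak_gradient \<Omega> v"
    have Gm: "?G \<in> borel_measurable ?L" using GL[OF v] by (simp add: Linf_def)
    obtain K where K: "AE x in ?L. norm (?G x) \<le> K" using GL[OF v] by (auto simp: Linf_def)
    have "AE x in ?L. barycenter (\<nu> x) \<bullet> b = ?G x \<bullet> b" if b: "b \<in> Basis" for b
    proof -
      have \<phi>: "continuous_on UNIV (\<lambda>\<xi> :: real ^ 'n ^ 'd. \<xi> \<bullet> b)" by (intro continuous_intros)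
      obtain \<Psi> C where \<Psi>: "\<Psi> \<in> borel_measurable ?L" "\<And>x. \<bar>\<Psi> x\<bar> \<le> C"
        "AE x in ?L. integrable (\<nu> x) (\<lambda>\<xi>. \<xi> \<bullet> b) \<and> \<Psi> x = (LINT \<xi>|\<nu> x. \<xi> \<bullet> b)"
        "\<And>h. integrable ?L h \<Longrightarrow> (\<lambda>k. LINT x|?L. (z0 (q k) x \<bullet> b) * h x) \<longlonglongrightarrow> (LINT x|?L. \<Psi> x * h x)"
      proof -
        from rep[OF \<phi>] show ?thesis by (elim exE conjE) (rule that, blast+)
      qed
      have i\<Psi>: "integrable ?L \<Psi>" by (rule L.integrable_const_bound[where B=C]) (use \<Psi>(1,2) in auto)
      have Gbm: "(\<lambda>x. ?G x \<bullet> b) \<in> borel_measurable ?L" using Gm by measurable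
      have iG: "integrable ?L (\<lambda>x. ?G x \<bullet> b)"
      proof (rule L.integrable_const_bound[where B=K])
        show "AE x in ?L. norm (?G x \<bullet> b) \<le> K"
          using K by eventually_elim (use Basis_le_norm[OF b] order_trans in \<open>fastforce\<close>)
      qed (rule Gbm)
      have "AE x in ?L. \<Psi> x = ?G x \<bullet> b"
      proof (rule L.weakstar_limit_unique[OF i\<Psi> iG])
        fix h :: "real ^ 'n \<Rightarrow> real" assume h: "h \<in> borel_measurable ?L" "\<And>x. \<bar>h x\<bar> \<le> 1"
        have ih: "integrable ?L h" by (rule L.integrable_const_bound[where B=1]) (use h in auto)
        have "integrable ?L (\<lambda>x. h x *\<^sub>R b)" using ih by simp
        then have "(\<lambda>j. LINT x|?L. weak_gradient \<Omega> (u j) x \<bullet> (h x *\<^sub>R b)) \<longlonglongrightarrow> (LINT x|?L. ?G x \<bullet> (h x *\<^sub>R b))"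
          using lim unfolding Linf_weakstar_tendsto_def by blast
        from LIMSEQ_subseq_LIMSEQ[OF this q]
        have l1: "(\<lambda>k. LINT x|?L. weak_gradient \<Omega> (u (q k)) x \<bullet> (h x *\<^sub>R b)) \<longlonglongrightarrow> (LINT x|?L. ?G x \<bullet> (h x *\<^sub>R b))"
          by (simp only: comp_def)
        have e1: "(LINT x|?L. weak_gradient \<Omega> (u (q k)) x \<bullet> (h x *\<^sub>R b)) = (LINT x|?L. (z0 (q k) x \<bullet> b) * h x)" for k
        proof (rule integral_cong_AE)
          show "(\<lambda>x. weak_gradient \<Omega> (u (q k)) x \<bullet> (h x *\<^sub>R b)) \<in> borel_measurable ?L"
            using borel_measurable_gradient[OF u[of "q k"]] h(1) by measurable
          show "(\<lambda>x. (z0 (q k) x \<bullet> b) * h x) \<in> borel_measurable ?L"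
            using borel_lebesgue_on[OF z0(1)[of "q k"]] h(1) by measurable
          show "AE x in ?L. weak_gradient \<Omega> (u (q k)) x \<bullet> (h x *\<^sub>R b) = (z0 (q k) x \<bullet> b) * h x"
            using z0(3)[of "q k"] by eventually_elim simp
        qed
        have e2: "(LINT x|?L. ?G x \<bullet> (h x *\<^sub>R b)) = (LINT x|?L. (?G x \<bullet> b) * h x)"
          by (intro Bochner_Integration.integral_cong) simp_all
        show "(LINT x|?L. \<Psi> x * h x) = (LINT x|?L. (?G x \<bullet> b) * h x)"
          using LIMSEQ_unique[OF \<Psi>(4)[OF ih] l1[unfolded e1 e2]] .
      qed
      with \<Psi>(3) good show ?thesis
      proof eventually_elim
        case (elim x)
        have "integrable (\<nu> x) (\<lambda>\<xi>. \<xi>)" using comp[OF elim(2) continuous_on_id] by simp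
        then have "barycenter (\<nu> x) \<bullet> b = (LINT \<xi>|\<nu> x. \<xi> \<bullet> b)" unfolding barycenter_def by simp
        then show ?case using elim by simp
      qed
    qed
    then have "AE x in ?L. \<forall>b\<in>Basis. barycenter (\<nu> x) \<bullet> b = ?G x \<bullet> b"
      by (subst AE_finite_all) auto
    then show ?thesis by eventually_elim (rule euclidean_eqI, blast)
  qed
  show ?thesis
  proof (rule that[of q "\<lambda>k. z0 (q k)" \<nu>, OF q z0(1) z0(3) _ bary rep])
    show "AE x in ?L. homogeneous_W1inf_gradient_young_measure (\<nu> x)"
      using good by eventually_elim (simp add: good_def \<nu>_def)
  qed
qed

section \<open>Null sets of product spaces\<close>

lemma null_sets_lborel_Times:
  fixes N :: "'a::euclidean_space set"
  assumes "N \<in> null_sets lborel"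
  shows "N \<times> (UNIV :: 'b::euclidean_space set) \<in> null_sets lborel" "(UNIV :: 'b set) \<times> N \<in> null_sets lborel"
proof -
  have N: "N \<in> sets borel" "emeasure lborel N = 0" using assms by (auto simp: null_sets_def)
  have "emeasure (lborel \<Otimes>\<^sub>M lborel) (N \<times> (UNIV :: 'b set)) = 0"
    using N by (subst lborel.emeasure_pair_measure_Times) auto
  moreover have "emeasure (lborel \<Otimes>\<^sub>M lborel) ((UNIV :: 'b set) \<times> N) = 0"
    using N by (subst lborel.emeasure_pair_measure_Times) auto
  moreover have "N \<times> (UNIV :: 'b set) \<in> sets (lborel \<Otimes>\<^sub>M lborel)" "(UNIV :: 'b set) \<times> N \<in> sets (lborel \<Otimes>\<^sub>M lborel)"
    using N by auto
  ultimately show "N \<times> (UNIV :: 'b set) \<in> null_sets lborel" "(UNIV :: 'b set) \<times> N \<in> null_sets lborel"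
    unfolding lborel_prod by (auto simp: null_sets_def)
qed

text \<open>
  Preimages of Lebesgue sets under projections are Lebesgue sets, because the preimage of a null set is a
  null cylinder.
\<close>

lemma lebesgue_measurable_fst_snd:
  "fst \<in> (lebesgue :: ('a::euclidean_space \<times> 'b::euclidean_space) measure) \<rightarrow>\<^sub>M lebesgue"
  "snd \<in> (lebesgue :: ('a::euclidean_space \<times> 'b::euclidean_space) measure) \<rightarrow>\<^sub>M lebesgue"
proof -
  show "fst \<in> (lebesgue :: ('a \<times> 'b) measure) \<rightarrow>\<^sub>M (lebesgue :: 'a measure)"
  proof (rule completion.measurable_completion2)
    show m1: "fst \<in> (lebesgue :: ('a \<times> 'b) measure) \<rightarrow>\<^sub>M (lborel :: 'a measure)"
      by (rule measurable_completion) (simp add: borel_prod[symmetric])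
    show "null_sets lborel \<subseteq> null_sets (distr (lebesgue :: ('a \<times> 'b) measure) lborel fst)"
    proof
      fix N :: "'a set" assume N: "N \<in> null_sets lborel"
      have "fst -` N \<inter> space (lebesgue :: ('a \<times> 'b) measure) = N \<times> (UNIV :: 'b set)" by auto
      then have "fst -` N \<inter> space (lebesgue :: ('a \<times> 'b) measure) \<in> null_sets lebesgue"
        using null_sets_completionI[OF null_sets_lborel_Times(1)[OF N]] by simp
      then show "N \<in> null_sets (distr (lebesgue :: ('a \<times> 'b) measure) lborel fst)"
        using N by (subst null_sets_distr_iff[OF m1]) auto
    qed
  qed
  show "snd \<in> (lebesgue :: ('a \<times> 'b) measure) \<rightarrow>\<^sub>M (lebesgue :: 'b measure)"
  proof (rule completion.measurable_completion2)
    show m2: "snd \<in> (lebesgue :: ('a \<times> 'b) measure) \<rightarrow>\<^sub>M (lborel :: 'b measure)"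
      by (rule measurable_completion) (simp add: borel_prod[symmetric])
    show "null_sets lborel \<subseteq> null_sets (distr (lebesgue :: ('a \<times> 'b) measure) lborel snd)"
    proof
      fix N :: "'b set" assume N: "N \<in> null_sets lborel"
      have "snd -` N \<inter> space (lebesgue :: ('a \<times> 'b) measure) = (UNIV :: 'a set) \<times> N" by auto
      then have "snd -` N \<inter> space (lebesgue :: ('a \<times> 'b) measure) \<in> null_sets lebesgue"
        using null_sets_completionI[OF null_sets_lborel_Times(2)[OF N]] by simp
      then show "N \<in> null_sets (distr (lebesgue :: ('a \<times> 'b) measure) lborel snd)"
        using N by (subst null_sets_distr_iff[OF m2]) auto
    qed
  qed
qed

lemma lebesgue_on_measurable_fst_snd:
  "fst \<in> lebesgue_on (A \<times> B) \<rightarrow>\<^sub>M lebesgue_on (A :: 'a::euclidean_space set)"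
  "snd \<in> lebesgue_on (A \<times> B) \<rightarrow>\<^sub>M lebesgue_on (B :: 'b::euclidean_space set)"
  by (rule measurable_restrict_space2; use lebesgue_measurable_fst_snd in \<open>auto intro: measurable_restrict_space1\<close>)+

lemma AE_lebesgue_on_Times_of_factor:
  fixes \<Omega> :: "'a::euclidean_space set"
  assumes \<Omega>: "open \<Omega>" and P: "AE x in lebesgue_on \<Omega>. P x"
  shows "AE p in lebesgue_on (\<Omega> \<times> \<Omega>). P (fst p)" "AE p in lebesgue_on (\<Omega> \<times> \<Omega>). P (snd p)"
proof -
  have b: "\<Omega> \<in> sets borel" "\<Omega> \<times> \<Omega> \<in> sets borel" using \<Omega> by (simp_all add: open_Times)
  have "AE x in lborel. x \<in> \<Omega> \<longrightarrow> P x" using P AE_lebesgue_on_iff[OF b(1)] by blast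
  then obtain N where N: "N \<in> null_sets lborel" "{x \<in> space lborel. \<not> (x \<in> \<Omega> \<longrightarrow> P x)} \<subseteq> N"
    unfolding eventually_ae_filter by blast
  have "AE p in lborel. p \<notin> N \<times> (UNIV :: 'a set)" "AE p in lborel. p \<notin> (UNIV :: 'a set) \<times> N"
    by (intro AE_not_in null_sets_lborel_Times N(1))+
  then have "AE p in lborel. p \<in> \<Omega> \<times> \<Omega> \<longrightarrow> P (fst p)" "AE p in lborel. p \<in> \<Omega> \<times> \<Omega> \<longrightarrow> P (snd p)"
    by (eventually_elim, use N(2) in auto)+
  then show "AE p in lebesgue_on (\<Omega> \<times> \<Omega>). P (fst p)" "AE p in lebesgue_on (\<Omega> \<times> \<Omega>). P (snd p)"
    using AE_lebesgue_on_iff[OF b(2)] by blast+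
qed

text \<open>
  The \<open>\<sigma>\<close>-algebra of the product of two Lebesgue measures lies between the Borel and the Lebesgue sets.
  An exceptional set in it is Lebesgue measurable, and Fubini's theorem for its Borel part shows
  that it is a null set.
\<close>

lemma AE_lebesgue_on_Times_of_pair:
  fixes \<Omega> :: "'a::euclidean_space set"
  assumes \<Omega>: "open \<Omega>" and P: "AE p in lebesgue_on \<Omega> \<Otimes>\<^sub>M lebesgue_on \<Omega>. P p"
    and fin: "finite_measure (lebesgue_on \<Omega>)"
  shows "AE p in lebesgue_on (\<Omega> \<times> \<Omega>). P p"
proof -
  interpret finite_measure "lebesgue_on \<Omega>" by fact
  interpret pair_sigma_finite "lebesgue_on \<Omega>" "lebesgue_on \<Omega>" ..
  have b: "\<Omega> \<in> sets borel" "\<Omega> \<times> \<Omega> \<in> sets borel" using \<Omega> by (simp_all add: open_Times)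
  obtain N where N: "N \<in> null_sets (lebesgue_on \<Omega> \<Otimes>\<^sub>M lebesgue_on \<Omega>)"
    "{p \<in> space (lebesgue_on \<Omega> \<Otimes>\<^sub>M lebesgue_on \<Omega>). \<not> P p} \<subseteq> N"
    using P unfolding eventually_ae_filter by blast
  have Ns: "N \<in> sets (lebesgue_on \<Omega> \<Otimes>\<^sub>M lebesgue_on \<Omega>)" using N(1) by auto
  have Nsub: "N \<subseteq> \<Omega> \<times> \<Omega>" using sets.sets_into_space[OF Ns] by (simp add: space_pair_measure)
  have "(\<lambda>p. (fst p, snd p)) \<in> lebesgue_on (\<Omega> \<times> \<Omega>) \<rightarrow>\<^sub>M lebesgue_on \<Omega> \<Otimes>\<^sub>M lebesgue_on \<Omega>"
    by (intro measurable_Pair lebesgue_on_measurable_fst_snd)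
  from measurable_sets[OF this Ns] have "N \<in> sets (lebesgue_on (\<Omega> \<times> \<Omega>))"
    using Nsub by (simp add: vimage_def Int_absorb2)
  then have "N \<in> sets lebesgue" using b(2) by (simp add: sets_restrict_space_iff)
  then obtain S N0 N1 where S: "N = S \<union> N0" "N0 \<subseteq> N1" "N1 \<in> null_sets lborel" "S \<in> sets lborel"
    by (elim sets_completionE)
  have "AE p in lebesgue_on \<Omega> \<Otimes>\<^sub>M lebesgue_on \<Omega>. p \<notin> N" by (rule AE_not_in[OF N(1)])
  then have "AE x in lebesgue_on \<Omega>. AE y in lebesgue_on \<Omega>. (x, y) \<notin> N" by (rule AE_pair)
  then have "AE x in lborel. x \<in> \<Omega> \<longrightarrow> (AE y in lborel. y \<in> \<Omega> \<longrightarrow> (x, y) \<notin> N)"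
    unfolding AE_lebesgue_on_iff[OF b(1)] .
  then have "AE x in lborel. AE y in lborel. (x, y) \<notin> S"
  proof eventually_elim
    case (elim x)
    show ?case
    proof (cases "x \<in> \<Omega>")
      case True
      with elim have "AE y in lborel. y \<in> \<Omega> \<longrightarrow> (x, y) \<notin> N" by blast
      then show ?thesis by eventually_elim (use S(1) Nsub in blast)
    next
      case False
      then show ?thesis using S(1) Nsub by (intro AE_I2) blast
    qed
  qed
  then have "AE p in lborel \<Otimes>\<^sub>M lborel. p \<notin> S"
  proof (intro lborel_pair.AE_pair_measure)
    have "S \<in> sets (lborel \<Otimes>\<^sub>M lborel)" using S(4) unfolding lborel_prod .
    then show "{p \<in> space (lborel \<Otimes>\<^sub>M lborel). p \<notin> S} \<in> sets (lborel \<Otimes>\<^sub>M lborel)" by measurable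
  qed
  then have "AE p in lborel. p \<notin> S" unfolding lborel_prod .
  moreover have "AE p in lborel. p \<notin> N1" by (rule AE_not_in[OF S(3)])
  ultimately have "AE p in lborel. p \<in> \<Omega> \<times> \<Omega> \<longrightarrow> P p"
  proof eventually_elim
    case (elim p)
    then have "p \<notin> N" using S by blast
    then show ?case using N(2) by (auto simp: space_pair_measure)
  qed
  then show ?thesis using AE_lebesgue_on_iff[OF b(2)] by blast
qed

section \<open>Lower semicontinuity of the supremal functional\<close>

lemma lower_semicontinuous_borel:
  fixes f :: "'a::second_countable_topology \<Rightarrow> real"
  assumes "lower_semicontinuous f"
  shows "open {x. t < f x}" "f \<in> borel_measurable borel"
proof -
  show o: "open {x. t < f x}" for t
  proof (subst open_subopen, rule ballI)
    fix x assume "x \<in> {x. t < f x}"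
    then have "\<forall>\<^sub>F y in nhds x. t < f y" using assms by (simp add: lower_semicontinuous_def)
    then obtain S where "open S" "x \<in> S" "\<forall>y\<in>S. t < f y" unfolding eventually_nhds by (elim exE conjE)
    then show "\<exists>T. open T \<and> x \<in> T \<and> T \<subseteq> {x. t < f x}" by (intro exI[of _ S]) auto
  qed
  show "f \<in> borel_measurable borel"
    by (rule borel_measurableI_greater) (use o in simp)
qed

text \<open>
  The set where \<open>V\<close> exceeds \<open>c\<close> is open and contains no pair of the sequence. So it is
  a union of base rectangles that no pair enters. There are countably many of them, and by hypothesis each has
  a factor of measure zero.
\<close>

lemma product_esssup_le:
  fixes V :: "'b::euclidean_space \<Rightarrow> 'b \<Rightarrow> real" and B :: "nat \<Rightarrow> 'b set"
  assumes lsc: "lower_semicontinuous (\<lambda>(\<xi>, \<zeta>). V \<xi> \<zeta>)"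
    and base: "\<And>n. open (B n)" "\<And>S x. open S \<Longrightarrow> x \<in> S \<Longrightarrow> \<exists>n. x \<in> B n \<and> B n \<subseteq> S"
    and \<nu>: "prob_space \<nu>" "sets \<nu> = sets borel" and \<mu>: "prob_space \<mu>" "sets \<mu> = sets borel"
    and le: "\<And>k. V (\<xi> k) (\<zeta> k) \<le> c"
    and null: "\<And>n n'. (\<And>k. \<not> (\<xi> k \<in> B n \<and> \<zeta> k \<in> B n')) \<Longrightarrow> emeasure \<nu> (B n) = 0 \<or> emeasure \<mu> (B n') = 0"
  shows "esssup (\<nu> \<Otimes>\<^sub>M \<mu>) (\<lambda>(\<xi>, \<zeta>). ereal (V \<xi> \<zeta>)) \<le> ereal c"
proof (rule esssup_I)
  interpret \<nu>: prob_space \<nu> by fact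
  interpret \<mu>: prob_space \<mu> by fact
  have sets_eq: "sets (\<nu> \<Otimes>\<^sub>M \<mu>) = sets (borel :: ('b \<times> 'b) measure)"
    using sets_pair_measure_cong[OF \<nu>(2) \<mu>(2)] unfolding borel_prod .
  have "(\<lambda>(\<xi>, \<zeta>). V \<xi> \<zeta>) \<in> borel_measurable borel" by (rule lower_semicontinuous_borel(2)[OF lsc])
  then have "(\<lambda>p. ereal ((\<lambda>(\<xi>, \<zeta>). V \<xi> \<zeta>) p)) \<in> borel_measurable borel" by measurable
  then have "(\<lambda>(\<xi>, \<zeta>). ereal (V \<xi> \<zeta>)) \<in> borel_measurable borel" by (simp add: case_prod_unfold)
  then show "(\<lambda>(\<xi>, \<zeta>). ereal (V \<xi> \<zeta>)) \<in> borel_measurable (\<nu> \<Otimes>\<^sub>M \<mu>)"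
    using measurable_cong_sets[OF sets_eq refl] by blast
  define J where "J = {(n, n'). \<forall>k. \<not> (\<xi> k \<in> B n \<and> \<zeta> k \<in> B n')}"
  have "(\<Union>i\<in>J. B (fst i) \<times> B (snd i)) \<in> null_sets (\<nu> \<Otimes>\<^sub>M \<mu>)"
  proof (rule null_sets_UN')
    show "countable J" by simp
    fix i assume i: "i \<in> J"
    have m: "B n \<in> sets \<nu>" "B n \<in> sets \<mu>" for n using base(1)[of n] \<nu>(2) \<mu>(2) by auto
    have "emeasure (\<nu> \<Otimes>\<^sub>M \<mu>) (B (fst i) \<times> B (snd i)) = emeasure \<nu> (B (fst i)) * emeasure \<mu> (B (snd i))"
      by (rule \<mu>.emeasure_pair_measure_Times[OF m(1) m(2)])
    also have "\<dots> = 0" using null[of "fst i" "snd i"] i by (auto simp: J_def)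
    finally show "B (fst i) \<times> B (snd i) \<in> null_sets (\<nu> \<Otimes>\<^sub>M \<mu>)" using m by (auto simp: null_sets_def)
  qed
  then have "AE p in \<nu> \<Otimes>\<^sub>M \<mu>. p \<notin> (\<Union>i\<in>J. B (fst i) \<times> B (snd i))" by (rule AE_not_in)
  then show "AE p in \<nu> \<Otimes>\<^sub>M \<mu>. (case p of (\<xi>, \<zeta>) \<Rightarrow> ereal (V \<xi> \<zeta>)) \<le> ereal c"
  proof eventually_elim
    case (elim p)
    obtain a b where p: "p = (a, b)" by fastforce
    have "V a b \<le> c"
    proof (rule ccontr)
      assume "\<not> V a b \<le> c"
      then have ab: "(a, b) \<in> {x. c < (\<lambda>(\<xi>, \<zeta>). V \<xi> \<zeta>) x}" by simp
      obtain S T where ST: "open S" "open T" "(a, b) \<in> S \<times> T" "S \<times> T \<subseteq> {x. c < (\<lambda>(\<xi>, \<zeta>). V \<xi> \<zeta>) x}"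
        using open_prod_elim[OF lower_semicontinuous_borel(1)[OF lsc] ab] by blast
      obtain n where n: "a \<in> B n" "B n \<subseteq> S" using base(2)[OF ST(1), of a] ST(3) by blast
      obtain n' where n': "b \<in> B n'" "B n' \<subseteq> T" using base(2)[OF ST(2), of b] ST(3) by blast
      have "\<not> (\<xi> k \<in> B n \<and> \<zeta> k \<in> B n')" for k
      proof
        assume "\<xi> k \<in> B n \<and> \<zeta> k \<in> B n'"
        then have "(\<xi> k, \<zeta> k) \<in> {x. c < (\<lambda>(\<xi>, \<zeta>). V \<xi> \<zeta>) x}" using n n' ST(4) by blast
        then show False using le[of k] by simp
      qed
      then have "(n, n') \<in> J" by (simp add: J_def)
      then have "p \<in> (\<Union>i\<in>J. B (fst i) \<times> B (snd i))" using n n' p by force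
      with elim show False by blast
    qed
    then show ?case by (simp add: p)
  qed
qed

text \<open>
  The functions are distances to the complements. For the whole space the distance to the empty set would be
  \<open>0\<close>, and the constant 1 takes its place.
\<close>

lemma countable_base_with_functions:
  obtains B :: "nat \<Rightarrow> 'b::euclidean_space set" and \<phi> :: "nat \<Rightarrow> 'b \<Rightarrow> real"
  where "\<And>n. open (B n)" "\<And>S x. open S \<Longrightarrow> x \<in> S \<Longrightarrow> \<exists>n. x \<in> B n \<and> B n \<subseteq> S"
    "\<And>n. continuous_on UNIV (\<phi> n)" "\<And>n x. 0 \<le> \<phi> n x" "\<And>n x. \<phi> n x \<noteq> 0 \<longleftrightarrow> x \<in> B n"
proof -
  obtain \<B> :: "'b set set" where \<B>: "countable \<B>" "topological_basis \<B>" using ex_countable_basis by blast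
  have "\<exists>B'\<in>\<B>. (0 :: 'b) \<in> B' \<and> B' \<subseteq> UNIV" by (rule topological_basisE[OF \<B>(2) open_UNIV UNIV_I]) blast
  then have ne: "\<B> \<noteq> {}" by blast
  define B where "B = from_nat_into \<B>"
  have B: "open (B n)" for n
    using from_nat_into[OF ne, of n] topological_basis_open[OF \<B>(2)] by (simp add: B_def)
  define \<phi> where "\<phi> n x = (if B n = UNIV then 1 else infdist x (- B n))" for n x
  show ?thesis
  proof (rule that[of B \<phi>, OF B])
    fix S :: "'b set" and x assume S: "open S" "x \<in> S"
    obtain C where C: "C \<in> \<B>" "x \<in> C" "C \<subseteq> S" by (rule topological_basisE[OF \<B>(2) S])
    obtain n where "B n = C" using from_nat_into_surj[OF \<B>(1) C(1)] by (auto simp: B_def)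
    then show "\<exists>n. x \<in> B n \<and> B n \<subseteq> S" using C by blast
  next
    show "continuous_on UNIV (\<phi> n)" for n
      by (cases "B n = UNIV") (auto simp: \<phi>_def[abs_def] intro!: continuous_intros)
    show "0 \<le> \<phi> n x" for n x by (simp add: \<phi>_def infdist_nonneg)
    show "\<phi> n x \<noteq> 0 \<longleftrightarrow> x \<in> B n" for n x
    proof (cases "B n = UNIV")
      case True then show ?thesis by (simp add: \<phi>_def)
    next
      case False
      then have "- B n \<noteq> {}" "closed (- B n)" using B[of n] by auto
      then have "infdist x (- B n) = 0 \<longleftrightarrow> x \<notin> B n" using in_closed_iff_infdist_zero[of "- B n" x] by auto
      then show ?thesis using False by (auto simp: \<phi>_def)
    qed
  qed
qed

text \<open>
  The sublevel form of lower semicontinuity. Only countably many exceptional null sets occur, one for each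
  index and each pair of base sets, so that quasiconvexity can be used at almost every single point \<open>(x, y)\<close>.
\<close>

lemma supremal_functional_le_of_sequence_le:
  fixes \<Omega> :: "(real ^ 'n) set"
    and W :: "real ^ 'n \<Rightarrow> real ^ 'n \<Rightarrow> real ^ 'n ^ 'd \<Rightarrow> real ^ 'n ^ 'd \<Rightarrow> real"
    and u :: "nat \<Rightarrow> real ^ 'n \<Rightarrow> real ^ 'd" and v :: "real ^ 'n \<Rightarrow> real ^ 'd" and c :: real
  assumes \<Omega>: "open \<Omega>" "bounded \<Omega>" and W: "normal_integrand \<Omega> W"
    and qc: "AE (x, y) in lebesgue_on (\<Omega> \<times> \<Omega>). separately_curl_Young_quasiconvex (W x y)"
    and u: "\<And>j. u j \<in> W1inf \<Omega>" and v: "v \<in> W1inf \<Omega>"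
    and lim: "Linf_weakstar_tendsto \<Omega> (\<lambda>j. weak_gradient \<Omega> (u j)) (weak_gradient \<Omega> v)"
    and le: "\<And>j. supremal_functional \<Omega> W (u j) \<le> ereal c"
  shows "supremal_functional \<Omega> W v \<le> ereal c"
proof -
  let ?L = "lebesgue_on \<Omega>" and ?L2 = "lebesgue_on (\<Omega> \<times> \<Omega>)"
  have \<Omega>b [measurable]: "\<Omega> \<in> sets borel" using \<Omega> by simp
  interpret L: finite_measure ?L by (rule finite_measure_lebesgue_on_open_bounded[OF \<Omega>])
  obtain q z \<nu> where q: "strict_mono (q :: nat \<Rightarrow> nat)" and z: "\<And>k. z k \<in> borel_measurable borel"
    "\<And>k. AE x in ?L. z k x = weak_gradient \<Omega> (u (q k)) x"
    and \<nu>: "AE x in ?L. homogeneous_W1inf_gradient_young_measure (\<nu> x)"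
    "AE x in ?L. barycenter (\<nu> x) = weak_gradient \<Omega> v x"
    and rep: "\<And>\<phi> :: real ^ 'n ^ 'd \<Rightarrow> real. continuous_on UNIV \<phi> \<Longrightarrow> \<exists>\<Psi> C. \<Psi> \<in> borel_measurable ?L \<and> (\<forall>x. \<bar>\<Psi> x\<bar> \<le> C) \<and>
      (\<forall>k x. \<bar>\<phi> (z k x)\<bar> \<le> C) \<and> (AE x in ?L. integrable (\<nu> x) \<phi> \<and> \<Psi> x = (LINT \<xi>|\<nu> x. \<phi> \<xi>)) \<and>
      (\<forall>h. integrable ?L h \<longrightarrow> (\<lambda>k. LINT x|?L. \<phi> (z k x) * h x) \<longlonglongrightarrow> (LINT x|?L. \<Psi> x * h x))"
    by (rule gradient_young_measure_exists[OF \<Omega> u v lim]) (rule that)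
  obtain B :: "nat \<Rightarrow> (real ^ 'n ^ 'd) set" and \<phi> :: "nat \<Rightarrow> real ^ 'n ^ 'd \<Rightarrow> real"
    where B: "\<And>n. open (B n)" "\<And>S x. open S \<Longrightarrow> x \<in> S \<Longrightarrow> \<exists>n. x \<in> B n \<and> B n \<subseteq> S"
      and \<phi>: "\<And>n. continuous_on UNIV (\<phi> n)" "\<And>n x. 0 \<le> \<phi> n x" "\<And>n x. \<phi> n x \<noteq> 0 \<longleftrightarrow> x \<in> B n"
    by (rule countable_base_with_functions) (rule that)
  have \<phi>m: "\<phi> n \<in> borel_measurable borel" for n using \<phi>(1) by (rule borel_measurable_continuous_onI)
  have zL: "z k \<in> borel_measurable ?L" for k by (rule borel_lebesgue_on[OF z(1)])
  have zero_part: "AE p in ?L2. (\<forall>k. \<not> (z k (fst p) \<in> B n \<and> z k (snd p) \<in> B n')) \<longrightarrow>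
      (LINT \<xi>|\<nu> (fst p). \<phi> n \<xi>) * (LINT \<xi>|\<nu> (snd p). \<phi> n' \<xi>) = 0" for n n'
  proof -
    obtain \<Psi> C where \<Psi>: "\<Psi> \<in> borel_measurable ?L" "\<And>x. \<bar>\<Psi> x\<bar> \<le> C" "\<And>k x. \<bar>\<phi> n (z k x)\<bar> \<le> C"
      "AE x in ?L. integrable (\<nu> x) (\<phi> n) \<and> \<Psi> x = (LINT \<xi>|\<nu> x. \<phi> n \<xi>)"
      "\<And>h. integrable ?L h \<Longrightarrow> (\<lambda>k. LINT x|?L. \<phi> n (z k x) * h x) \<longlonglongrightarrow> (LINT x|?L. \<Psi> x * h x)"
    proof -
      from rep[OF \<phi>(1)[of n]] show ?thesis by (elim exE conjE) (rule that, blast+)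
    qed
    obtain \<Psi>' C' where \<Psi>': "\<Psi>' \<in> borel_measurable ?L" "\<And>x. \<bar>\<Psi>' x\<bar> \<le> C'" "\<And>k x. \<bar>\<phi> n' (z k x)\<bar> \<le> C'"
      "AE x in ?L. integrable (\<nu> x) (\<phi> n') \<and> \<Psi>' x = (LINT \<xi>|\<nu> x. \<phi> n' \<xi>)"
      "\<And>h. integrable ?L h \<Longrightarrow> (\<lambda>k. LINT x|?L. \<phi> n' (z k x) * h x) \<longlonglongrightarrow> (LINT x|?L. \<Psi>' x * h x)"
    proof -
      from rep[OF \<phi>(1)[of n']] show ?thesis by (elim exE conjE) (rule that, blast+)
    qed
    \<comment> \<open>at the points of \<open>A\<close> no pair of gradients enters the rectangle, so that all products vanish\<close>
    define A where "A = {p \<in> space (?L \<Otimes>\<^sub>M ?L). \<forall>k. \<not> (z k (fst p) \<in> B n \<and> z k (snd p) \<in> B n')}"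
    have [measurable]: "B n \<in> sets borel" for n using B(1) by simp
    note [measurable] = zL
    have A: "A \<in> sets (?L \<Otimes>\<^sub>M ?L)" unfolding A_def by measurable
    have nn: "AE x in ?L. 0 \<le> \<Psi> x" "AE x in ?L. 0 \<le> \<Psi>' x"
    proof -
      show "AE x in ?L. 0 \<le> \<Psi> x" using \<Psi>(4) by eventually_elim (simp add: \<phi>(2))
      show "AE x in ?L. 0 \<le> \<Psi>' x" using \<Psi>'(4) by eventually_elim (simp add: \<phi>(2))
    qed
    have "AE p in ?L \<Otimes>\<^sub>M ?L. p \<in> A \<longrightarrow> \<Psi> (fst p) * \<Psi>' (snd p) = 0"
    proof (rule L.weakstar_tensor_AE_zero[of "\<lambda>k x. \<phi> n (z k x)" "max C C'" "\<lambda>k x. \<phi> n' (z k x)"])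
      show "(\<lambda>x. \<phi> n (z k x)) \<in> borel_measurable ?L" "(\<lambda>x. \<phi> n' (z k x)) \<in> borel_measurable ?L" for k
        by (rule measurable_compose[OF zL \<phi>m])+
      show "\<phi> n (z k (fst p)) * \<phi> n' (z k (snd p)) = 0" if "p \<in> A" for k p
      proof -
        have "z k (fst p) \<notin> B n \<or> z k (snd p) \<notin> B n'" using that unfolding A_def by blast
        then have "\<phi> n (z k (fst p)) = 0 \<or> \<phi> n' (z k (snd p)) = 0"
          using \<phi>(3)[of n "z k (fst p)"] \<phi>(3)[of n' "z k (snd p)"] by blast
        then show ?thesis by auto
      qed
    qed (use \<Psi> \<Psi>' nn A in \<open>auto intro: max.coboundedI1 max.coboundedI2\<close>)
    then have 1: "AE p in ?L2. p \<in> A \<longrightarrow> \<Psi> (fst p) * \<Psi>' (snd p) = 0"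
      by (rule AE_lebesgue_on_Times_of_pair[OF \<Omega>(1) _ L.finite_measure_axioms])
    have 2: "AE p in ?L2. \<Psi> (fst p) = (LINT \<xi>|\<nu> (fst p). \<phi> n \<xi>)"
      by (rule AE_lebesgue_on_Times_of_factor(1)[OF \<Omega>(1)]) (use \<Psi>(4) in \<open>eventually_elim, simp\<close>)
    have 3: "AE p in ?L2. \<Psi>' (snd p) = (LINT \<xi>|\<nu> (snd p). \<phi> n' \<xi>)"
      by (rule AE_lebesgue_on_Times_of_factor(2)[OF \<Omega>(1)]) (use \<Psi>'(4) in \<open>eventually_elim, simp\<close>)
    have 4: "AE p in ?L2. p \<in> \<Omega> \<times> \<Omega>" using AE_space by eventually_elim simp
    from 1 2 3 4 show ?thesis
      by eventually_elim (auto simp: A_def space_pair_measure)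
  qed
  have all_zero: "AE p in ?L2. \<forall>n n'. (\<forall>k. \<not> (z k (fst p) \<in> B n \<and> z k (snd p) \<in> B n')) \<longrightarrow>
      (LINT \<xi>|\<nu> (fst p). \<phi> n \<xi>) * (LINT \<xi>|\<nu> (snd p). \<phi> n' \<xi>) = 0"
    unfolding AE_all_countable using zero_part by blast
  have "AE x in ?L. \<forall>n. integrable (\<nu> x) (\<phi> n)"
  proof (subst AE_all_countable, rule allI)
    fix n
    obtain \<Psi> C where "AE x in ?L. integrable (\<nu> x) (\<phi> n) \<and> \<Psi> x = (LINT \<xi>|\<nu> x. \<phi> n \<xi>)"
      using rep[OF \<phi>(1)[of n]] by (elim exE conjE)
    then show "AE x in ?L. integrable (\<nu> x) (\<phi> n)" by eventually_elim simp
  qed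
  with \<nu> have "AE x in ?L. homogeneous_W1inf_gradient_young_measure (\<nu> x) \<and> barycenter (\<nu> x) = weak_gradient \<Omega> v x
    \<and> (\<forall>n. integrable (\<nu> x) (\<phi> n))" by eventually_elim blast
  note \<nu>2 = AE_lebesgue_on_Times_of_factor[OF \<Omega>(1) this]
  have "AE x in ?L. \<forall>k. z k x = weak_gradient \<Omega> (u (q k)) x"
    unfolding AE_all_countable using z(2) by blast
  note z2 = AE_lebesgue_on_Times_of_factor[OF \<Omega>(1) this]
  have "AE p in ?L2. W (fst p) (snd p) (weak_gradient \<Omega> (u j) (fst p)) (weak_gradient \<Omega> (u j) (snd p)) \<le> c" for j
    using esssup_AE[of "\<lambda>(x, y). ereal (W x y (weak_gradient \<Omega> (u j) x) (weak_gradient \<Omega> (u j) y))" ?L2]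
  proof eventually_elim
    case (elim p)
    also have "esssup ?L2 (\<lambda>(x, y). ereal (W x y (weak_gradient \<Omega> (u j) x) (weak_gradient \<Omega> (u j) y))) \<le> ereal c"
      using le[of j] by (simp add: supremal_functional_def)
    finally show ?case by (simp add: case_prod_unfold)
  qed
  then have W2: "AE p in ?L2. \<forall>j. W (fst p) (snd p) (weak_gradient \<Omega> (u j) (fst p)) (weak_gradient \<Omega> (u j) (snd p)) \<le> c"
    unfolding AE_all_countable by blast
  have null: "emeasure \<mu> (B n) = 0" if int: "integrable \<mu> (\<phi> n)" and z: "(LINT \<xi>|\<mu>. \<phi> n \<xi>) = 0" and s: "sets \<mu> = sets borel" for \<mu> n
  proof -
    have "AE \<xi> in \<mu>. \<phi> n \<xi> = 0"
      using integral_nonneg_eq_0_iff_AE[OF int] \<phi>(2) z by simp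
    then have ae: "AE \<xi> in \<mu>. \<xi> \<notin> B n" by eventually_elim (use \<phi>(3) in blast)
    have Bs: "B n \<in> sets \<mu>" using B(1)[of n] s by simp
    have "{x \<in> space \<mu>. \<not> x \<notin> B n} = B n" using sets.sets_into_space[OF Bs] by blast
    with ae Bs show ?thesis using AE_iff_measurable[of "B n" \<mu> "\<lambda>x. x \<notin> B n"] by blast
  qed
  have "AE p in ?L2. (case p of (x, y) \<Rightarrow> ereal (W x y (weak_gradient \<Omega> v x) (weak_gradient \<Omega> v y))) \<le> ereal c"
    using all_zero \<nu>2 z2 W2 qc
  proof eventually_elim
    case (elim p)
    obtain x y where p: "p = (x, y)" by fastforce
    have hx: "homogeneous_W1inf_gradient_young_measure (\<nu> x)" "barycenter (\<nu> x) = weak_gradient \<Omega> v x" "\<And>n. integrable (\<nu> x) (\<phi> n)"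
      and hy: "homogeneous_W1inf_gradient_young_measure (\<nu> y)" "barycenter (\<nu> y) = weak_gradient \<Omega> v y" "\<And>n. integrable (\<nu> y) (\<phi> n)"
      using elim(2,3) by (auto simp: p)
    have sx: "prob_space (\<nu> x)" "sets (\<nu> x) = sets borel" and sy: "prob_space (\<nu> y)" "sets (\<nu> y) = sets borel"
      using hx(1) hy(1) by (auto simp: homogeneous_W1inf_gradient_young_measure_def)
    have qcp: "separately_curl_Young_quasiconvex (W x y)" using elim(7) by (simp add: p)
    have "ereal (W x y (barycenter (\<nu> x)) (barycenter (\<nu> y))) \<le> esssup (\<nu> x \<Otimes>\<^sub>M \<nu> y) (\<lambda>(\<xi>, \<zeta>). ereal (W x y \<xi> \<zeta>))"
      using qcp hx(1) hy(1) unfolding separately_curl_Young_quasiconvex_def by blast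
    also have "\<dots> \<le> ereal c"
    proof (rule product_esssup_le[OF _ B sx sy])
      show "lower_semicontinuous (\<lambda>(\<xi>, \<zeta>). W x y \<xi> \<zeta>)" using qcp unfolding separately_curl_Young_quasiconvex_def by blast
      show "W x y (z k x) (z k y) \<le> c" for k
      proof -
        have "z k x = weak_gradient \<Omega> (u (q k)) x" "z k y = weak_gradient \<Omega> (u (q k)) y" using elim(4,5) by (simp_all add: p)
        then show ?thesis using elim(6) by (simp add: p)
      qed
      fix n n' assume "\<And>k. \<not> (z k x \<in> B n \<and> z k y \<in> B n')"
      then have "(LINT \<xi>|\<nu> x. \<phi> n \<xi>) * (LINT \<xi>|\<nu> y. \<phi> n' \<xi>) = 0" using elim(1) by (simp add: p)
      then show "emeasure (\<nu> x) (B n) = 0 \<or> emeasure (\<nu> y) (B n') = 0"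
        using null[OF hx(3) _ sx(2)] null[OF hy(3) _ sy(2)] by (auto simp: mult_eq_0_iff)
    qed
    finally show ?case by (simp add: p hx(2) hy(2))
  qed
  moreover have "(\<lambda>(x, y). ereal (W x y (weak_gradient \<Omega> v x) (weak_gradient \<Omega> v y))) \<in> borel_measurable ?L2"
  proof -
    have Wm: "(\<lambda>((x, y), (\<xi>, \<zeta>)). W x y \<xi> \<zeta>) \<in> borel_measurable (?L2 \<Otimes>\<^sub>M borel)"
      using W unfolding normal_integrand_def by blast
    have Gm: "weak_gradient \<Omega> v \<in> borel_measurable ?L" by (rule borel_measurable_gradient[OF v])
    have "(\<lambda>p. (weak_gradient \<Omega> v (fst p), weak_gradient \<Omega> v (snd p))) \<in> ?L2 \<rightarrow>\<^sub>M borel"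
      unfolding borel_prod[symmetric]
      by (intro measurable_Pair measurable_compose[OF lebesgue_on_measurable_fst_snd(1) Gm] measurable_compose[OF lebesgue_on_measurable_fst_snd(2) Gm])
    then have "(\<lambda>p. (p, (weak_gradient \<Omega> v (fst p), weak_gradient \<Omega> v (snd p)))) \<in> ?L2 \<rightarrow>\<^sub>M ?L2 \<Otimes>\<^sub>M borel"
      by (intro measurable_Pair measurable_ident_sets[OF refl])
    from measurable_compose[OF this Wm]
    have "(\<lambda>p. W (fst p) (snd p) (weak_gradient \<Omega> v (fst p)) (weak_gradient \<Omega> v (snd p))) \<in> borel_measurable ?L2"
      by (simp add: case_prod_unfold)
    then show ?thesis unfolding case_prod_unfold by measurable
  qed
  ultimately show ?thesis unfolding supremal_functional_def by (intro esssup_I)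
qed

theorem theorem2p5:
  fixes \<Omega> :: "(real ^ 'n) set"
    and W :: "real ^ 'n \<Rightarrow> real ^ 'n \<Rightarrow> real ^ 'n ^ 'd \<Rightarrow> real ^ 'n ^ 'd \<Rightarrow> real"
    and u :: "nat \<Rightarrow> real ^ 'n \<Rightarrow> real ^ 'd"
    and v :: "real ^ 'n \<Rightarrow> real ^ 'd"
  assumes "open \<Omega>" and "bounded \<Omega>"
    and "normal_integrand \<Omega> W"
    and "\<exists>c. \<forall>x \<in> \<Omega>. \<forall>y \<in> \<Omega>. \<forall>\<xi> \<zeta>. c \<le> W x y \<xi> \<zeta>"
    and "AE (x, y) in lebesgue_on (\<Omega> \<times> \<Omega>). separately_curl_Young_quasiconvex (W x y)"
    and "\<And>j. u j \<in> W1inf \<Omega>" and "v \<in> W1inf \<Omega>"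
    and "W1inf_weakstar_tendsto \<Omega> u v"
  shows "supremal_functional \<Omega> W v \<le> liminf (\<lambda>j. supremal_functional \<Omega> W (u j))"
proof (rule ccontr)
  assume "\<not> ?thesis"
  then have "liminf (\<lambda>j. supremal_functional \<Omega> W (u j)) < supremal_functional \<Omega> W v" by simp
  then obtain c :: real where c: "liminf (\<lambda>j. supremal_functional \<Omega> W (u j)) < ereal c"
      "ereal c < supremal_functional \<Omega> W v"
    using ereal_dense2 by blast
  have freq: "\<exists>j\<ge>N. supremal_functional \<Omega> W (u j) \<le> ereal c" for N
  proof (rule ccontr)
    assume "\<not> ?thesis"
    then have "\<forall>\<^sub>F j in sequentially. ereal c \<le> supremal_functional \<Omega> W (u j)"
      by (intro eventually_sequentiallyI[of N]) auto
    then have "ereal c \<le> liminf (\<lambda>j. supremal_functional \<Omega> W (u j))" by (rule Liminf_bounded)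
    with c(1) show False by simp
  qed
  have "\<exists>q :: nat \<Rightarrow> nat. strict_mono q \<and> (\<forall>k. supremal_functional \<Omega> W (u (q k)) \<le> ereal c)"
  proof -
    have "infinite {j. supremal_functional \<Omega> W (u j) \<le> ereal c}"
      unfolding infinite_nat_iff_unbounded_le using freq by blast
    from infinite_enumerate[OF this] show ?thesis by blast
  qed
  then obtain q :: "nat \<Rightarrow> nat" where q: "strict_mono q" "\<And>k. supremal_functional \<Omega> W (u (q k)) \<le> ereal c" by blast
  have "Linf_weakstar_tendsto \<Omega> (\<lambda>j. weak_gradient \<Omega> (u j)) (weak_gradient \<Omega> v)"
    using assms(8) by (simp add: W1inf_weakstar_tendsto_def)
  then have lim: "Linf_weakstar_tendsto \<Omega> (\<lambda>k. weak_gradient \<Omega> (u (q k))) (weak_gradient \<Omega> v)"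
    unfolding Linf_weakstar_tendsto_def
    using LIMSEQ_subseq_LIMSEQ[OF _ q(1)] unfolding comp_def by blast
  have "supremal_functional \<Omega> W v \<le> ereal c"
    by (rule supremal_functional_le_of_sequence_le[OF assms(1-3,5,6,7) lim q(2)])
  with c(2) show False by simp
qed

end
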